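(* Let $R$ be a right generalized $\delta$-perfect ring. Then the Jacobson radical $J(R/S_r)$ of the ring $R/S_r$ is right $T$-nilpotent. In particular, idempotents lift modulo $\delta_r$.
   Context: Rings are associative with identity; modules are unitary right modules. $S_r=\operatorname{Soc}(R_R)$ is the right socle of $R$ (a two-sided ideal), and $\delta_r$ is the intersection of all essential maximal right ideals of $R$ (with $\delta_r=R$ if there are none). A submodule $N$ of a module $M$ is $\delta$-small in $M$, written $N\ll_\delta M$, if $N+K\neq M$ for every proper submodule $K$ of $M$ with $M/K$ singular (a module is singular if each of its elements is annihilated by some essential right ideal of $R$). A flat $\delta$-cover of $M$ is an epimorphism $f:F\to M$ with $F$ flat and $\operatorname{Ker}(f)\ll_\delta F$. $R$ is right generalized $\delta$-perfect (right $G$-$\delta$-perfect) if every right $R$-module has a flat $\delta$-cover. A subset $S$ of a ring is right $T$-nilpotent if for every sequence $a_1,a_2,\ldots$ in $S$ there is an integer $n\ge 1$ with $a_n\cdots a_2a_1=0$. *)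

theory Defs
  imports "HOL-Algebra.Module" "HOL-Algebra.QuotRing" "HOL-Algebra.Free_Abelian_Groups"
begin

section \<open>One-sided modules over a noncommutative ring\<close>

text \<open>
  The library locale \<^locale>\<open>module\<close> requires a commutative ring, so one-sided modules are
  introduced here on the library's \<^emph>\<open>record\<close> of modules.  For a \<^emph>\<open>right\<close> module the term
  \<open>a \<odot>\<^bsub>M\<^esub> x\<close> denotes \<open>x \<cdot> a\<close>, i.e. the scalar is still the first argument of the operation;
  this is reflected in the associativity law.  The locale \<^locale>\<open>submodule\<close> does not mention
  commutativity or associativity, so it is used unchanged for left and right modules.
\<close>

locale onesided_module = R?: ring R + M?: abelian_group M
  for R :: "('a, 'c) ring_scheme" (structure) and M :: "('a, 'b, 'd) module_scheme" (structure) +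
  assumes act_closed:
      "\<lbrakk>a \<in> carrier R; x \<in> carrier M\<rbrakk> \<Longrightarrow> a \<odot>\<^bsub>M\<^esub> x \<in> carrier M"
    and act_add_scalar:
      "\<lbrakk>a \<in> carrier R; b \<in> carrier R; x \<in> carrier M\<rbrakk>
        \<Longrightarrow> (a \<oplus>\<^bsub>R\<^esub> b) \<odot>\<^bsub>M\<^esub> x = a \<odot>\<^bsub>M\<^esub> x \<oplus>\<^bsub>M\<^esub> b \<odot>\<^bsub>M\<^esub> x"
    and act_add_vector:
      "\<lbrakk>a \<in> carrier R; x \<in> carrier M; y \<in> carrier M\<rbrakk>
        \<Longrightarrow> a \<odot>\<^bsub>M\<^esub> (x \<oplus>\<^bsub>M\<^esub> y) = a \<odot>\<^bsub>M\<^esub> x \<oplus>\<^bsub>M\<^esub> a \<odot>\<^bsub>M\<^esub> y"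
    and act_one:
      "x \<in> carrier M \<Longrightarrow> \<one>\<^bsub>R\<^esub> \<odot>\<^bsub>M\<^esub> x = x"

locale left_module = onesided_module +
  assumes left_assoc:
      "\<lbrakk>a \<in> carrier R; b \<in> carrier R; x \<in> carrier M\<rbrakk>
        \<Longrightarrow> (a \<otimes>\<^bsub>R\<^esub> b) \<odot>\<^bsub>M\<^esub> x = a \<odot>\<^bsub>M\<^esub> (b \<odot>\<^bsub>M\<^esub> x)"

locale right_module = onesided_module +
  assumes right_assoc:
      "\<lbrakk>a \<in> carrier R; b \<in> carrier R; x \<in> carrier M\<rbrakk>
        \<Longrightarrow> (a \<otimes>\<^bsub>R\<^esub> b) \<odot>\<^bsub>M\<^esub> x = b \<odot>\<^bsub>M\<^esub> (a \<odot>\<^bsub>M\<^esub> x)"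

definition right_regular :: "('a, 'c) ring_scheme \<Rightarrow> ('a, 'a) module" where
  "right_regular R =
     \<lparr>carrier = carrier R, monoid.mult = monoid.mult R, one = \<one>\<^bsub>R\<^esub>,
      ring.zero = \<zero>\<^bsub>R\<^esub>, ring.add = ring.add R,
      smult = (\<lambda>a x. x \<otimes>\<^bsub>R\<^esub> a)\<rparr>"

text \<open>
  The ring multiplication and unit in a module record are irrelevant; the action on cosets
  follows the pattern of \<^const>\<open>FactRing\<close>.
\<close>

definition quot_module :: "('a, 'b, 'd) module_scheme \<Rightarrow> 'b set \<Rightarrow> ('a, 'b set) module" where
  "quot_module M K =
     \<lparr>carrier = a_rcosets\<^bsub>M\<^esub> K, monoid.mult = undefined, one = undefined,
      ring.zero = K, ring.add = set_add M,
      smult = (\<lambda>a C. \<Union>x\<in>C. K +>\<^bsub>M\<^esub> (a \<odot>\<^bsub>M\<^esub> x))\<rparr>"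

definition module_hom ::
    "('a, 'c) ring_scheme \<Rightarrow> ('a, 'b, 'd) module_scheme \<Rightarrow> ('a, 'e, 'f) module_scheme
      \<Rightarrow> ('b \<Rightarrow> 'e) set" where
  "module_hom R M N =
     {f \<in> carrier M \<rightarrow> carrier N.
        (\<forall>x \<in> carrier M. \<forall>y \<in> carrier M. f (x \<oplus>\<^bsub>M\<^esub> y) = f x \<oplus>\<^bsub>N\<^esub> f y) \<and>
        (\<forall>a \<in> carrier R. \<forall>x \<in> carrier M. f (a \<odot>\<^bsub>M\<^esub> x) = a \<odot>\<^bsub>N\<^esub> f x)}"


section \<open>Socle, essential submodules, radicals\<close>

definition simple_submodule ::
    "'b set \<Rightarrow> ('a, 'c) ring_scheme \<Rightarrow> ('a, 'b, 'd) module_scheme \<Rightarrow> bool" where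
  "simple_submodule S R M \<longleftrightarrow>
     submodule S R M \<and> S \<noteq> {\<zero>\<^bsub>M\<^esub>} \<and>
     (\<forall>N. submodule N R M \<and> N \<subseteq> S \<longrightarrow> N = {\<zero>\<^bsub>M\<^esub>} \<or> N = S)"

text \<open>The sum of all simple submodules, i.e. the least submodule containing all of them.\<close>

definition Soc :: "('a, 'c) ring_scheme \<Rightarrow> ('a, 'b, 'd) module_scheme \<Rightarrow> 'b set" where
  "Soc R M = \<Inter>{N. submodule N R M \<and> (\<forall>S. simple_submodule S R M \<longrightarrow> S \<subseteq> N)}"

definition essential_submodule ::
    "'b set \<Rightarrow> ('a, 'c) ring_scheme \<Rightarrow> ('a, 'b, 'd) module_scheme \<Rightarrow> bool" where
  "essential_submodule N R M \<longleftrightarrow>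
     submodule N R M \<and>
     (\<forall>K. submodule K R M \<and> K \<noteq> {\<zero>\<^bsub>M\<^esub>} \<longrightarrow> N \<inter> K \<noteq> {\<zero>\<^bsub>M\<^esub>})"

definition maximal_submodule ::
    "'b set \<Rightarrow> ('a, 'c) ring_scheme \<Rightarrow> ('a, 'b, 'd) module_scheme \<Rightarrow> bool" where
  "maximal_submodule N R M \<longleftrightarrow>
     submodule N R M \<and> N \<noteq> carrier M \<and>
     (\<forall>K. submodule K R M \<and> N \<subseteq> K \<longrightarrow> K = N \<or> K = carrier M)"

abbreviation essential_right_ideal :: "'a set \<Rightarrow> ('a, 'c) ring_scheme \<Rightarrow> bool" where
  "essential_right_ideal I R \<equiv> essential_submodule I R (right_regular R)"

abbreviation maximal_right_ideal :: "'a set \<Rightarrow> ('a, 'c) ring_scheme \<Rightarrow> bool" where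
  "maximal_right_ideal I R \<equiv> maximal_submodule I R (right_regular R)"

definition right_socle :: "('a, 'c) ring_scheme \<Rightarrow> 'a set" where
  "right_socle R = Soc R (right_regular R)"

text \<open>In both intersections below the empty intersection is the whole ring.\<close>

definition delta_right :: "('a, 'c) ring_scheme \<Rightarrow> 'a set" where
  "delta_right R =
     {x \<in> carrier R. \<forall>I. essential_right_ideal I R \<and> maximal_right_ideal I R \<longrightarrow> x \<in> I}"

definition jacobson_radical :: "('a, 'c) ring_scheme \<Rightarrow> 'a set" where
  "jacobson_radical R = {x \<in> carrier R. \<forall>I. maximal_right_ideal I R \<longrightarrow> x \<in> I}"


section \<open>Singular modules and \<open>\<delta>\<close>-small submodules\<close>

definition singular_module ::
    "('a, 'c) ring_scheme \<Rightarrow> ('a, 'b, 'd) module_scheme \<Rightarrow> bool" where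
  "singular_module R M \<longleftrightarrow>
     (\<forall>x \<in> carrier M. \<exists>I. essential_right_ideal I R \<and> (\<forall>a \<in> I. a \<odot>\<^bsub>M\<^esub> x = \<zero>\<^bsub>M\<^esub>))"

definition delta_small ::
    "'b set \<Rightarrow> ('a, 'c) ring_scheme \<Rightarrow> ('a, 'b, 'd) module_scheme \<Rightarrow> bool" where
  "delta_small N R M \<longleftrightarrow>
     submodule N R M \<and>
     (\<forall>K. submodule K R M \<and> K \<noteq> carrier M \<and> singular_module R (quot_module M K)
        \<longrightarrow> N <+>\<^bsub>M\<^esub> K \<noteq> carrier M)"


section \<open>Tensor products and flat modules\<close>

text \<open>
  For a right module \<open>F\<close> and a left module \<open>A\<close>, the tensor product is the free abelian group on
  \<open>F \<times> A\<close> modulo the subgroup generated by the bilinearity and balancing relations.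
  The group \<^const>\<open>free_Abelian_group\<close> is a multiplicatively written record whose operation is the
  addition of finitely supported integer functions.
\<close>

definition tensor_gens ::
    "('a, 'c) ring_scheme \<Rightarrow> ('a, 'f, 'd) module_scheme \<Rightarrow> ('a, 'l, 'e) module_scheme
      \<Rightarrow> (('f \<times> 'l) \<Rightarrow>\<^sub>0 int) set" where
  "tensor_gens R F A =
     {frag_of (x \<oplus>\<^bsub>F\<^esub> y, u) - frag_of (x, u) - frag_of (y, u) | x y u.
        x \<in> carrier F \<and> y \<in> carrier F \<and> u \<in> carrier A} \<union>
     {frag_of (x, u \<oplus>\<^bsub>A\<^esub> v) - frag_of (x, u) - frag_of (x, v) | x u v.
        x \<in> carrier F \<and> u \<in> carrier A \<and> v \<in> carrier A} \<union>
     {frag_of (a \<odot>\<^bsub>F\<^esub> x, u) - frag_of (x, a \<odot>\<^bsub>A\<^esub> u) | a x u.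
        a \<in> carrier R \<and> x \<in> carrier F \<and> u \<in> carrier A}"

definition tensor_rels ::
    "('a, 'c) ring_scheme \<Rightarrow> ('a, 'f, 'd) module_scheme \<Rightarrow> ('a, 'l, 'e) module_scheme
      \<Rightarrow> (('f \<times> 'l) \<Rightarrow>\<^sub>0 int) set" where
  "tensor_rels R F A =
     generate (free_Abelian_group (carrier F \<times> carrier A)) (tensor_gens R F A)"

definition tensor_product ::
    "('a, 'c) ring_scheme \<Rightarrow> ('a, 'f, 'd) module_scheme \<Rightarrow> ('a, 'l, 'e) module_scheme
      \<Rightarrow> (('f \<times> 'l) \<Rightarrow>\<^sub>0 int) set monoid" where
  "tensor_product R F A =
     free_Abelian_group (carrier F \<times> carrier A) Mod tensor_rels R F A"

text \<open>The homomorphism \<open>id \<otimes> g : F \<otimes> A \<rightarrow> F \<otimes> B\<close> induced by \<open>g : A \<rightarrow> B\<close>, on cosets.\<close>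

definition tensor_map ::
    "('a, 'c) ring_scheme \<Rightarrow> ('a, 'f, 'd) module_scheme \<Rightarrow> ('a, 'l, 'e) module_scheme
      \<Rightarrow> ('k \<Rightarrow> 'l) \<Rightarrow> (('f \<times> 'k) \<Rightarrow>\<^sub>0 int) set \<Rightarrow> (('f \<times> 'l) \<Rightarrow>\<^sub>0 int) set" where
  "tensor_map R F B g C =
     (\<Union>t\<in>C. tensor_rels R F B #>\<^bsub>free_Abelian_group (carrier F \<times> carrier B)\<^esub>
              frag_extend (\<lambda>(x, u). frag_of (x, g u)) t)"

text \<open>
  \<open>F\<close> is flat if \<open>F \<otimes> -\<close> preserves monomorphisms of left modules.  HOL cannot quantify over all
  types inside a formula, so the class of test modules is the class of left modules
  with elements in a type \<open>'l\<close>.  By the ideal criterion, all types into which \<open>carrier R\<close>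
  injects give the same notion.
\<close>

definition flat_module ::
    "'l itself \<Rightarrow> ('a, 'c) ring_scheme \<Rightarrow> ('a, 'f, 'd) module_scheme \<Rightarrow> bool" where
  "flat_module (_ :: 'l itself) R F \<longleftrightarrow>
     right_module R F \<and>
     (\<forall>(A :: ('a, 'l) module) (B :: ('a, 'l) module).
        left_module R A \<and> left_module R B \<longrightarrow>
        (\<forall>g \<in> module_hom R A B. inj_on g (carrier A) \<longrightarrow>
           inj_on (tensor_map R F B g) (carrier (tensor_product R F A))))"


section \<open>Flat \<open>\<delta>\<close>-covers and generalized \<open>\<delta>\<close>-perfect rings\<close>

definition flat_delta_cover ::
    "'l itself \<Rightarrow> ('a, 'c) ring_scheme \<Rightarrow> ('a, 'f, 'd) module_scheme
      \<Rightarrow> ('a, 'b, 'e) module_scheme \<Rightarrow> ('f \<Rightarrow> 'b) \<Rightarrow> bool" where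
  "flat_delta_cover L R F M f \<longleftrightarrow>
     flat_module L R F \<and> f \<in> module_hom R F M \<and> f ` carrier F = carrier M \<and>
     delta_small (a_kernel F M f) R F"

text \<open>
  The two type arguments are the universes: every right \<open>R\<close>-module with elements in \<open>'m\<close> has a flat
  \<open>\<delta>\<close>-cover with elements in \<open>'f\<close> (flatness being tested on left modules with elements in \<open>'m\<close>).
  The condition on \<open>R\<close> in the absolute sense implies this one for every \<open>'m\<close> and all
  sufficiently large \<open>'f\<close>.
\<close>

definition right_G_delta_perfect ::
    "'m itself \<Rightarrow> 'f itself \<Rightarrow> ('a, 'c) ring_scheme \<Rightarrow> bool" where
  "right_G_delta_perfect (_ :: 'm itself) (_ :: 'f itself) R \<longleftrightarrow>
     ring R \<and>
     (\<forall>M :: ('a, 'm) module. right_module R M \<longrightarrow>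
        (\<exists>(F :: ('a, 'f) module) f. flat_delta_cover TYPE('m) R F M f))"


section \<open>T-nilpotence and lifting of idempotents\<close>

primrec left_growing_prod :: "('a, 'c) ring_scheme \<Rightarrow> (nat \<Rightarrow> 'a) \<Rightarrow> nat \<Rightarrow> 'a" where
  "left_growing_prod R s 0 = \<one>\<^bsub>R\<^esub>"
| "left_growing_prod R s (Suc n) = s (Suc n) \<otimes>\<^bsub>R\<^esub> left_growing_prod R s n"

text \<open>
  \<^term>\<open>left_growing_prod R s n\<close> is \<open>s n \<otimes> \<dots> \<otimes> s 2 \<otimes> s 1\<close>; sequences are indexed from 1 and
  the value \<open>s 0\<close> is never used.
\<close>

definition right_T_nilpotent :: "('a, 'c) ring_scheme \<Rightarrow> 'a set \<Rightarrow> bool" where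
  "right_T_nilpotent R S \<longleftrightarrow>
     (\<forall>s :: nat \<Rightarrow> 'a. (\<forall>i\<ge>1. s i \<in> S) \<longrightarrow>
        (\<exists>n\<ge>1. left_growing_prod R s n = \<zero>\<^bsub>R\<^esub>))"

definition idempotents_lift_modulo :: "('a, 'c) ring_scheme \<Rightarrow> 'a set \<Rightarrow> bool" where
  "idempotents_lift_modulo R I \<longleftrightarrow>
     (\<forall>x \<in> carrier R. x \<otimes>\<^bsub>R\<^esub> x \<ominus>\<^bsub>R\<^esub> x \<in> I \<longrightarrow>
        (\<exists>e \<in> carrier R. e \<otimes>\<^bsub>R\<^esub> e = e \<and> e \<ominus>\<^bsub>R\<^esub> x \<in> I))"

end

theory Submission
  imports Defs
begin

text \<open>
Write \<open>S\<close> for the right socle and \<open>D\<close> for \<open>\<delta>\<^sub>r\<close>.  A maximal right ideal is essential exactly when it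
contains \<open>S\<close>, so \<open>D\<close> is the preimage of \<open>J(R/S)\<close> under \<open>R \<rightarrow> R/S\<close> (\<open>delta_right_iff\<close>).  Hence \<open>D\<close> is an
ideal, every \<open>1 - d\<close> with \<open>d \<in> D\<close> has a left inverse modulo \<open>S\<close>, and T-nilpotence of \<open>J(R/S)\<close> means:
for every sequence \<open>a\<^sub>1, a\<^sub>2, \<dots>\<close> in \<open>D\<close> some product \<open>a\<^sub>n \<cdots> a\<^sub>1\<close> lies in \<open>S\<close>.

T-nilpotence is obtained from a flat \<open>\<delta>\<close>-cover \<open>f : F \<rightarrow> (R/D)\<^sup>(\<^sup>\<nat>\<^sup>)\<close>, by three observations.

\<^item> A submodule of \<open>F\<close> that contains \<open>FS\<close> and is mapped onto \<open>(R/D)\<^sup>(\<^sup>\<nat>\<^sup>)\<close> is all of \<open>F\<close>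
  (\<open>delta_small_supplement\<close>): modulo \<open>FS\<close>, a \<open>\<delta>\<close>-small submodule is small.

\<^item> If \<open>\<Sum> x\<^sub>t u\<^sub>t = 0\<close> in the flat module \<open>F\<close> with all \<open>u\<^sub>t\<close> in a left ideal \<open>A\<close>, then
  \<open>\<Sum> x\<^sub>t \<otimes> u\<^sub>t = 0\<close> already in \<open>F \<otimes> A\<close>, because \<open>F \<otimes> A \<rightarrow> F \<otimes> R\<close> is injective.  A homomorphism
  \<open>h : F \<rightarrow> R/D\<close> then sends this element to \<open>\<Sum> h(x\<^sub>t) u\<^sub>t = 0\<close> in \<open>R/D \<otimes> A = A/DA\<close>
  (\<open>flat_relation_vanishes\<close>).

\<^item> Consequently, if \<open>v\<^sub>0, \<dots>, v\<^sub>n \<in> F\<close> lift the unit vectors and \<open>\<Sum> v\<^sub>k p\<^sub>k \<in> FS\<close>, then all \<open>p\<^sub>k\<close> lie in \<open>S\<close>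
  (\<open>relation_coefficients_in_socle\<close>): for \<open>A = \<Sum> R p\<^sub>k + S\<close>, taking the coordinates of \<open>f\<close> as \<open>h\<close>
  gives \<open>p\<^sub>k \<in> \<Sum> D p\<^sub>j + S\<close> for all \<open>k\<close>, and Nakayama's lemma applies.

Now lift the unit vectors to \<open>y\<^sub>0, y\<^sub>1, \<dots>\<close> and put \<open>g\<^sub>k = y\<^sub>k - y\<^sub>k\<^sub>+\<^sub>1 a\<^sub>k\<^sub>+\<^sub>1\<close>, as in Bass's construction.  The
\<open>g\<^sub>k\<close> also lift the unit vectors, so together with \<open>FS\<close> they generate \<open>F\<close>, and \<open>y\<^sub>0\<close> lies in
\<open>g\<^sub>0 R + \<dots> + g\<^sub>n\<^sub>-\<^sub>1 R + FS\<close> for some \<open>n\<close>.  On the other hand \<open>y\<^sub>0\<close> telescopes to a combination of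
\<open>g\<^sub>0, \<dots>, g\<^sub>n\<^sub>-\<^sub>1\<close> plus \<open>y\<^sub>n a\<^sub>n \<cdots> a\<^sub>1\<close>.  Comparing the two gives a relation modulo \<open>FS\<close> among the lifts
\<open>g\<^sub>0, \<dots>, g\<^sub>n\<^sub>-\<^sub>1, y\<^sub>n\<close>, in which \<open>y\<^sub>n\<close> has the coefficient \<open>a\<^sub>n \<cdots> a\<^sub>1\<close> up to sign.

For idempotents, let \<open>x\<^sup>2 - x \<in> D\<close>.  T-nilpotence puts a power \<open>t\<close> of \<open>x\<^sup>2 - x\<close> into \<open>S\<close>.  Since \<open>tR\<close> has
finite length, Fitting's lemma splits \<open>R\<close> by an idempotent \<open>g \<in> S\<close> that commutes with \<open>x\<close> such that a
power of \<open>t\<close> vanishes on \<open>(1 - g)R\<close>.  There \<open>x\<close> is idempotent up to a nilpotent element, and the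
classical lifting of idempotents modulo nilpotents finishes the proof.
\<close>

section \<open>Submodules of one-sided modules\<close>

lemma (in onesided_module) zero_act:
  assumes x: "x \<in> carrier M"
  shows "\<zero>\<^bsub>R\<^esub> \<odot>\<^bsub>M\<^esub> x = \<zero>\<^bsub>M\<^esub>"
proof -
  have "\<zero>\<^bsub>R\<^esub> \<odot>\<^bsub>M\<^esub> x = \<zero>\<^bsub>R\<^esub> \<odot>\<^bsub>M\<^esub> x \<oplus>\<^bsub>M\<^esub> \<zero>\<^bsub>R\<^esub> \<odot>\<^bsub>M\<^esub> x"
    using act_add_scalar[of "\<zero>\<^bsub>R\<^esub>" "\<zero>\<^bsub>R\<^esub>" x] x by simp
  then show ?thesis using act_closed[OF R.zero_closed x] by simp
qed

lemma (in onesided_module) act_zero: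
  assumes a: "a \<in> carrier R"
  shows "a \<odot>\<^bsub>M\<^esub> \<zero>\<^bsub>M\<^esub> = \<zero>\<^bsub>M\<^esub>"
proof -
  have "a \<odot>\<^bsub>M\<^esub> \<zero>\<^bsub>M\<^esub> = a \<odot>\<^bsub>M\<^esub> \<zero>\<^bsub>M\<^esub> \<oplus>\<^bsub>M\<^esub> a \<odot>\<^bsub>M\<^esub> \<zero>\<^bsub>M\<^esub>"
    using act_add_vector[OF a, of "\<zero>\<^bsub>M\<^esub>" "\<zero>\<^bsub>M\<^esub>"] by simp
  then show ?thesis using act_closed[OF a M.zero_closed] by simp
qed

lemma (in onesided_module) minus_act:
  assumes a: "a \<in> carrier R" and x: "x \<in> carrier M"
  shows "(\<ominus>\<^bsub>R\<^esub> a) \<odot>\<^bsub>M\<^esub> x = \<ominus>\<^bsub>M\<^esub> (a \<odot>\<^bsub>M\<^esub> x)"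
proof -
  have "(\<ominus>\<^bsub>R\<^esub> a) \<odot>\<^bsub>M\<^esub> x \<oplus>\<^bsub>M\<^esub> a \<odot>\<^bsub>M\<^esub> x = \<zero>\<^bsub>M\<^esub>"
    using act_add_scalar[of "\<ominus>\<^bsub>R\<^esub> a" a x] a x zero_act[OF x] by (simp add: R.l_neg)
  then show ?thesis using act_closed a x by (simp add: M.minus_equality)
qed

lemma (in onesided_module) submodule_iff:
  "submodule H R M \<longleftrightarrow> H \<subseteq> carrier M \<and> \<zero>\<^bsub>M\<^esub> \<in> H \<and>
     (\<forall>x\<in>H. \<forall>y\<in>H. x \<oplus>\<^bsub>M\<^esub> y \<in> H) \<and> (\<forall>a\<in>carrier R. \<forall>x\<in>H. a \<odot>\<^bsub>M\<^esub> x \<in> H)"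
  (is "_ = ?P")
proof
  assume "submodule H R M"
  then interpret submodule H R M .
  show ?P using subset m_closed one_closed smult_closed by auto
next
  assume P: ?P
  have neg: "\<ominus>\<^bsub>M\<^esub> x \<in> H" if "x \<in> H" for x
  proof -
    have "x \<in> carrier M" using that P by blast
    then have "(\<ominus>\<^bsub>R\<^esub> \<one>\<^bsub>R\<^esub>) \<odot>\<^bsub>M\<^esub> x = \<ominus>\<^bsub>M\<^esub> x" by (simp add: minus_act act_one)
    moreover have "(\<ominus>\<^bsub>R\<^esub> \<one>\<^bsub>R\<^esub>) \<odot>\<^bsub>M\<^esub> x \<in> H" using that P by simp
    ultimately show ?thesis by simp
  qed
  show "submodule H R M"
  proof (intro submodule.intro submodule_axioms.intro subgroup.intro)
    fix x assume "x \<in> H"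
    then show "inv\<^bsub>add_monoid M\<^esub> x \<in> H" using neg by (simp add: a_inv_def)
  qed (use P in auto)
qed

lemma (in onesided_module) submodule_carrier:
  "submodule H R M \<Longrightarrow> x \<in> H \<Longrightarrow> x \<in> carrier M"
  unfolding submodule_iff by blast

lemma (in onesided_module) submodule_minus_closed:
  assumes "submodule H R M" "x \<in> H" "y \<in> H" shows "x \<ominus>\<^bsub>M\<^esub> y \<in> H"
proof -
  have "y \<in> carrier M" using assms submodule_carrier by blast
  then have "(\<ominus>\<^bsub>R\<^esub> \<one>\<^bsub>R\<^esub>) \<odot>\<^bsub>M\<^esub> y = \<ominus>\<^bsub>M\<^esub> y" by (simp add: minus_act act_one)
  moreover have "(\<ominus>\<^bsub>R\<^esub> \<one>\<^bsub>R\<^esub>) \<odot>\<^bsub>M\<^esub> y \<in> H" using assms submodule_iff by simp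
  ultimately have "\<ominus>\<^bsub>M\<^esub> y \<in> H" by simp
  then show ?thesis using assms submodule_iff by (simp add: a_minus_def)
qed

lemma set_add_iff: "z \<in> H <+>\<^bsub>M\<^esub> K \<longleftrightarrow> (\<exists>h\<in>H. \<exists>k\<in>K. z = h \<oplus>\<^bsub>M\<^esub> k)"
  by (auto simp: set_add_defs)

lemma set_addI: "h \<in> H \<Longrightarrow> k \<in> K \<Longrightarrow> h \<oplus>\<^bsub>M\<^esub> k \<in> H <+>\<^bsub>M\<^esub> K"
  by (auto simp: set_add_iff)

lemma set_addE:
  assumes "z \<in> H <+>\<^bsub>M\<^esub> K"
  obtains h k where "h \<in> H" "k \<in> K" "z = h \<oplus>\<^bsub>M\<^esub> k"
  using assms by (auto simp: set_add_iff)

lemma (in onesided_module) submodule_plus: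
  assumes "submodule H R M" "submodule K R M"
  shows "submodule (H <+>\<^bsub>M\<^esub> K) R M"
proof -
  note H = assms(1)[unfolded submodule_iff] and K = assms(2)[unfolded submodule_iff]
  show ?thesis unfolding submodule_iff
  proof (intro conjI ballI)
    show "H <+>\<^bsub>M\<^esub> K \<subseteq> carrier M" using H K by (auto simp: set_add_iff subset_iff)
    show "\<zero>\<^bsub>M\<^esub> \<in> H <+>\<^bsub>M\<^esub> K"
      using H K unfolding set_add_iff by (metis M.r_zero M.zero_closed)
    fix x y assume "x \<in> H <+>\<^bsub>M\<^esub> K" "y \<in> H <+>\<^bsub>M\<^esub> K"
    then obtain h k h' k' where *: "h \<in> H" "k \<in> K" "h' \<in> H" "k' \<in> K"
      and xy: "x = h \<oplus>\<^bsub>M\<^esub> k" "y = h' \<oplus>\<^bsub>M\<^esub> k'" by (auto simp: set_add_iff)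
    have "x \<oplus>\<^bsub>M\<^esub> y = (h \<oplus>\<^bsub>M\<^esub> h') \<oplus>\<^bsub>M\<^esub> (k \<oplus>\<^bsub>M\<^esub> k')"
      using * H K unfolding xy by (simp add: subset_iff M.a_ac)
    moreover have "h \<oplus>\<^bsub>M\<^esub> h' \<in> H" "k \<oplus>\<^bsub>M\<^esub> k' \<in> K" using * H K by auto
    ultimately show "x \<oplus>\<^bsub>M\<^esub> y \<in> H <+>\<^bsub>M\<^esub> K"
      unfolding set_add_iff by blast
  next
    fix a x assume a: "a \<in> carrier R" and "x \<in> H <+>\<^bsub>M\<^esub> K"
    then obtain h k where *: "h \<in> H" "k \<in> K" "x = h \<oplus>\<^bsub>M\<^esub> k" by (auto simp: set_add_iff)
    then have "a \<odot>\<^bsub>M\<^esub> x = a \<odot>\<^bsub>M\<^esub> h \<oplus>\<^bsub>M\<^esub> a \<odot>\<^bsub>M\<^esub> k"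
      using a H K by (simp add: act_add_vector subset_iff)
    moreover have "a \<odot>\<^bsub>M\<^esub> h \<in> H" "a \<odot>\<^bsub>M\<^esub> k \<in> K" using * a H K by auto
    ultimately show "a \<odot>\<^bsub>M\<^esub> x \<in> H <+>\<^bsub>M\<^esub> K" unfolding set_add_iff by blast
  qed
qed

lemma (in onesided_module) subset_plus:
  assumes "submodule H R M" "submodule K R M"
  shows "H \<subseteq> H <+>\<^bsub>M\<^esub> K" "K \<subseteq> H <+>\<^bsub>M\<^esub> K"
  using assms unfolding submodule_iff set_add_iff subset_iff
  by (metis M.r_zero, metis M.l_zero)

lemma (in onesided_module) plus_subset:
  assumes "submodule L R M" "H \<subseteq> L" "K \<subseteq> L"
  shows "H <+>\<^bsub>M\<^esub> K \<subseteq> L"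
  using assms unfolding submodule_iff set_add_iff subset_iff by metis

text \<open>
Zorn's lemma in the form used throughout: avoiding \<open>1\<close> it yields maximal right ideals, avoiding an
arbitrary vector it yields a quotient with a smallest nonzero submodule.
\<close>

lemma (in onesided_module) submodule_maximal_avoiding:
  assumes N: "submodule N R M" and x: "x \<notin> N"
  obtains K where "submodule K R M" "N \<subseteq> K" "x \<notin> K"
    "\<And>L. submodule L R M \<Longrightarrow> K \<subseteq> L \<Longrightarrow> x \<notin> L \<Longrightarrow> L = K"
proof -
  define A where "A = {K. submodule K R M \<and> N \<subseteq> K \<and> x \<notin> K}"
  have "\<exists>K\<in>A. \<forall>L\<in>A. K \<subseteq> L \<longrightarrow> L = K"
  proof (rule subset_Zorn_nonempty)
    show "A \<noteq> {}" using N x by (auto simp: A_def)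
    fix C assume C: "C \<noteq> {}" "subset.chain A C"
    then have sub: "\<And>K. K \<in> C \<Longrightarrow> submodule K R M" and NC: "\<And>K. K \<in> C \<Longrightarrow> N \<subseteq> K"
      and xC: "\<And>K. K \<in> C \<Longrightarrow> x \<notin> K"
      by (auto simp: A_def subset.chain_def)
    have "submodule (\<Union>C) R M" unfolding submodule_iff
    proof (intro conjI ballI)
      show "\<Union>C \<subseteq> carrier M" "\<zero>\<^bsub>M\<^esub> \<in> \<Union>C" using sub C unfolding submodule_iff by blast+
      fix u v assume "u \<in> \<Union>C" "v \<in> \<Union>C"
      then obtain K L where KL: "K \<in> C" "L \<in> C" "u \<in> K" "v \<in> L" by auto
      moreover have "K \<subseteq> L \<or> L \<subseteq> K" using KL C by (auto simp: subset.chain_def)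
      ultimately have "\<exists>P\<in>C. u \<in> P \<and> v \<in> P" by blast
      then obtain P where "P \<in> C" "u \<in> P" "v \<in> P" by auto
      then show "u \<oplus>\<^bsub>M\<^esub> v \<in> \<Union>C" using sub[of P] unfolding submodule_iff by blast
    next
      fix a u assume "a \<in> carrier R" "u \<in> \<Union>C"
      then show "a \<odot>\<^bsub>M\<^esub> u \<in> \<Union>C" using sub unfolding submodule_iff by blast
    qed
    then show "\<Union>C \<in> A" using NC xC C by (auto simp: A_def)
  qed
  then show thesis using that unfolding A_def by (smt (verit) mem_Collect_eq order_trans)
qed

section \<open>Right ideals and the Jacobson radical\<close>

abbreviation right_ideal :: "'a set \<Rightarrow> ('a, 'c) ring_scheme \<Rightarrow> bool" where
  "right_ideal I R \<equiv> submodule I R (right_regular R)"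

lemma right_regular_simps [simp]:
  "carrier (right_regular R) = carrier R"
  "\<zero>\<^bsub>right_regular R\<^esub> = \<zero>\<^bsub>R\<^esub>"
  "x \<oplus>\<^bsub>right_regular R\<^esub> y = x \<oplus>\<^bsub>R\<^esub> y"
  "a \<odot>\<^bsub>right_regular R\<^esub> x = x \<otimes>\<^bsub>R\<^esub> a"
  by (simp_all add: right_regular_def)

lemma (in ring) right_regular_right_module: "right_module R (right_regular R)"
proof -
  have "abelian_group (right_regular R)"
  proof (rule abelian_groupI)
    fix x assume "x \<in> carrier (right_regular R)"
    then show "\<exists>y\<in>carrier (right_regular R). y \<oplus>\<^bsub>right_regular R\<^esub> x = \<zero>\<^bsub>right_regular R\<^esub>"
      using l_neg[of x] by (auto intro!: bexI[of _ "\<ominus> x"])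
  qed (auto simp: a_ac)
  then show ?thesis
    by (intro right_module.intro onesided_module.intro onesided_module_axioms.intro
        right_module_axioms.intro) (auto simp: l_distr r_distr m_assoc ring_axioms)
qed

lemma (in ring) right_regular_onesided: "onesided_module R (right_regular R)"
  using right_regular_right_module by (simp add: right_module_def)

lemma (in ring) right_ideal_iff:
  "right_ideal I R \<longleftrightarrow> I \<subseteq> carrier R \<and> \<zero> \<in> I \<and> (\<forall>x\<in>I. \<forall>y\<in>I. x \<oplus> y \<in> I) \<and>
     (\<forall>a\<in>carrier R. \<forall>x\<in>I. x \<otimes> a \<in> I)"
  using onesided_module.submodule_iff[OF right_regular_onesided] by simp

lemma (in ring) right_ideal_carrier:
  "right_ideal I R \<Longrightarrow> x \<in> I \<Longrightarrow> x \<in> carrier R"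
  unfolding right_ideal_iff by blast

lemma (in ring) right_ideal_minus:
  assumes "right_ideal I R" "x \<in> I" shows "\<ominus> x \<in> I"
proof -
  have "x \<in> carrier R" using assms right_ideal_carrier by blast
  then have "x \<otimes> (\<ominus> \<one>) = \<ominus> x" using r_minus by simp
  moreover have "x \<otimes> (\<ominus> \<one>) \<in> I" using assms right_ideal_iff by simp
  ultimately show ?thesis by simp
qed

lemma (in ring) right_ideal_diff:
  assumes "right_ideal I R" "x \<in> I" "y \<in> I" shows "x \<ominus> y \<in> I"
  using assms right_ideal_minus right_ideal_iff by (simp add: a_minus_def)

lemma (in ring) right_ideal_add_cancel:
  assumes "right_ideal I R" "x \<in> I" "y \<in> carrier R" "x \<oplus> y \<in> I" shows "y \<in> I"
proof -
  have "x \<in> carrier R" using assms right_ideal_carrier by blast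
  then have "y = \<ominus> x \<oplus> (x \<oplus> y)" using assms by (simp add: r_neg1)
  then show ?thesis using assms right_ideal_minus right_ideal_iff by metis
qed

lemma (in ring) principal_right_ideal:
  assumes "x \<in> carrier R" shows "right_ideal ((\<otimes>) x ` carrier R) R"
proof -
  have "x \<otimes> a \<oplus> x \<otimes> b \<in> (\<otimes>) x ` carrier R" if "a \<in> carrier R" "b \<in> carrier R" for a b
    using that assms by (simp add: r_distr[symmetric])
  moreover have "(x \<otimes> b) \<otimes> a \<in> (\<otimes>) x ` carrier R" if "a \<in> carrier R" "b \<in> carrier R" for a b
    using that assms by (simp add: m_assoc)
  moreover have "\<zero> \<in> (\<otimes>) x ` carrier R" using assms r_null[of x] by (metis imageI zero_closed)
  ultimately show ?thesis unfolding right_ideal_iff using assms by auto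
qed

lemma (in ring) right_ideal_sum:
  assumes "right_ideal I R" "right_ideal J R"
  shows "right_ideal (I <+>\<^bsub>R\<^esub> J) R" "I \<subseteq> I <+>\<^bsub>R\<^esub> J" "J \<subseteq> I <+>\<^bsub>R\<^esub> J"
    "right_ideal L R \<Longrightarrow> I \<subseteq> L \<Longrightarrow> J \<subseteq> L \<Longrightarrow> I <+>\<^bsub>R\<^esub> J \<subseteq> L"
proof -
  interpret rr: onesided_module R "right_regular R" by (rule right_regular_onesided)
  have eq: "I <+>\<^bsub>right_regular R\<^esub> J = I <+>\<^bsub>R\<^esub> J" by (auto simp: set_add_iff)
  show "right_ideal (I <+>\<^bsub>R\<^esub> J) R" "I \<subseteq> I <+>\<^bsub>R\<^esub> J" "J \<subseteq> I <+>\<^bsub>R\<^esub> J"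
    "right_ideal L R \<Longrightarrow> I \<subseteq> L \<Longrightarrow> J \<subseteq> L \<Longrightarrow> I <+>\<^bsub>R\<^esub> J \<subseteq> L"
    using rr.submodule_plus[OF assms] rr.subset_plus[OF assms] rr.plus_subset[of L I J] unfolding eq by auto
qed

lemma (in ring) right_ideal_one: "right_ideal I R \<Longrightarrow> \<one> \<in> I \<longleftrightarrow> I = carrier R"
  unfolding right_ideal_iff by (metis l_one one_closed subset_antisym subsetI)

lemma (in ring) maximal_right_ideal_iff:
  "maximal_right_ideal I R \<longleftrightarrow> right_ideal I R \<and> \<one> \<notin> I \<and>
     (\<forall>x\<in>carrier R - I. \<exists>y\<in>I. \<exists>r\<in>carrier R. \<one> = y \<oplus> x \<otimes> r)"
proof
  assume m: "maximal_right_ideal I R"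
  then have I: "right_ideal I R" and ne: "\<one> \<notin> I"
    using right_ideal_one by (auto simp: maximal_submodule_def)
  have "\<exists>y\<in>I. \<exists>r\<in>carrier R. \<one> = y \<oplus> x \<otimes> r" if x: "x \<in> carrier R - I" for x
  proof -
    let ?L = "I <+>\<^bsub>R\<^esub> ((\<otimes>) x ` carrier R)"
    have L: "right_ideal ?L R" "I \<subseteq> ?L" "(\<otimes>) x ` carrier R \<subseteq> ?L"
      using right_ideal_sum[OF I principal_right_ideal, of x] x by auto
    moreover have "x \<in> ?L" using L(3) x by (metis Diff_iff imageI one_closed r_one subsetD)
    ultimately have "?L = carrier R" using m x unfolding maximal_submodule_def by auto
    then have "\<one> \<in> ?L" by simp
    then show ?thesis unfolding set_add_iff by auto
  qed
  then show "right_ideal I R \<and> \<one> \<notin> I \<and>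
     (\<forall>x\<in>carrier R - I. \<exists>y\<in>I. \<exists>r\<in>carrier R. \<one> = y \<oplus> x \<otimes> r)" using I ne by blast
next
  assume *: "right_ideal I R \<and> \<one> \<notin> I \<and>
     (\<forall>x\<in>carrier R - I. \<exists>y\<in>I. \<exists>r\<in>carrier R. \<one> = y \<oplus> x \<otimes> r)"
  have "K = I \<or> K = carrier R" if K: "right_ideal K R" "I \<subseteq> K" for K
  proof (cases "K \<subseteq> I")
    case False
    then obtain x where x: "x \<in> K" "x \<notin> I" by auto
    moreover have "x \<in> carrier R" using x K right_ideal_carrier by blast
    ultimately obtain y r where "y \<in> I" "r \<in> carrier R" "\<one> = y \<oplus> x \<otimes> r" using * by blast
    then have "\<one> \<in> K" using x K unfolding right_ideal_iff by auto
    then show ?thesis using right_ideal_one K by blast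
  qed (use K in auto)
  then show "maximal_right_ideal I R" using * by (auto simp: maximal_submodule_def)
qed

lemma (in ring) exists_maximal_right_ideal:
  assumes "right_ideal N R" "\<one> \<notin> N"
  obtains I where "maximal_right_ideal I R" "N \<subseteq> I"
proof -
  interpret rr: onesided_module R "right_regular R" by (rule right_regular_onesided)
  obtain K where K: "right_ideal K R" "N \<subseteq> K" "\<one> \<notin> K"
    "\<And>L. right_ideal L R \<Longrightarrow> K \<subseteq> L \<Longrightarrow> \<one> \<notin> L \<Longrightarrow> L = K"
    using rr.submodule_maximal_avoiding[OF assms] by blast
  then have "maximal_right_ideal K R" unfolding maximal_submodule_def
    using right_ideal_one by auto
  then show thesis using K that by blast
qed

lemma (in ring) jacobson_right_ideal: "right_ideal (jacobson_radical R) R"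
  unfolding right_ideal_iff jacobson_radical_def
  by (auto simp: maximal_right_ideal_iff right_ideal_iff)

lemma (in ring) jacobson_one_minus_right_inverse:
  assumes "x \<in> jacobson_radical R"
  obtains v where "v \<in> carrier R" "(\<one> \<ominus> x) \<otimes> v = \<one>"
proof -
  have x: "x \<in> carrier R" using assms by (simp add: jacobson_radical_def)
  let ?N = "(\<otimes>) (\<one> \<ominus> x) ` carrier R"
  have N: "right_ideal ?N R" using x by (intro principal_right_ideal) simp
  have "\<one> \<in> ?N"
  proof (rule ccontr)
    assume "\<one> \<notin> ?N"
    then obtain I where I: "maximal_right_ideal I R" "?N \<subseteq> I"
      using exists_maximal_right_ideal[OF N] by blast
    then have "\<one> \<ominus> x \<in> I" using x by (metis imageI minus_closed one_closed r_one subsetD)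
    moreover have "x \<in> I" using I assms by (simp add: jacobson_radical_def)
    moreover have "\<one> = (\<one> \<ominus> x) \<oplus> x" using x by (simp add: a_minus_def a_assoc l_neg)
    ultimately have "\<one> \<in> I" using I by (metis maximal_right_ideal_iff right_ideal_iff)
    then show False using I maximal_right_ideal_iff by blast
  qed
  then show thesis using that by (metis imageE)
qed

text \<open>
The right inverse \<open>v\<close> of \<open>1 - x\<close> has the form \<open>1 - (- x v)\<close> with \<open>- x v\<close> in the radical, so it is itself
right invertible; an element with inverses on both sides has a two-sided one.
\<close>

lemma (in ring) jacobson_one_minus_left_inverse:
  assumes "x \<in> jacobson_radical R"
  obtains v where "v \<in> carrier R" "v \<otimes> (\<one> \<ominus> x) = \<one>"
proof -
  have x: "x \<in> carrier R" using assms by (simp add: jacobson_radical_def)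
  obtain v where v: "v \<in> carrier R" "(\<one> \<ominus> x) \<otimes> v = \<one>"
    using jacobson_one_minus_right_inverse[OF assms] .
  have "\<ominus> (x \<otimes> v) \<in> jacobson_radical R"
    using assms v right_ideal_minus[OF jacobson_right_ideal] jacobson_right_ideal
    by (simp add: right_ideal_iff)
  then obtain w where w: "w \<in> carrier R" "(\<one> \<ominus> \<ominus> (x \<otimes> v)) \<otimes> w = \<one>"
    using jacobson_one_minus_right_inverse by blast
  have "v \<ominus> x \<otimes> v = \<one>" using v x by (simp add: a_minus_def l_distr l_minus)
  then have "\<one> \<ominus> \<ominus> (x \<otimes> v) = v"
    using v x by (metis a_minus_def a_assoc a_inv_closed l_neg m_closed minus_minus r_zero)
  then have "v \<otimes> w = \<one>" using w by simp
  then have "\<one> \<ominus> x = w" using v w x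
    by (metis l_one m_assoc minus_closed one_closed r_one)
  then have "v \<otimes> (\<one> \<ominus> x) = \<one>" using \<open>v \<otimes> w = \<one>\<close> by simp
  then show thesis using that v by blast
qed

lemma (in ring) ideal_iff_right_ideal:
  "ideal I R \<longleftrightarrow> right_ideal I R \<and> (\<forall>a\<in>carrier R. \<forall>x\<in>I. a \<otimes> x \<in> I)"
proof
  assume "ideal I R"
  then interpret ideal I R .
  show "right_ideal I R \<and> (\<forall>a\<in>carrier R. \<forall>x\<in>I. a \<otimes> x \<in> I)"
    unfolding right_ideal_iff using I_l_closed I_r_closed a_subset by auto
next
  assume *: "right_ideal I R \<and> (\<forall>a\<in>carrier R. \<forall>x\<in>I. a \<otimes> x \<in> I)"
  show "ideal I R"
  proof (rule idealI)
    show "subgroup I (add_monoid R)"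
      using * right_ideal_minus unfolding right_ideal_iff
      by (auto simp: subgroup_def a_inv_def[symmetric])
  qed (use * in \<open>auto simp: right_ideal_iff ring_axioms\<close>)
qed

text \<open>
The definition by maximal right ideals gives only a right ideal.  If \<open>a x\<close> were outside a maximal right
ideal \<open>I\<close>, then \<open>1 = y + a x r\<close> with \<open>y \<in> I\<close>, hence \<open>y a = a (1 - x r a)\<close>; the last factor is right
invertible, which forces \<open>a\<close> and therefore \<open>a x\<close> into \<open>I\<close>.
\<close>

lemma (in ring) jacobson_ideal: "ideal (jacobson_radical R) R"
  unfolding ideal_iff_right_ideal
proof (intro conjI ballI jacobson_right_ideal)
  fix a x assume a: "a \<in> carrier R" and xJ: "x \<in> jacobson_radical R"
  then have x: "x \<in> carrier R" by (simp add: jacobson_radical_def)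
  have "a \<otimes> x \<in> I" if I: "maximal_right_ideal I R" for I
  proof (rule ccontr)
    assume n: "a \<otimes> x \<notin> I"
    have rI: "right_ideal I R" using I maximal_right_ideal_iff by blast
    obtain y r where yr: "y \<in> I" "r \<in> carrier R" "\<one> = y \<oplus> (a \<otimes> x) \<otimes> r"
      using I n a x unfolding maximal_right_ideal_iff by blast
    have y: "y \<in> carrier R" using rI yr right_ideal_carrier by blast
    have "x \<otimes> r \<otimes> a \<in> jacobson_radical R"
      using xJ yr a jacobson_right_ideal by (simp add: right_ideal_iff)
    have "(y \<otimes> a) = a \<ominus> a \<otimes> x \<otimes> r \<otimes> a"
    proof -
      have "a = y \<otimes> a \<oplus> a \<otimes> x \<otimes> r \<otimes> a"
        using yr a x y by (metis l_distr l_one m_closed)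
      then show ?thesis using a x y yr
        by (metis a_minus_def add.inv_solve_right m_closed)
    qed
    also have "\<dots> = a \<otimes> (\<one> \<ominus> x \<otimes> r \<otimes> a)" using a x yr(2)
      by (simp add: a_minus_def r_distr r_minus m_assoc)
    finally have ya: "y \<otimes> a = a \<otimes> (\<one> \<ominus> x \<otimes> r \<otimes> a)" .
    obtain w where w: "w \<in> carrier R" "(\<one> \<ominus> x \<otimes> r \<otimes> a) \<otimes> w = \<one>"
      using jacobson_one_minus_right_inverse \<open>x \<otimes> r \<otimes> a \<in> jacobson_radical R\<close> by blast
    have "a = y \<otimes> a \<otimes> w" using ya w a x yr(2) by (simp add: m_assoc)
    then have "a \<in> I" using rI yr a w unfolding right_ideal_iff by metis
    then have "a \<otimes> x \<in> I" using rI x unfolding right_ideal_iff by blast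
    then show False using n by simp
  qed
  then show "a \<otimes> x \<in> jacobson_radical R" using a x by (simp add: jacobson_radical_def)
qed

section \<open>The right socle and the ideal \<open>\<delta>\<^sub>r\<close>\<close>

abbreviation simple_right_ideal :: "'a set \<Rightarrow> ('a, 'c) ring_scheme \<Rightarrow> bool" where
  "simple_right_ideal T R \<equiv> simple_submodule T R (right_regular R)"

lemma (in ring) right_ideal_Int:
  assumes "right_ideal I R" "right_ideal J R" shows "right_ideal (I \<inter> J) R"
  using assms unfolding right_ideal_iff by auto

lemma (in ring) right_ideal_carrier_set: "right_ideal (carrier R) R"
  unfolding right_ideal_iff by auto

lemma (in ring) right_ideal_zero_set: "right_ideal {\<zero>} R"
  unfolding right_ideal_iff by auto

lemma (in ring) right_ideal_zero: "right_ideal I R \<Longrightarrow> \<zero> \<in> I"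
  unfolding right_ideal_iff by blast

lemma (in ring) socle_right_ideal: "right_ideal (right_socle R) R"
proof -
  let ?C = "{N. right_ideal N R \<and> (\<forall>T. simple_right_ideal T R \<longrightarrow> T \<subseteq> N)}"
  have "carrier R \<in> ?C"
    using right_ideal_carrier by (auto simp: simple_submodule_def right_ideal_carrier_set)
  then show ?thesis
    unfolding right_socle_def Soc_def right_ideal_iff[of "\<Inter>?C"]
    by (auto simp: right_ideal_iff)
qed

lemma (in ring) simple_subset_socle: "simple_right_ideal T R \<Longrightarrow> T \<subseteq> right_socle R"
  unfolding right_socle_def Soc_def by blast

lemma (in ring) socle_subset:
  assumes "right_ideal N R" "\<And>T. simple_right_ideal T R \<Longrightarrow> T \<subseteq> N"
  shows "right_socle R \<subseteq> N"
  using assms unfolding right_socle_def Soc_def by blast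

lemma (in ring) left_multiple_right_ideal:
  assumes a: "a \<in> carrier R" and I: "right_ideal I R"
  shows "right_ideal ((\<otimes>) a ` I) R"
proof -
  have c: "\<And>x. x \<in> I \<Longrightarrow> x \<in> carrier R" using right_ideal_carrier[OF I] .
  have "a \<otimes> x \<oplus> a \<otimes> y \<in> (\<otimes>) a ` I" if "x \<in> I" "y \<in> I" for x y
    using that a c I by (simp add: r_distr[symmetric] right_ideal_iff)
  moreover have "(a \<otimes> x) \<otimes> b \<in> (\<otimes>) a ` I" if "x \<in> I" "b \<in> carrier R" for x b
    using that a c I by (simp add: m_assoc right_ideal_iff)
  moreover have "\<zero> \<in> (\<otimes>) a ` I" using a r_null[of a] right_ideal_zero[OF I] by (metis imageI)
  ultimately show ?thesis unfolding right_ideal_iff using a c by auto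
qed

lemma (in ring) right_ideal_quotient:
  assumes a: "a \<in> carrier R" and I: "right_ideal I R"
  shows "right_ideal {x \<in> carrier R. a \<otimes> x \<in> I} R"
proof -
  have "a \<otimes> (x \<otimes> b) \<in> I" if "x \<in> carrier R" "a \<otimes> x \<in> I" "b \<in> carrier R" for x b
    using that a I unfolding right_ideal_iff by (metis m_assoc)
  then show ?thesis using a I unfolding right_ideal_iff by (auto simp: r_distr)
qed

text \<open>
Left multiplication by \<open>a\<close> maps a simple right ideal onto zero or onto a simple right ideal.
\<close>

lemma (in ring) socle_ideal: "ideal (right_socle R) R"
  unfolding ideal_iff_right_ideal
proof (intro conjI ballI socle_right_ideal)
  fix a x assume a: "a \<in> carrier R" and x: "x \<in> right_socle R"
  let ?N = "{x \<in> carrier R. a \<otimes> x \<in> right_socle R}"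
  have "right_socle R \<subseteq> ?N"
  proof (rule socle_subset)
    show "right_ideal ?N R" using right_ideal_quotient[OF a socle_right_ideal] .
    fix T assume T: "simple_right_ideal T R"
    then have rT: "right_ideal T R" by (simp add: simple_submodule_def)
    let ?aT = "(\<otimes>) a ` T"
    have raT: "right_ideal ?aT R" using left_multiple_right_ideal[OF a rT] .
    have "?aT \<subseteq> right_socle R"
    proof (cases "?aT = {\<zero>}")
      case True
      then show ?thesis using right_ideal_zero[OF socle_right_ideal] by simp
    next
      case False
      have "U = {\<zero>} \<or> U = ?aT" if U: "right_ideal U R" "U \<subseteq> ?aT" for U
      proof -
        let ?V = "T \<inter> {x \<in> carrier R. a \<otimes> x \<in> U}"
        have V: "right_ideal ?V R"
          using right_ideal_Int[OF rT right_ideal_quotient[OF a U(1)]] .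
        have im: "U = (\<otimes>) a ` ?V" using U(2) right_ideal_carrier[OF rT] by blast
        have "?V = {\<zero>} \<or> ?V = T" using T V unfolding simple_submodule_def by auto
        then show ?thesis
        proof
          assume "?V = {\<zero>}"
          then show ?thesis using im a by simp
        next
          assume "?V = T"
          then show ?thesis using im by simp
        qed
      qed
      then have "simple_right_ideal ?aT R"
        using raT False by (auto simp: simple_submodule_def)
      then show ?thesis by (rule simple_subset_socle)
    qed
    then show "T \<subseteq> ?N" using right_ideal_carrier[OF rT] by blast
  qed
  then show "a \<otimes> x \<in> right_socle R" using x by blast
qed

lemma (in ring) essential_right_ideal_iff:
  "essential_right_ideal I R \<longleftrightarrow> right_ideal I R \<and>
     (\<forall>K. right_ideal K R \<and> K \<noteq> {\<zero>} \<longrightarrow> I \<inter> K \<noteq> {\<zero>})"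
  by (simp add: essential_submodule_def)

lemma (in ring) socle_subset_essential:
  assumes "essential_right_ideal I R" shows "right_socle R \<subseteq> I"
proof (rule socle_subset)
  show rI: "right_ideal I R" using assms essential_right_ideal_iff by blast
  fix T assume T: "simple_right_ideal T R"
  then have rT: "right_ideal T R" and "T \<noteq> {\<zero>}" by (simp_all add: simple_submodule_def)
  then have "I \<inter> T \<noteq> {\<zero>}" using assms essential_right_ideal_iff by blast
  then have "I \<inter> T = T"
    using T right_ideal_Int[OF rI rT] unfolding simple_submodule_def by auto
  then show "T \<subseteq> I" by blast
qed

text \<open>
A right ideal \<open>K\<close> that meets a maximal right ideal \<open>I\<close> trivially is a complement of it, hence simple,
and so it lies in the socle.
\<close>

lemma (in ring) maximal_ge_socle_essential:
  assumes I: "maximal_right_ideal I R" and S: "right_socle R \<subseteq> I"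
  shows "essential_right_ideal I R"
proof -
  have rI: "right_ideal I R" using I by (simp add: maximal_submodule_def)
  have "I \<inter> K \<noteq> {\<zero>}" if K: "right_ideal K R" "K \<noteq> {\<zero>}" for K
  proof
    assume zero: "I \<inter> K = {\<zero>}"
    have cK: "\<And>x. x \<in> K \<Longrightarrow> x \<in> carrier R" using right_ideal_carrier[OF K(1)] .
    have cI: "\<And>x. x \<in> I \<Longrightarrow> x \<in> carrier R" using right_ideal_carrier[OF rI] .
    have "U = {\<zero>} \<or> U = K" if U: "right_ideal U R" "U \<subseteq> K" for U
    proof (cases "U = {\<zero>}")
      case False
      then obtain u where u: "u \<in> U" "u \<noteq> \<zero>" using right_ideal_zero[OF U(1)] by blast
      then have "u \<in> carrier R - I" using U zero cK by blast
      then obtain y r where yr: "y \<in> I" "r \<in> carrier R" "\<one> = y \<oplus> u \<otimes> r"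
        using I unfolding maximal_right_ideal_iff by blast
      have "k \<in> U" if k: "k \<in> K" for k
      proof -
        have c: "k \<in> carrier R" "u \<in> carrier R" "y \<in> carrier R"
          using k cK cI u U yr by auto
        have eq: "k = y \<otimes> k \<oplus> u \<otimes> (r \<otimes> k)"
          using c yr by (metis l_distr l_one m_assoc m_closed)
        have ur: "u \<otimes> (r \<otimes> k) \<in> U" using U u c yr by (simp add: right_ideal_iff)
        then have urK: "u \<otimes> (r \<otimes> k) \<in> K" using U by blast
        have "y \<otimes> k \<in> K"
          using right_ideal_add_cancel[OF K(1) urK, of "y \<otimes> k"] eq k c
          by (metis a_comm m_closed yr(2))
        moreover have "y \<otimes> k \<in> I" using rI yr c by (simp add: right_ideal_iff)
        ultimately have "y \<otimes> k = \<zero>" using zero by blast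
        then show ?thesis using eq ur c yr by simp
      qed
      then show ?thesis using U by blast
    qed simp
    then have "simple_right_ideal K R" using K by (simp add: simple_submodule_def)
    then have "K \<subseteq> I" using simple_subset_socle S by blast
    then show False using zero K by blast
  qed
  then show ?thesis using rI essential_right_ideal_iff by blast
qed

lemma (in ring) delta_right_alt:
  "delta_right R = {x \<in> carrier R. \<forall>I. maximal_right_ideal I R \<and> right_socle R \<subseteq> I \<longrightarrow> x \<in> I}"
  unfolding delta_right_def
  using socle_subset_essential maximal_ge_socle_essential by blast

lemma (in ideal) quotient_carrier: "carrier (R Quot I) = (+>) I ` carrier R"
  unfolding FactRing_def A_RCOSETS_def' by auto

lemma (in ideal) coset_eq_iff:
  "x \<in> carrier R \<Longrightarrow> y \<in> carrier R \<Longrightarrow> I +> x = I +> y \<longleftrightarrow> x \<ominus> y \<in> I"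
  using quotient_eq_iff_same_a_r_cos[OF is_ideal] by blast

text \<open>
The maximal right ideals of \<open>R/S\<close> correspond to those of \<open>R\<close> that contain \<open>S\<close>, and these are the
essential ones.  All properties of \<open>\<delta>\<^sub>r\<close> are inherited through this from the Jacobson radical of \<open>R/S\<close>.
\<close>

lemma (in ring) delta_right_iff:
  assumes x: "x \<in> carrier R"
  shows "x \<in> delta_right R \<longleftrightarrow>
    right_socle R +> x \<in> jacobson_radical (R Quot right_socle R)"
proof -
  let ?S = "right_socle R"
  interpret S: ideal ?S R by (rule socle_ideal)
  let ?Q = "R Quot ?S" and ?\<pi> = "(+>) ?S"
  interpret Q: ring ?Q by (rule S.quotient_is_ring)
  interpret \<pi>: ring_hom_ring R ?Q ?\<pi> by (rule S.rcos_ring_hom_ring)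
  have inS: "y \<in> I" if "right_ideal I R" "?S \<subseteq> I" "y \<in> carrier R" "z \<in> I" "?\<pi> y = ?\<pi> z" for I y z
  proof -
    have z: "z \<in> carrier R" using that right_ideal_carrier by blast
    then have "y \<ominus> z \<in> I" using that S.coset_eq_iff[of y z] by blast
    then have "(y \<ominus> z) \<oplus> z \<in> I" using that unfolding right_ideal_iff by blast
    moreover have "(y \<ominus> z) \<oplus> z = y" using that z by (simp add: a_minus_def a_assoc l_neg)
    ultimately show ?thesis by simp
  qed
  show ?thesis
  proof
    assume xd: "x \<in> delta_right R"
    have "?\<pi> x \<in> I'" if I': "maximal_right_ideal I' ?Q" for I'
    proof -
      have rI': "right_ideal I' ?Q" using I' by (simp add: maximal_submodule_def)
      let ?I = "{y \<in> carrier R. ?\<pi> y \<in> I'}"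
      have rI: "right_ideal ?I R"
        using rI' unfolding right_ideal_iff Q.right_ideal_iff by (auto simp: \<pi>.hom_zero)
      have "maximal_right_ideal ?I R" unfolding maximal_right_ideal_iff
      proof (intro conjI rI ballI)
        show "\<one> \<notin> ?I" using I' by (auto simp: Q.maximal_right_ideal_iff \<pi>.hom_one)
        fix z assume z: "z \<in> carrier R - ?I"
        then have "?\<pi> z \<in> carrier ?Q - I'" by auto
        then obtain Y C where Y: "Y \<in> I'" "C \<in> carrier ?Q" "\<one>\<^bsub>?Q\<^esub> = Y \<oplus>\<^bsub>?Q\<^esub> ?\<pi> z \<otimes>\<^bsub>?Q\<^esub> C"
          using I' unfolding Q.maximal_right_ideal_iff by blast
        then obtain r where r: "r \<in> carrier R" "C = ?\<pi> r" unfolding S.quotient_carrier by auto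
        have cY: "Y \<in> carrier ?Q" using Q.right_ideal_carrier[OF rI' Y(1)] .
        have "?\<pi> (\<one> \<ominus> z \<otimes> r) = \<one>\<^bsub>?Q\<^esub> \<ominus>\<^bsub>?Q\<^esub> ?\<pi> z \<otimes>\<^bsub>?Q\<^esub> C"
          using z r by (simp add: a_minus_def Q.minus_eq)
        also have "\<dots> = Y" using Y cY z r
          by (simp add: a_minus_def Q.minus_eq Q.a_assoc Q.r_neg)
        finally have "\<one> \<ominus> z \<otimes> r \<in> ?I" using Y z r by simp
        moreover have "\<one> = (\<one> \<ominus> z \<otimes> r) \<oplus> z \<otimes> r"
          using z r by (simp add: a_minus_def a_assoc l_neg)
        ultimately show "\<exists>y\<in>?I. \<exists>r\<in>carrier R. \<one> = y \<oplus> z \<otimes> r" using r by blast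
      qed
      moreover have "?S \<subseteq> ?I"
      proof
        fix s assume s: "s \<in> ?S"
        moreover have sc: "s \<in> carrier R" using s right_ideal_carrier[OF socle_right_ideal] by blast
        ultimately have "s \<ominus> \<zero> \<in> ?S" by (simp add: a_minus_def)
        then have "?\<pi> s = ?\<pi> \<zero>" using S.coset_eq_iff[OF sc zero_closed] by blast
        then have "?\<pi> s = \<zero>\<^bsub>?Q\<^esub>" using \<pi>.hom_zero by metis
        moreover note sc
        ultimately show "s \<in> ?I" using Q.right_ideal_zero[OF rI'] by simp
      qed
      ultimately have "x \<in> ?I" using xd unfolding delta_right_alt by blast
      then show ?thesis by simp
    qed
    then show "?\<pi> x \<in> jacobson_radical ?Q" using x by (simp add: jacobson_radical_def)
  next
    assume xJ: "?\<pi> x \<in> jacobson_radical ?Q"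
    have "x \<in> I" if I: "maximal_right_ideal I R" "?S \<subseteq> I" for I
    proof -
      have rI: "right_ideal I R" using I by (simp add: maximal_submodule_def)
      have cI: "\<And>x. x \<in> I \<Longrightarrow> x \<in> carrier R" using right_ideal_carrier[OF rI] .
      let ?I' = "?\<pi> ` I"
      have rI': "right_ideal ?I' ?Q" unfolding Q.right_ideal_iff
      proof (intro conjI ballI)
        show "?I' \<subseteq> carrier ?Q" using cI by auto
        show "\<zero>\<^bsub>?Q\<^esub> \<in> ?I'" using right_ideal_zero[OF rI] \<pi>.hom_zero by (metis imageI)
        fix X Y assume "X \<in> ?I'" "Y \<in> ?I'"
        then obtain y z where "y \<in> I" "z \<in> I" "X = ?\<pi> y" "Y = ?\<pi> z" by auto
        moreover have "y \<oplus> z \<in> I" using rI calculation right_ideal_iff by simp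
        ultimately show "X \<oplus>\<^bsub>?Q\<^esub> Y \<in> ?I'" using cI by (metis \<pi>.hom_add imageI)
      next
        fix C Y assume "C \<in> carrier ?Q" "Y \<in> ?I'"
        then obtain r y where "r \<in> carrier R" "y \<in> I" "C = ?\<pi> r" "Y = ?\<pi> y"
          unfolding S.quotient_carrier by auto
        moreover have "y \<otimes> r \<in> I" using rI calculation right_ideal_iff by simp
        ultimately show "Y \<otimes>\<^bsub>?Q\<^esub> C \<in> ?I'" using cI by (metis \<pi>.hom_mult imageI)
      qed
      have "maximal_right_ideal ?I' ?Q" unfolding Q.maximal_right_ideal_iff
      proof (intro conjI rI' ballI)
        show "\<one>\<^bsub>?Q\<^esub> \<notin> ?I'"
        proof
          assume "\<one>\<^bsub>?Q\<^esub> \<in> ?I'"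
          then obtain y where "y \<in> I" "?\<pi> \<one> = ?\<pi> y" by auto
          then have "\<one> \<in> I" using inS[OF rI I(2)] by blast
          then show False using I maximal_right_ideal_iff by blast
        qed
        fix Z assume "Z \<in> carrier ?Q - ?I'"
        then obtain z where z: "z \<in> carrier R - I" "Z = ?\<pi> z" unfolding S.quotient_carrier by auto
        then obtain y r where yr: "y \<in> I" "r \<in> carrier R" "\<one> = y \<oplus> z \<otimes> r"
          using I unfolding maximal_right_ideal_iff by blast
        have "\<one>\<^bsub>?Q\<^esub> = ?\<pi> y \<oplus>\<^bsub>?Q\<^esub> Z \<otimes>\<^bsub>?Q\<^esub> ?\<pi> r"
          using yr z cI by (metis Diff_iff \<pi>.hom_add \<pi>.hom_mult \<pi>.hom_one m_closed)
        then show "\<exists>Y\<in>?I'. \<exists>C\<in>carrier ?Q. \<one>\<^bsub>?Q\<^esub> = Y \<oplus>\<^bsub>?Q\<^esub> Z \<otimes>\<^bsub>?Q\<^esub> C"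
          using yr \<pi>.hom_closed by blast
      qed
      then have "?\<pi> x \<in> ?I'" using xJ by (simp add: jacobson_radical_def)
      then show "x \<in> I" using inS[OF rI I(2) x] by blast
    qed
    then show "x \<in> delta_right R" using x unfolding delta_right_alt by blast
  qed
qed

lemma (in ring) delta_ideal: "ideal (delta_right R) R"
proof -
  let ?S = "right_socle R"
  interpret S: ideal ?S R by (rule socle_ideal)
  interpret Q: ring "R Quot ?S" by (rule S.quotient_is_ring)
  interpret \<pi>: ring_hom_ring R "R Quot ?S" "(+>) ?S" by (rule S.rcos_ring_hom_ring)
  have "{r \<in> carrier R. ?S +> r \<in> jacobson_radical (R Quot ?S)} = delta_right R"
    using delta_right_iff by (auto simp: delta_right_def)
  then show ?thesis using \<pi>.ideal_vimage[OF Q.jacobson_ideal] by simp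
qed

lemma (in ring) socle_subset_delta: "right_socle R \<subseteq> delta_right R"
  unfolding delta_right_alt using right_ideal_carrier[OF socle_right_ideal] by blast

lemma (in ring) delta_one_minus_left_inverse:
  assumes d: "d \<in> delta_right R"
  obtains v where "v \<in> carrier R" "v \<otimes> (\<one> \<ominus> d) \<ominus> \<one> \<in> right_socle R"
proof -
  let ?S = "right_socle R"
  interpret S: ideal ?S R by (rule socle_ideal)
  interpret Q: ring "R Quot ?S" by (rule S.quotient_is_ring)
  interpret \<pi>: ring_hom_ring R "R Quot ?S" "(+>) ?S" by (rule S.rcos_ring_hom_ring)
  have dc: "d \<in> carrier R" using d by (simp add: delta_right_def)
  then have "?S +> d \<in> jacobson_radical (R Quot ?S)" using d delta_right_iff by blast
  then obtain V where "V \<in> carrier (R Quot ?S)"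
    "V \<otimes>\<^bsub>R Quot ?S\<^esub> (\<one>\<^bsub>R Quot ?S\<^esub> \<ominus>\<^bsub>R Quot ?S\<^esub> (?S +> d)) = \<one>\<^bsub>R Quot ?S\<^esub>"
    using Q.jacobson_one_minus_left_inverse by blast
  then obtain v where v: "v \<in> carrier R"
    "(?S +> v) \<otimes>\<^bsub>R Quot ?S\<^esub> (\<one>\<^bsub>R Quot ?S\<^esub> \<ominus>\<^bsub>R Quot ?S\<^esub> (?S +> d)) = \<one>\<^bsub>R Quot ?S\<^esub>"
    unfolding S.quotient_carrier by auto
  then have "?S +> (v \<otimes> (\<one> \<ominus> d)) = ?S +> \<one>"
    using dc by (simp add: a_minus_def Q.minus_eq)
  moreover have "v \<otimes> (\<one> \<ominus> d) \<in> carrier R" using v dc by simp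
  ultimately have "v \<otimes> (\<one> \<ominus> d) \<ominus> \<one> \<in> ?S" using S.coset_eq_iff by blast
  then show thesis using that v by blast
qed

section \<open>Right ideals of finite length\<close>

text \<open>
Finite length as the conjunction of the ascending and the descending chain condition.  Treating both
directions of a monotone sequence at once saves proving every closure property twice.
\<close>

definition finite_length_ideal :: "('a, 'c) ring_scheme \<Rightarrow> 'a set \<Rightarrow> bool" where
  "finite_length_ideal R U \<longleftrightarrow> right_ideal U R \<and>
     (\<forall>V :: nat \<Rightarrow> 'a set. (\<forall>k. right_ideal (V k) R \<and> V k \<subseteq> U) \<and>
        ((\<forall>k. V k \<subseteq> V (Suc k)) \<or> (\<forall>k. V (Suc k) \<subseteq> V k)) \<longrightarrow> (\<exists>m. \<forall>k\<ge>m. V k = V m))"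

lemma monotone_nat_comparable:
  fixes V :: "nat \<Rightarrow> 'a set"
  assumes "(\<forall>k. V k \<subseteq> V (Suc k)) \<or> (\<forall>k. V (Suc k) \<subseteq> V k)"
  shows "V m \<subseteq> V n \<or> V n \<subseteq> V m"
proof (cases "\<forall>k. V k \<subseteq> V (Suc k)")
  case True
  then show ?thesis using lift_Suc_mono_le[of V] by (meson nle_le)
next
  case False
  then show ?thesis using lift_Suc_antimono_le[of V] assms by (meson nle_le)
qed

text \<open>
The modular law in \<open>A + B\<close>: comparable right ideals coincide if they have the same intersection with
\<open>A\<close> and the same image modulo \<open>A\<close>, the latter being measured inside \<open>B\<close>.
\<close>

lemma (in ring) modular_equality:
  assumes X: "right_ideal X R" and Y: "right_ideal Y R" and A: "right_ideal A R"
    and XY: "X \<subseteq> Y" and YAB: "Y \<subseteq> A <+>\<^bsub>R\<^esub> B" and B: "right_ideal B R"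
    and int: "X \<inter> A = Y \<inter> A" and sum: "(X <+>\<^bsub>R\<^esub> A) \<inter> B = (Y <+>\<^bsub>R\<^esub> A) \<inter> B"
  shows "X = Y"
proof
  show "Y \<subseteq> X"
  proof
    fix y assume y: "y \<in> Y"
    then have "y \<in> A <+>\<^bsub>R\<^esub> B" using YAB by blast
    then obtain a b where ab: "a \<in> A" "b \<in> B" "y = a \<oplus> b" by (rule set_addE)
    have c: "y \<in> carrier R" "a \<in> carrier R" "b \<in> carrier R"
      using y ab(1,2) right_ideal_carrier[OF Y] right_ideal_carrier[OF A] right_ideal_carrier[OF B] by auto
    have "\<ominus> a \<oplus> y = b" using c unfolding ab(3) by (simp add: r_neg1)
    then have "b = y \<oplus> (\<ominus> a)" using c a_comm[of y "\<ominus> a"] by simp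
    moreover have "\<ominus> a \<in> A" using right_ideal_minus[OF A ab(1)] .
    ultimately have "b \<in> Y <+>\<^bsub>R\<^esub> A" using y set_addI by metis
    then have "b \<in> X <+>\<^bsub>R\<^esub> A" using ab(2) sum by blast
    then obtain x a' where x: "x \<in> X" "a' \<in> A" "b = x \<oplus> a'" by (rule set_addE)
    have c': "x \<in> carrier R" "a' \<in> carrier R" 
      using x(1,2) right_ideal_carrier[OF X] right_ideal_carrier[OF A] by auto
    have eq: "y = x \<oplus> (a \<oplus> a')" using c c' x(3) ab(3) by (simp add: a_ac)
    have "a \<oplus> a' \<in> Y"
      using right_ideal_add_cancel[OF Y, of x "a \<oplus> a'"] x XY y eq c c' by auto
    moreover have "a \<oplus> a' \<in> A" using A ab x by (simp add: right_ideal_iff)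
    ultimately have "a \<oplus> a' \<in> X" using int by blast
    then show "y \<in> X" using eq x X by (simp add: right_ideal_iff)
  qed
qed (rule XY)

lemma (in ring) finite_length_sum:
  assumes A: "finite_length_ideal R A" and B: "finite_length_ideal R B"
  shows "finite_length_ideal R (A <+>\<^bsub>R\<^esub> B)"
  unfolding finite_length_ideal_def
proof (intro conjI allI impI)
  have rA: "right_ideal A R" and rB: "right_ideal B R"
    using A B by (simp_all add: finite_length_ideal_def)
  show "right_ideal (A <+>\<^bsub>R\<^esub> B) R" using right_ideal_sum(1)[OF rA rB] .
  fix V :: "nat \<Rightarrow> 'a set"
  assume V: "(\<forall>k. right_ideal (V k) R \<and> V k \<subseteq> A <+>\<^bsub>R\<^esub> B) \<and>
        ((\<forall>k. V k \<subseteq> V (Suc k)) \<or> (\<forall>k. V (Suc k) \<subseteq> V k))"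
  then have rV: "\<And>k. right_ideal (V k) R" by blast
  let ?I = "\<lambda>k. V k \<inter> A" and ?J = "\<lambda>k. (V k <+>\<^bsub>R\<^esub> A) \<inter> B"
  have mono: "X <+>\<^bsub>R\<^esub> A \<subseteq> Y <+>\<^bsub>R\<^esub> A" if "X \<subseteq> Y" for X Y
  proof
    fix z assume "z \<in> X <+>\<^bsub>R\<^esub> A"
    then obtain x a where "x \<in> X" "a \<in> A" "z = x \<oplus> a" by (rule set_addE)
    then show "z \<in> Y <+>\<^bsub>R\<^esub> A" using that set_addI[of x Y a A R] by blast
  qed
  have "\<exists>m. \<forall>k\<ge>m. ?I k = ?I m"
    using A V right_ideal_Int[OF rV rA] unfolding finite_length_ideal_def
    by (elim conjE allE[of _ ?I]) blast
  then obtain m1 where m1: "\<And>k. k \<ge> m1 \<Longrightarrow> ?I k = ?I m1" by blast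
  have "(\<forall>k. ?J k \<subseteq> ?J (Suc k)) \<or> (\<forall>k. ?J (Suc k) \<subseteq> ?J k)"
    using V mono by (meson Int_mono order_refl)
  then have "\<exists>m. \<forall>k\<ge>m. ?J k = ?J m"
    using B right_ideal_Int[OF right_ideal_sum(1)[OF rV rA] rB] unfolding finite_length_ideal_def
    by (elim conjE allE[of _ ?J]) blast
  then obtain m2 where m2: "\<And>k. k \<ge> m2 \<Longrightarrow> ?J k = ?J m2" by blast
  define m where "m = max m1 m2"
  have "V k = V m" if "k \<ge> m" for k
  proof -
    have I: "?I k = ?I m" using m1[of k] m1[of m] that by (simp add: m_def)
    have J: "?J k = ?J m" using m2[of k] m2[of m] that by (simp add: m_def)
    have sub: "V k \<subseteq> A <+>\<^bsub>R\<^esub> B" "V m \<subseteq> A <+>\<^bsub>R\<^esub> B" using V by blast+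
    consider "V m \<subseteq> V k" | "V k \<subseteq> V m" using monotone_nat_comparable V by metis
    then show ?thesis
    proof cases
      case 1
      then show ?thesis
        using modular_equality[OF rV rV rA 1 sub(1) rB I[symmetric] J[symmetric]] by simp
    next
      case 2
      then show ?thesis using modular_equality[OF rV rV rA 2 sub(2) rB I J] by simp
    qed
  qed
  then show "\<exists>m. \<forall>k\<ge>m. V k = V m" by blast
qed

lemma (in ring) finite_length_zero_or_simple:
  assumes "right_ideal T R" and "\<And>N. right_ideal N R \<Longrightarrow> N \<subseteq> T \<Longrightarrow> N = {\<zero>} \<or> N = T"
  shows "finite_length_ideal R T"
  unfolding finite_length_ideal_def
proof (intro conjI allI impI assms(1))
  fix V :: "nat \<Rightarrow> 'a set"
  assume V: "(\<forall>k. right_ideal (V k) R \<and> V k \<subseteq> T) \<and>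
        ((\<forall>k. V k \<subseteq> V (Suc k)) \<or> (\<forall>k. V (Suc k) \<subseteq> V k))"
  then have two: "V k = {\<zero>} \<or> V k = T" for k using assms(2) by blast
  have z: "\<zero> \<in> T" using right_ideal_zero[OF assms(1)] .
  show "\<exists>m. \<forall>k\<ge>m. V k = V m"
  proof (rule ccontr)
    assume no: "\<nexists>m. \<forall>k\<ge>m. V k = V m"
    then obtain i where i: "V i \<noteq> V 0" by blast
    obtain j where j: "j \<ge> i" "V j \<noteq> V i" using no by blast
    have "V j = V 0" "T \<noteq> {\<zero>}" using i j two by metis+
    from V consider "\<forall>k. V k \<subseteq> V (Suc k)" | "\<forall>k. V (Suc k) \<subseteq> V k" by blast
    then show False
    proof cases
      case 1
      then have "V 0 \<subseteq> V i" "V i \<subseteq> V j" using lift_Suc_mono_le[of V] j(1) by auto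
      then show False using \<open>V j = V 0\<close> i by blast
    next
      case 2
      then have "V i \<subseteq> V 0" "V j \<subseteq> V i" using lift_Suc_antimono_le[of V] j(1) by auto
      then show False using \<open>V j = V 0\<close> i by blast
    qed
  qed
qed

text \<open>
The elements that lie in some right ideal of finite length form a right ideal, and it contains all
simple ones.
\<close>

lemma (in ring) socle_finite_length:
  assumes "t \<in> right_socle R"
  obtains U where "finite_length_ideal R U" "t \<in> U"
proof -
  let ?N = "{t \<in> carrier R. \<exists>U. finite_length_ideal R U \<and> t \<in> U}"
  have "right_ideal ?N R" unfolding right_ideal_iff
  proof (intro conjI ballI)
    have "finite_length_ideal R {\<zero>}"
      by (rule finite_length_zero_or_simple[OF right_ideal_zero_set])
        (use right_ideal_zero in blast)
    then show "\<zero> \<in> ?N" by auto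
    fix x y assume "x \<in> ?N" "y \<in> ?N"
    then obtain U W where *: "finite_length_ideal R U" "x \<in> U" "finite_length_ideal R W" "y \<in> W"
      and c: "x \<in> carrier R" "y \<in> carrier R" by blast
    have "x \<oplus> y \<in> U <+>\<^bsub>R\<^esub> W" using *(2,4) by (rule set_addI)
    then show "x \<oplus> y \<in> ?N" using finite_length_sum * c by blast
  next
    fix a x assume a: "a \<in> carrier R" and "x \<in> ?N"
    then obtain U where *: "finite_length_ideal R U" "x \<in> U" and c: "x \<in> carrier R" by blast
    then have "x \<otimes> a \<in> U" using a by (simp add: finite_length_ideal_def right_ideal_iff)
    then show "x \<otimes> a \<in> ?N" using * c a by blast
  qed auto
  moreover have "T \<subseteq> ?N" if T: "simple_right_ideal T R" for T
  proof -
    have "right_ideal T R" using T by (simp add: simple_submodule_def)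
    moreover have "finite_length_ideal R T"
      using finite_length_zero_or_simple[of T] T by (simp add: simple_submodule_def)
    ultimately show ?thesis using right_ideal_carrier by blast
  qed
  ultimately have "right_socle R \<subseteq> ?N" using socle_subset by blast
  then show thesis using assms that by blast
qed

text \<open>
Fitting's lemma for left multiplication by \<open>t\<close> on a right ideal of finite length.  For a suitable
power \<open>u\<close> of \<open>t\<close> the descending chain of images gives \<open>uR = u\<^sup>2R\<close>, and the ascending chain of kernels
then gives injectivity of \<open>u\<close> on \<open>uR\<close>.
\<close>

lemma (in ring) socle_power_fitting:
  assumes t: "t \<in> right_socle R"
  obtains n c where "n \<ge> (1::nat)" "c \<in> carrier R" "t [^] n = t [^] n \<otimes> t [^] n \<otimes> c"
    "\<And>r. r \<in> carrier R \<Longrightarrow> t [^] n \<otimes> (t [^] n \<otimes> r) = \<zero> \<Longrightarrow> t [^] n \<otimes> r = \<zero>"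
proof -
  have tc: "t \<in> carrier R" using t right_ideal_carrier[OF socle_right_ideal] by blast
  obtain U where U: "finite_length_ideal R U" "t \<in> U" using socle_finite_length[OF t] .
  have rU: "right_ideal U R" using U by (simp add: finite_length_ideal_def)
  have pow: "t [^] Suc k \<otimes> r = t \<otimes> (t [^] k \<otimes> r)" if "r \<in> carrier R" for k r
    using that tc by (metis m_assoc nat_pow_Suc2 nat_pow_closed)
  have powU: "t [^] Suc k \<otimes> r \<in> U" if "r \<in> carrier R" for k r
    using that tc rU U(2) unfolding pow[OF that] right_ideal_iff by auto
  let ?V = "\<lambda>k. (\<otimes>) (t [^] Suc k) ` carrier R"
  have V1: "\<forall>k. right_ideal (?V k) R \<and> ?V k \<subseteq> U"
    using powU principal_right_ideal[OF nat_pow_closed[OF tc]] by blast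
  have "?V (Suc k) \<subseteq> ?V k" for k
  proof -
    have "t [^] Suc (Suc k) \<otimes> r = t [^] Suc k \<otimes> (t \<otimes> r)" if "r \<in> carrier R" for r
      using that tc by (simp add: m_assoc)
    then show ?thesis using tc by auto
  qed
  then have "\<exists>m. \<forall>k\<ge>m. ?V k = ?V m"
    using U(1) V1 unfolding finite_length_ideal_def by (elim conjE allE[of _ ?V]) blast
  then obtain m where m: "\<And>k. k \<ge> m \<Longrightarrow> ?V k = ?V m" by blast
  define n where "n = Suc m"
  define u where "u = t [^] n"
  have uc: "u \<in> carrier R" using tc by (simp add: u_def)
  have "n + n = Suc (m + n)" by (simp add: n_def)
  then have "u \<otimes> u = t [^] Suc (m + n)" using nat_pow_mult[OF tc, of n n] by (simp only: u_def)
  moreover have "u \<in> ?V m"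
    unfolding u_def n_def using tc by (metis imageI nat_pow_closed one_closed r_one)
  ultimately obtain c where c: "c \<in> carrier R" "u = u \<otimes> u \<otimes> c" using m[of "m + n"] by auto
  \<comment> \<open>Iterating \<open>u = u\<^sup>2 c\<close> shows that every power of \<open>u\<close> has the same image.\<close>
  have red: "u = u [^] Suc j \<otimes> c [^] j" for j
  proof (induction j)
    case 0
    then show ?case using uc by simp
  next
    case (Suc j)
    have "u [^] Suc (Suc j) \<otimes> c [^] Suc j = u [^] j \<otimes> (u \<otimes> u \<otimes> c) \<otimes> c [^] j"
      using uc c(1) nat_pow_Suc2[OF c(1), of j] by (simp add: m_assoc)
    also have "\<dots> = u [^] Suc j \<otimes> c [^] j" using c(2) uc by simp
    finally show ?case using Suc by simp
  qed
  have uU: "u \<otimes> r \<in> U" if "r \<in> carrier R" for r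
    using powU[OF that, of m] by (simp add: u_def n_def)
  let ?W = "\<lambda>k::nat. (\<otimes>) u ` carrier R \<inter> {r \<in> carrier R. u [^] k \<otimes> r \<in> {\<zero>}}"
  have W1: "\<forall>k. right_ideal (?W k) R \<and> ?W k \<subseteq> U"
  proof (intro allI conjI)
    fix k
    show "right_ideal (?W k) R"
      by (rule right_ideal_Int[OF principal_right_ideal[OF uc]
            right_ideal_quotient[OF nat_pow_closed[OF uc] right_ideal_zero_set]])
    show "?W k \<subseteq> U" using uU by auto
  qed
  have "?W k \<subseteq> ?W (Suc k)" for k
    using uc nat_pow_Suc2[OF uc, of k] by (auto simp: m_assoc)
  then have "\<exists>m. \<forall>k\<ge>m. ?W k = ?W m"
    using U(1) W1 unfolding finite_length_ideal_def by (elim conjE allE[of _ ?W]) blast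
  then obtain m' where m': "\<forall>k\<ge>m'. ?W k = ?W m'" ..
  have W: "?W (Suc m') = ?W m'" using m'[rule_format, OF le_SucI[OF order_refl]] .
  have "u \<otimes> r = \<zero>" if r: "r \<in> carrier R" "u \<otimes> (u \<otimes> r) = \<zero>" for r
  proof -
    define w where "w = u \<otimes> (c [^] m' \<otimes> r)"
    have wc: "w \<in> carrier R" using uc c r by (simp add: w_def)
    have ur: "u \<otimes> r = u [^] m' \<otimes> w"
    proof -
      have "u \<otimes> r = (u [^] Suc m' \<otimes> c [^] m') \<otimes> r" using red[of m'] by simp
      then show ?thesis using uc c(1) r by (simp add: w_def m_assoc)
    qed
    have "u [^] Suc m' \<otimes> w = u \<otimes> (u \<otimes> r)"
      unfolding ur using nat_pow_Suc2[OF uc, of m'] uc wc by (simp add: m_assoc)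
    then have "w \<in> ?W (Suc m')" using r wc uc c by (auto simp: w_def)
    then have "w \<in> ?W m'" by (rule W[THEN equalityD1, THEN subsetD])
    then show ?thesis using ur by simp
  qed
  then show thesis using that[of n c] c by (simp add: u_def n_def)
qed

section \<open>Lifting idempotents\<close>

lemma (in ring) diff_zero_imp_eq:
  assumes "a \<in> carrier R" "b \<in> carrier R" "a \<ominus> b = \<zero>" shows "a = b"
proof -
  have "a = (a \<ominus> b) \<oplus> b" using assms(1,2) by (simp add: a_minus_def a_assoc l_neg)
  then show ?thesis using assms by simp
qed

text \<open>
A commutative subring around \<open>y\<close>.  It makes computations with polynomials in \<open>y\<close> possible without
having to evaluate polynomials in a noncommutative ring.
\<close>

definition bicommutant :: "('a, 'c) ring_scheme \<Rightarrow> 'a \<Rightarrow> 'a set" where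
  "bicommutant R y =
     {a \<in> carrier R. \<forall>b\<in>carrier R. b \<otimes>\<^bsub>R\<^esub> y = y \<otimes>\<^bsub>R\<^esub> b \<longrightarrow> a \<otimes>\<^bsub>R\<^esub> b = b \<otimes>\<^bsub>R\<^esub> a}"

context ring
begin

lemma bicommutant_carrier: "a \<in> bicommutant R y \<Longrightarrow> a \<in> carrier R"
  by (simp add: bicommutant_def)

lemma bicommutantD:
  "a \<in> bicommutant R y \<Longrightarrow> b \<in> carrier R \<Longrightarrow> b \<otimes> y = y \<otimes> b \<Longrightarrow> a \<otimes> b = b \<otimes> a"
  unfolding bicommutant_def by blast

lemma bicommutantI:
  "a \<in> carrier R \<Longrightarrow> (\<And>b. b \<in> carrier R \<Longrightarrow> b \<otimes> y = y \<otimes> b \<Longrightarrow> a \<otimes> b = b \<otimes> a) \<Longrightarrow> a \<in> bicommutant R y"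
  unfolding bicommutant_def by blast

lemma bicommutant_self: "y \<in> carrier R \<Longrightarrow> y \<in> bicommutant R y"
  by (rule bicommutantI) simp_all

lemma bicommutant_zero: "\<zero> \<in> bicommutant R y"
  by (rule bicommutantI) simp_all

lemma bicommutant_one: "\<one> \<in> bicommutant R y"
  by (rule bicommutantI) simp_all

lemma bicommutant_add:
  assumes "a \<in> bicommutant R y" "b \<in> bicommutant R y" shows "a \<oplus> b \<in> bicommutant R y"
proof (rule bicommutantI)
  fix d assume d: "d \<in> carrier R" "d \<otimes> y = y \<otimes> d"
  then show "(a \<oplus> b) \<otimes> d = d \<otimes> (a \<oplus> b)"
    using bicommutantD[OF assms(1) d] bicommutantD[OF assms(2) d] assms[THEN bicommutant_carrier]
    by (simp add: l_distr r_distr)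
qed (use assms[THEN bicommutant_carrier] in simp)

lemma bicommutant_diff:
  assumes "a \<in> bicommutant R y" "b \<in> bicommutant R y" shows "a \<ominus> b \<in> bicommutant R y"
proof (rule bicommutantI)
  fix d assume d: "d \<in> carrier R" "d \<otimes> y = y \<otimes> d"
  then show "(a \<ominus> b) \<otimes> d = d \<otimes> (a \<ominus> b)"
    using bicommutantD[OF assms(1) d] bicommutantD[OF assms(2) d] assms[THEN bicommutant_carrier]
    by (simp add: a_minus_def l_distr r_distr l_minus r_minus)
qed (use assms[THEN bicommutant_carrier] in simp)

lemma bicommutant_mult:
  assumes "a \<in> bicommutant R y" "b \<in> bicommutant R y" shows "a \<otimes> b \<in> bicommutant R y"
proof (rule bicommutantI)
  fix d assume d: "d \<in> carrier R" "d \<otimes> y = y \<otimes> d"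
  note c = assms[THEN bicommutant_carrier]
  have "a \<otimes> b \<otimes> d = a \<otimes> (d \<otimes> b)" using bicommutantD[OF assms(2) d] c d by (simp add: m_assoc)
  also have "\<dots> = (d \<otimes> a) \<otimes> b" using bicommutantD[OF assms(1) d] c d by (simp flip: m_assoc)
  finally show "a \<otimes> b \<otimes> d = d \<otimes> (a \<otimes> b)" using c d by (simp add: m_assoc)
qed (use assms[THEN bicommutant_carrier] in simp)

lemma bicommutant_pow: "a \<in> bicommutant R y \<Longrightarrow> a [^] (n::nat) \<in> bicommutant R y"
  by (induction n) (simp_all add: bicommutant_one bicommutant_mult)

lemma bicommutant_commute:
  assumes y: "y \<in> carrier R" and a: "a \<in> bicommutant R y" and b: "b \<in> bicommutant R y"
  shows "a \<otimes> b = b \<otimes> a"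
  using bicommutantD[OF a bicommutant_carrier[OF b]] bicommutantD[OF b y] by blast

lemma bicommutant_subset:
  assumes y: "y \<in> carrier R" and v: "v \<in> bicommutant R y"
  shows "bicommutant R v \<subseteq> bicommutant R y"
proof
  fix a assume a: "a \<in> bicommutant R v"
  show "a \<in> bicommutant R y"
  proof (rule bicommutantI[OF bicommutant_carrier[OF a]])
    fix d assume d: "d \<in> carrier R" "d \<otimes> y = y \<otimes> d"
    show "a \<otimes> d = d \<otimes> a" using bicommutantD[OF a d(1) bicommutantD[OF v d, symmetric]] .
  qed
qed

lemma commuting_mult_pow:
  assumes "a \<in> carrier R" "b \<in> carrier R" "a \<otimes> b = b \<otimes> a"
  shows "(a \<otimes> b) [^] (n::nat) = a [^] n \<otimes> b [^] n"
proof (induction n)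
  case (Suc n)
  have comm: "b [^] n \<otimes> a = a \<otimes> b [^] n"
  proof -
    have "b [^] n \<in> bicommutant R b" using assms bicommutant_pow bicommutant_self by blast
    then show ?thesis using bicommutantD assms by blast
  qed
  have "a [^] n \<otimes> b [^] n \<otimes> (a \<otimes> b) = a [^] n \<otimes> (b [^] n \<otimes> a) \<otimes> b"
    using assms by (simp add: m_assoc)
  also have "\<dots> = a [^] Suc n \<otimes> b [^] Suc n" unfolding comm using assms by (simp add: m_assoc)
  finally show ?case using Suc by simp
qed simp

lemma one_minus_pow_factor:
  assumes v: "v \<in> carrier R"
  obtains q where "q \<in> bicommutant R v" "\<one> \<ominus> v [^] (n::nat) = (\<one> \<ominus> v) \<otimes> q"
proof -
  have "\<exists>q \<in> bicommutant R v. \<one> \<ominus> v [^] n = (\<one> \<ominus> v) \<otimes> q"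
  proof (induction n)
    case 0
    then show ?case using v bicommutant_zero by (intro bexI[of _ \<zero>]) (simp_all add: a_minus_def r_neg)
  next
    case (Suc n)
    then obtain q where q: "q \<in> bicommutant R v" "\<one> \<ominus> v [^] n = (\<one> \<ominus> v) \<otimes> q" by blast
    have qc: "q \<in> carrier R" using q bicommutant_carrier by blast
    have "\<one> \<ominus> v [^] Suc n = (\<one> \<ominus> v) \<oplus> (\<one> \<ominus> v [^] n) \<otimes> v"
      using v by (simp add: a_minus_def l_distr l_minus a_assoc r_neg1)
    also have "\<dots> = (\<one> \<ominus> v) \<otimes> (\<one> \<oplus> q \<otimes> v)"
      unfolding q(2) using v qc by (simp add: r_distr m_assoc)
    finally show ?case
      using q v bicommutant_add bicommutant_one bicommutant_mult bicommutant_self by blast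
  qed
  then show thesis using that by blast
qed

lemma idempotent_pow:
  assumes "e \<in> carrier R" "e \<otimes> e = e" "n \<ge> (1::nat)" shows "e [^] n = e"
  using assms(3)
proof (induction n rule: dec_induct)
  case base
  then show ?case using assms by simp
next
  case (step n)
  then show ?case using assms by simp
qed

lemma one_minus_idempotent:
  assumes "e \<in> carrier R" "e \<otimes> e = e" shows "(\<one> \<ominus> e) \<otimes> (\<one> \<ominus> e) = \<one> \<ominus> e"
  using assms by (simp add: a_minus_def l_distr r_distr l_minus r_minus r_neg a_assoc)

text \<open>
With \<open>n\<close> such that \<open>(y (1 - y))\<^sup>n = 0\<close>, the idempotent is \<open>e = 1 - (1 - y\<^sup>n)\<^sup>n\<close>: it is divisible by \<open>y\<^sup>n\<close>,
while \<open>1 - e = (1 - y\<^sup>n)\<^sup>n\<close> is divisible by \<open>(1 - y)\<^sup>n\<close>, so \<open>e (1 - e) = 0\<close>.  Modulo the ideal, where \<open>y\<close>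
is idempotent, the formula evaluates to \<open>y\<close>.
\<close>

lemma nil_idempotent_lift:
  assumes I: "ideal I R" and y: "y \<in> carrier R" and yI: "y \<otimes> y \<ominus> y \<in> I"
    and nil: "(y \<otimes> (\<one> \<ominus> y)) [^] (n::nat) = \<zero>" and n: "n \<ge> 1"
  obtains e where "e \<in> carrier R" "e \<otimes> e = e" "e \<ominus> y \<in> I"
proof -
  interpret I: ideal I R by (rule I)
  interpret Q: ring "R Quot I" by (rule I.quotient_is_ring)
  interpret \<pi>: ring_hom_ring R "R Quot I" "(+>) I" by (rule I.rcos_ring_hom_ring)
  define w where "w = y [^] n"
  define v where "v = \<one> \<ominus> w"
  define e where "e = \<one> \<ominus> v [^] n"
  have wc: "w \<in> carrier R" and vc: "v \<in> carrier R" and ec: "e \<in> carrier R"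
    using y by (simp_all add: w_def v_def e_def)
  have wB: "w \<in> bicommutant R y" using y by (simp add: w_def bicommutant_pow bicommutant_self)
  then have vB: "v \<in> bicommutant R y" by (simp add: v_def bicommutant_diff bicommutant_one)
  obtain p where p: "p \<in> bicommutant R v" "\<one> \<ominus> v [^] n = (\<one> \<ominus> v) \<otimes> p"
    using one_minus_pow_factor[OF vc] .
  obtain q where q: "q \<in> bicommutant R y" "\<one> \<ominus> y [^] n = (\<one> \<ominus> y) \<otimes> q"
    using one_minus_pow_factor[OF y] .
  have pB: "p \<in> bicommutant R y" using p bicommutant_subset[OF y vB] by blast
  have yB: "\<one> \<ominus> y \<in> bicommutant R y"
    using y by (simp add: bicommutant_diff bicommutant_one bicommutant_self)
  have cc: "p \<in> carrier R" "q \<in> carrier R" "\<one> \<ominus> y \<in> carrier R"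
    using pB q y bicommutant_carrier by auto
  have "\<one> \<ominus> v = w" using wc unfolding v_def
    by (simp add: a_minus_def minus_add r_neg1 a_assoc[symmetric] r_neg)
  then have e1: "e = y [^] n \<otimes> p" using p by (simp add: e_def w_def)
  have "\<one> \<ominus> e = v [^] n" using vc unfolding e_def
    by (simp add: a_minus_def minus_add r_neg1 a_assoc[symmetric] r_neg)
  also have "\<dots> = ((\<one> \<ominus> y) \<otimes> q) [^] n" using q by (simp add: v_def w_def)
  also have "\<dots> = (\<one> \<ominus> y) [^] n \<otimes> q [^] n"
    using commuting_mult_pow[OF cc(3,2) bicommutant_commute[OF y yB q(1)]] .
  finally have e2: "\<one> \<ominus> e = (\<one> \<ominus> y) [^] n \<otimes> q [^] n" .
  have "p \<otimes> (\<one> \<ominus> y) [^] n = (\<one> \<ominus> y) [^] n \<otimes> p"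
    using bicommutant_commute[OF y pB bicommutant_pow[OF yB]] .
  then have "e \<otimes> (\<one> \<ominus> e) = (y [^] n \<otimes> (\<one> \<ominus> y) [^] n) \<otimes> (p \<otimes> q [^] n)"
    unfolding e2 unfolding e1 using y cc
    by (smt (verit) m_assoc m_closed nat_pow_closed)
  also have "y [^] n \<otimes> (\<one> \<ominus> y) [^] n = \<zero>"
    using commuting_mult_pow[OF y cc(3) bicommutant_commute[OF y bicommutant_self[OF y] yB]] nil
    by simp
  finally have "e \<otimes> (\<one> \<ominus> e) = \<zero>" using cc by simp
  then have "e \<oplus> \<ominus> (e \<otimes> e) = \<zero>" using ec by (simp add: a_minus_def r_distr r_minus)
  then have ee: "e \<otimes> e = e" using ec diff_zero_imp_eq[of e "e \<otimes> e"] by (simp add: a_minus_def)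
  let ?y = "I +> y"
  have "I +> (y \<otimes> y) = ?y" using I.coset_eq_iff yI y by blast
  then have yy: "?y \<otimes>\<^bsub>R Quot I\<^esub> ?y = ?y" using y by simp
  have yc: "?y \<in> carrier (R Quot I)" using y by simp
  have hpow: "I +> (x [^] n) = (I +> x) [^]\<^bsub>R Quot I\<^esub> n" if "x \<in> carrier R" for x and n :: nat
    using that by (induction n) simp_all
  have hdiff: "I +> (\<one> \<ominus> x) = \<one>\<^bsub>R Quot I\<^esub> \<ominus>\<^bsub>R Quot I\<^esub> (I +> x)" if "x \<in> carrier R" for x
    using that by (simp add: a_minus_def Q.minus_eq)
  have "I +> v = \<one>\<^bsub>R Quot I\<^esub> \<ominus>\<^bsub>R Quot I\<^esub> ?y"
    unfolding v_def w_def using y hdiff hpow Q.idempotent_pow[OF yc yy n] by simp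
  then have "I +> (v [^] n) = \<one>\<^bsub>R Quot I\<^esub> \<ominus>\<^bsub>R Quot I\<^esub> ?y"
    using hpow[OF vc] Q.idempotent_pow[OF _ Q.one_minus_idempotent[OF yc yy] n] yc by simp
  then have "I +> e = \<one>\<^bsub>R Quot I\<^esub> \<ominus>\<^bsub>R Quot I\<^esub> (\<one>\<^bsub>R Quot I\<^esub> \<ominus>\<^bsub>R Quot I\<^esub> ?y)"
    unfolding e_def using hdiff vc by simp
  also have "\<dots> = ?y" using yc
    by (simp add: Q.minus_eq Q.minus_add Q.r_neg1 Q.a_assoc[symmetric] Q.r_neg)
  finally have "e \<ominus> y \<in> I" using I.coset_eq_iff ec y by blast
  then show thesis using that ec ee by blast
qed

text \<open>
A power of \<open>s = x\<^sup>2 - x\<close> that lies in the socle has a further power \<open>u = s\<^sup>n\<close> with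
\<open>R = uR \<oplus> ker u\<close>.  The projection onto \<open>uR\<close> is left multiplication by an idempotent \<open>g = u c\<close>; it commutes with \<open>x\<close>
since \<open>x\<close> preserves both summands.  On the complement \<open>s\<close> is nilpotent, so the nilpotent case applies
to \<open>y = x (1 - g)\<close>, and \<open>y - x = - x g\<close> lies in the socle.
\<close>

lemma idempotents_lift_modulo_delta:
  assumes pow: "\<And>s. s \<in> delta_right R \<Longrightarrow> \<exists>n\<ge>1::nat. s [^] n \<in> right_socle R"
  shows "idempotents_lift_modulo R (delta_right R)"
  unfolding idempotents_lift_modulo_def
proof (intro ballI impI)
  let ?D = "delta_right R" and ?S = "right_socle R"
  interpret D: ideal ?D R by (rule delta_ideal)
  interpret S: ideal ?S R by (rule socle_ideal)
  fix x assume x: "x \<in> carrier R" and xD: "x \<otimes> x \<ominus> x \<in> ?D"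
  define s where "s = x \<otimes> x \<ominus> x"
  have sc: "s \<in> carrier R" using x by (simp add: s_def)
  have sB: "s \<in> bicommutant R x" unfolding s_def
    using x by (intro bicommutant_diff bicommutant_mult bicommutant_self)
  obtain k where k: "k \<ge> (1::nat)" "s [^] k \<in> ?S" using pow[of s] xD s_def by blast
  obtain m c where m: "m \<ge> (1::nat)" "c \<in> carrier R"
    "(s [^] k) [^] m = (s [^] k) [^] m \<otimes> (s [^] k) [^] m \<otimes> c"
    "\<And>r. r \<in> carrier R \<Longrightarrow> (s [^] k) [^] m \<otimes> ((s [^] k) [^] m \<otimes> r) = \<zero> \<Longrightarrow> (s [^] k) [^] m \<otimes> r = \<zero>"
    using socle_power_fitting[OF k(2)] by blast
  define n where "n = k * m"
  define u where "u = s [^] n"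
  have n: "n \<ge> 1" using k m by (simp add: n_def)
  have u_eq: "(s [^] k) [^] m = u" using sc by (simp add: u_def n_def nat_pow_pow)
  have uc: "u \<in> carrier R" using sc by (simp add: u_def)
  have uS: "u \<in> ?S"
  proof -
    obtain j where "m = Suc j" using m(1) by (cases m) auto
    then show ?thesis using u_eq k(2) sc S.I_l_closed[of "s [^] k" "(s [^] k) [^] j"] by simp
  qed
  have uB: "u \<in> bicommutant R x" using sB by (simp add: u_def bicommutant_pow)
  then have xu: "x \<otimes> u = u \<otimes> x" using bicommutantD[OF uB x] by simp
  have ucc: "u = u \<otimes> u \<otimes> c" and inj: "\<And>r. r \<in> carrier R \<Longrightarrow> u \<otimes> (u \<otimes> r) = \<zero> \<Longrightarrow> u \<otimes> r = \<zero>"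
    using m unfolding u_eq by blast+
  define g where "g = u \<otimes> c"
  have gc: "g \<in> carrier R" using uc m(2) by (simp add: g_def)
  have ug: "u \<otimes> g = u" using ucc uc m(2) by (simp add: g_def m_assoc)
  \<comment> \<open>Elements of \<open>uR\<close> are equal once their products with \<open>u\<close> are; this proves the next two identities.\<close>
  have eqI: "u \<otimes> a = u \<otimes> b" if "a \<in> carrier R" "b \<in> carrier R" "u \<otimes> (u \<otimes> a) = u \<otimes> (u \<otimes> b)" for a b
  proof -
    have "u \<otimes> (u \<otimes> (a \<ominus> b)) = \<zero>"
      using that uc by (simp add: a_minus_def r_distr r_minus r_neg)
    then have "u \<otimes> (a \<ominus> b) = \<zero>" using inj that by simp
    then have "u \<otimes> a \<ominus> u \<otimes> b = \<zero>" using that uc by (simp add: a_minus_def r_distr r_minus)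
    then show ?thesis using that uc diff_zero_imp_eq by simp
  qed
  have gg: "g \<otimes> g = g"
  proof -
    have "u \<otimes> (u \<otimes> (c \<otimes> g)) = (u \<otimes> g) \<otimes> g" using uc m(2) gc by (simp add: g_def m_assoc)
    also have "\<dots> = u \<otimes> (u \<otimes> c)" using ug by (simp add: g_def)
    finally have "u \<otimes> (c \<otimes> g) = u \<otimes> c" using eqI[of "c \<otimes> g" c] m(2) gc by simp
    then show ?thesis using uc m(2) gc unfolding g_def by (simp add: m_assoc)
  qed
  have xg: "x \<otimes> g = g \<otimes> x"
  proof -
    have g1: "x \<otimes> g = u \<otimes> (x \<otimes> c)" using xu x uc m(2) unfolding g_def by (metis m_assoc)
    have g2: "g \<otimes> x = u \<otimes> (c \<otimes> x)" using x uc m(2) unfolding g_def by (simp add: m_assoc)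
    have "u \<otimes> (x \<otimes> g) = x \<otimes> (u \<otimes> g)" using xu x uc gc by (metis m_assoc)
    also have "\<dots> = (u \<otimes> g) \<otimes> x" using ug xu by simp
    also have "\<dots> = u \<otimes> (g \<otimes> x)" using x uc gc by (simp add: m_assoc)
    finally show ?thesis unfolding g1 g2 using eqI[of "x \<otimes> c" "c \<otimes> x"] x m(2) by simp
  qed
  define h where "h = \<one> \<ominus> g"
  define y where "y = x \<otimes> h"
  have hc: "h \<in> carrier R" and yc: "y \<in> carrier R" using gc x by (simp_all add: h_def y_def)
  have hh: "h \<otimes> h = h" unfolding h_def using one_minus_idempotent[OF gc gg] .
  have xh: "x \<otimes> h = h \<otimes> x" unfolding h_def using x gc xg
    by (simp add: a_minus_def l_distr r_distr l_minus r_minus)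
  have uh: "u \<otimes> h = \<zero>" unfolding h_def using uc gc ug
    by (simp add: a_minus_def r_distr r_minus r_neg)
  have yy: "y \<otimes> y = x \<otimes> x \<otimes> h"
  proof -
    have "y \<otimes> y = x \<otimes> (h \<otimes> x) \<otimes> h" using x hc by (simp add: y_def m_assoc)
    also have "\<dots> = x \<otimes> x \<otimes> (h \<otimes> h)" unfolding xh[symmetric] using x hc by (simp add: m_assoc)
    finally show ?thesis using hh by simp
  qed
  have ys: "y \<otimes> y \<ominus> y = s \<otimes> h"
    unfolding yy unfolding y_def s_def using x hc by (simp add: a_minus_def l_distr l_minus)
  have sh: "s \<otimes> h = h \<otimes> s" using bicommutantD[OF sB hc] xh by simp
  have mc: "\<ominus> h \<in> carrier R" using hc by simp
  have "y \<otimes> (\<one> \<ominus> y) = s \<otimes> (\<ominus> h)"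
  proof -
    have "y \<otimes> (\<one> \<ominus> y) = \<ominus> (y \<otimes> y \<ominus> y)"
      using yc by (simp add: a_minus_def r_distr r_minus minus_add a_comm)
    then show ?thesis using ys sc hc by (simp add: r_minus)
  qed
  moreover have "s \<otimes> (\<ominus> h) = (\<ominus> h) \<otimes> s" using sh sc hc by (simp add: l_minus r_minus)
  ultimately have "(y \<otimes> (\<one> \<ominus> y)) [^] n = u \<otimes> (\<ominus> h) [^] n"
    using commuting_mult_pow[OF sc mc] by (simp add: u_def)
  moreover obtain j where j: "n = Suc j" using n by (cases n) auto
  have "u \<otimes> (\<ominus> h) [^] Suc j = \<ominus> (u \<otimes> h) \<otimes> (\<ominus> h) [^] j"
    using uc hc mc nat_pow_Suc2[OF mc, of j] by (simp add: r_minus l_minus m_assoc)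
  then have "u \<otimes> (\<ominus> h) [^] n = \<zero>" using uh j mc by simp
  ultimately have nil: "(y \<otimes> (\<one> \<ominus> y)) [^] n = \<zero>" by simp
  have yD: "y \<otimes> y \<ominus> y \<in> ?D" unfolding ys using xD hc by (simp add: s_def D.I_r_closed)
  obtain e where e: "e \<in> carrier R" "e \<otimes> e = e" "e \<ominus> y \<in> ?D"
    using nil_idempotent_lift[OF delta_ideal yc yD nil n] .
  have gD: "g \<in> ?D" using uS m(2) socle_subset_delta S.I_r_closed unfolding g_def by blast
  have "y \<ominus> x = x \<otimes> (\<ominus> g)"
    unfolding y_def h_def using x gc
    by (simp add: a_minus_def r_distr r_minus) (simp add: a_ac r_neg1 r_neg2)
  moreover have "x \<otimes> (\<ominus> g) \<in> ?D" using gD x D.I_l_closed by simp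
  ultimately have "y \<ominus> x \<in> ?D" by simp
  then have "(e \<ominus> y) \<oplus> (y \<ominus> x) \<in> ?D" using e by simp
  moreover have "(e \<ominus> y) \<oplus> (y \<ominus> x) = e \<ominus> x"
    using e yc x by (simp add: a_minus_def a_assoc r_neg1)
  ultimately show "\<exists>e\<in>carrier R. e \<otimes> e = e \<and> e \<ominus> x \<in> ?D" using e by auto
qed

end

section \<open>Submodules that supplement a \<open>\<delta>\<close>-small one\<close>

lemma (in right_module) scalar_image_submodule:
  assumes U: "right_ideal U R" and y: "y \<in> carrier M"
  shows "submodule ((\<lambda>a. a \<odot>\<^bsub>M\<^esub> y) ` U) R M"
proof -
  have c: "\<And>a. a \<in> U \<Longrightarrow> a \<in> carrier R" using R.right_ideal_carrier[OF U] .
  show ?thesis unfolding submodule_iff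
  proof (intro conjI ballI)
    show "(\<lambda>a. a \<odot>\<^bsub>M\<^esub> y) ` U \<subseteq> carrier M" using c y act_closed by auto
    show "\<zero>\<^bsub>M\<^esub> \<in> (\<lambda>a. a \<odot>\<^bsub>M\<^esub> y) ` U"
      using R.right_ideal_zero[OF U] zero_act[OF y] by (metis imageI)
    fix u v assume "u \<in> (\<lambda>a. a \<odot>\<^bsub>M\<^esub> y) ` U" "v \<in> (\<lambda>a. a \<odot>\<^bsub>M\<^esub> y) ` U"
    then obtain a b where ab: "a \<in> U" "b \<in> U" "u = a \<odot>\<^bsub>M\<^esub> y" "v = b \<odot>\<^bsub>M\<^esub> y" by blast
    then have "u \<oplus>\<^bsub>M\<^esub> v = (a \<oplus>\<^bsub>R\<^esub> b) \<odot>\<^bsub>M\<^esub> y" using c y by (simp add: act_add_scalar)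
    moreover have "a \<oplus>\<^bsub>R\<^esub> b \<in> U" using U ab by (simp add: R.right_ideal_iff)
    ultimately show "u \<oplus>\<^bsub>M\<^esub> v \<in> (\<lambda>a. a \<odot>\<^bsub>M\<^esub> y) ` U" by blast
  next
    fix b u assume b: "b \<in> carrier R" and "u \<in> (\<lambda>a. a \<odot>\<^bsub>M\<^esub> y) ` U"
    then obtain a where a: "a \<in> U" "u = a \<odot>\<^bsub>M\<^esub> y" by blast
    then have "b \<odot>\<^bsub>M\<^esub> u = (a \<otimes>\<^bsub>R\<^esub> b) \<odot>\<^bsub>M\<^esub> y" using b c y by (simp add: right_assoc)
    moreover have "a \<otimes>\<^bsub>R\<^esub> b \<in> U" using U a b by (simp add: R.right_ideal_iff)
    ultimately show "b \<odot>\<^bsub>M\<^esub> u \<in> (\<lambda>a. a \<odot>\<^bsub>M\<^esub> y) ` U" by blast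
  qed
qed

lemma (in right_module) conductor_right_ideal:
  assumes K: "submodule K R M" and y: "y \<in> carrier M"
  shows "right_ideal {a \<in> carrier R. a \<odot>\<^bsub>M\<^esub> y \<in> K} R"
  using K y unfolding R.right_ideal_iff submodule_iff
  by (auto simp: zero_act act_add_scalar right_assoc)

text \<open>
The element \<open>y + K\<close> of the quotient is annihilated by the right ideal \<open>{a. y a \<in> K}\<close>.
\<close>

lemma (in right_module) singular_quotientI:
  assumes K: "submodule K R M"
    and ess: "\<And>y. y \<in> carrier M \<Longrightarrow> essential_right_ideal {a \<in> carrier R. a \<odot>\<^bsub>M\<^esub> y \<in> K} R"
  shows "singular_module R (quot_module M K)"
  unfolding singular_module_def
proof
  have sg: "subgroup K (add_monoid M)" using K by (simp add: submodule_def)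
  have KM: "K \<subseteq> carrier M" using submodule_carrier[OF K] by blast
  fix C assume "C \<in> carrier (quot_module M K)"
  then obtain y where y: "y \<in> carrier M" "C = K +>\<^bsub>M\<^esub> y"
    unfolding quot_module_def A_RCOSETS_def' by auto
  let ?I = "{a \<in> carrier R. a \<odot>\<^bsub>M\<^esub> y \<in> K}"
  have "a \<odot>\<^bsub>quot_module M K\<^esub> C = \<zero>\<^bsub>quot_module M K\<^esub>" if a: "a \<in> ?I" for a
  proof -
    have "K +>\<^bsub>M\<^esub> (a \<odot>\<^bsub>M\<^esub> x) = K" if x: "x \<in> C" for x
    proof -
      obtain k where k: "k \<in> K" "x = k \<oplus>\<^bsub>M\<^esub> y" using x y by (auto simp: a_r_coset_def')
      then have "a \<odot>\<^bsub>M\<^esub> x = a \<odot>\<^bsub>M\<^esub> k \<oplus>\<^bsub>M\<^esub> a \<odot>\<^bsub>M\<^esub> y"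
        using a y KM by (auto simp: act_add_vector)
      moreover have "a \<odot>\<^bsub>M\<^esub> k \<oplus>\<^bsub>M\<^esub> a \<odot>\<^bsub>M\<^esub> y \<in> K" using K a k by (simp add: submodule_iff)
      ultimately have "a \<odot>\<^bsub>M\<^esub> x \<in> K" by simp
      then show ?thesis using M.a_coset_join2[OF _ sg] KM by blast
    qed
    moreover have "C \<noteq> {}" using y sg K by (auto simp: a_r_coset_def' submodule_iff)
    ultimately show ?thesis by (simp add: quot_module_def)
  qed
  then show "\<exists>I. essential_right_ideal I R \<and>
      (\<forall>a\<in>I. a \<odot>\<^bsub>quot_module M K\<^esub> C = \<zero>\<^bsub>quot_module M K\<^esub>)"
    using ess[OF y(1)] by blast
qed

text \<open>
If \<open>K\<close> were proper, choose \<open>P \<supseteq> K\<close> maximal among the submodules that avoid some \<open>x \<notin> K\<close>.  Every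
nonzero submodule of \<open>M/P\<close> contains \<open>x\<close>, so \<open>M/(P + xR)\<close> is a quotient by an essential submodule and
hence singular, and \<open>\<delta>\<close>-smallness gives \<open>P + xR = M\<close>.  Thus \<open>M/P\<close> is simple, and being annihilated by the
socle it is singular as well: a right ideal that meets an annihilator trivially embeds in \<open>M/P\<close>, so it
is simple and lies in the socle, hence in the annihilator.  Now \<open>\<delta>\<close>-smallness gives \<open>P = M\<close>.
\<close>

lemma (in right_module) delta_small_supplement:
  assumes N: "delta_small N R M" and K: "submodule K R M"
    and soc: "\<And>s y. s \<in> right_socle R \<Longrightarrow> y \<in> carrier M \<Longrightarrow> s \<odot>\<^bsub>M\<^esub> y \<in> K"
    and sum: "N <+>\<^bsub>M\<^esub> K = carrier M"
  shows "K = carrier M"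
proof (rule ccontr)
  have sN: "submodule N R M" using N by (simp add: delta_small_def)
  assume "K \<noteq> carrier M"
  then obtain x where x: "x \<in> carrier M" "x \<notin> K" using submodule_carrier[OF K] by blast
  obtain P where P: "submodule P R M" "K \<subseteq> P" "x \<notin> P"
    and max: "\<And>L. submodule L R M \<Longrightarrow> P \<subseteq> L \<Longrightarrow> x \<notin> L \<Longrightarrow> L = P"
    using submodule_maximal_avoiding[OF K x(2)] by blast
  \<comment> \<open>\<open>\<delta>\<close>-smallness of \<open>N\<close>, applied to any submodule above \<open>K\<close>.\<close>
  have full: "L = carrier M" if L: "submodule L R M" "K \<subseteq> L" and sing: "singular_module R (quot_module M L)" for L
  proof -
    have "K \<subseteq> N <+>\<^bsub>M\<^esub> L" "N \<subseteq> N <+>\<^bsub>M\<^esub> L" using subset_plus[OF sN L(1)] L(2) by auto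
    then have "carrier M \<subseteq> N <+>\<^bsub>M\<^esub> L" using plus_subset[OF submodule_plus[OF sN L(1)]] sum by blast
    moreover have "N <+>\<^bsub>M\<^esub> L \<subseteq> carrier M" using submodule_carrier[OF submodule_plus[OF sN L(1)]] by blast
    ultimately show ?thesis using N L sing unfolding delta_small_def by blast
  qed
  have grow: "x \<in> P <+>\<^bsub>M\<^esub> ((\<lambda>a. a \<odot>\<^bsub>M\<^esub> y) ` U)" (is "x \<in> ?L")
    if y: "y \<in> carrier M" and U: "right_ideal U R" and u: "u \<in> U" "u \<odot>\<^bsub>M\<^esub> y \<notin> P" for y U u
  proof -
    note sU = scalar_image_submodule[OF U y]
    have "u \<odot>\<^bsub>M\<^esub> y \<in> ?L" using subset_plus(2)[OF P(1) sU] u by blast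
    then show ?thesis
      using max[OF submodule_plus[OF P(1) sU] subset_plus(1)[OF P(1) sU]] u(2) by blast
  qed
  let ?xR = "(\<lambda>a. a \<odot>\<^bsub>M\<^esub> x) ` carrier R"
  have xR: "submodule ?xR R M" using scalar_image_submodule[OF R.right_ideal_carrier_set x(1)] .
  let ?Q = "P <+>\<^bsub>M\<^esub> ?xR"
  have Q: "submodule ?Q R M" "P \<subseteq> ?Q" "?xR \<subseteq> ?Q"
    using submodule_plus[OF P(1) xR] subset_plus[OF P(1) xR] by auto
  have "x \<in> ?xR" using x act_one by (metis R.one_closed imageI)
  then have xQ: "x \<in> ?Q" using Q by blast
  have "singular_module R (quot_module M ?Q)"
  proof (rule singular_quotientI[OF Q(1)])
    fix y assume y: "y \<in> carrier M"
    let ?I = "{a \<in> carrier R. a \<odot>\<^bsub>M\<^esub> y \<in> ?Q}"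
    have "?I \<inter> U \<noteq> {\<zero>\<^bsub>R\<^esub>}" if U: "right_ideal U R" "U \<noteq> {\<zero>\<^bsub>R\<^esub>}" for U
    proof
      assume zero: "?I \<inter> U = {\<zero>\<^bsub>R\<^esub>}"
      obtain u where u: "u \<in> U" "u \<noteq> \<zero>\<^bsub>R\<^esub>" using U R.right_ideal_zero[OF U(1)] by blast
      then have "u \<odot>\<^bsub>M\<^esub> y \<notin> P" using zero Q(2) R.right_ideal_carrier[OF U(1)] by blast
      then have "x \<in> P <+>\<^bsub>M\<^esub> ((\<lambda>a. a \<odot>\<^bsub>M\<^esub> y) ` U)" using grow[OF y U(1) u(1)] by blast
      then obtain p w where p: "p \<in> P" "w \<in> (\<lambda>a. a \<odot>\<^bsub>M\<^esub> y) ` U" "x = p \<oplus>\<^bsub>M\<^esub> w" by (rule set_addE)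
      then obtain v where v: "v \<in> U" "w = v \<odot>\<^bsub>M\<^esub> y" by blast
      have vc: "v \<in> carrier R" using v R.right_ideal_carrier[OF U(1)] by blast
      have pc: "p \<in> carrier M" "w \<in> carrier M"
        using submodule_carrier[OF P(1) p(1)] v vc y act_closed by auto
      have "x \<ominus>\<^bsub>M\<^esub> p \<in> ?Q" using submodule_minus_closed[OF Q(1) xQ] p(1) Q(2) by blast
      moreover have "x \<ominus>\<^bsub>M\<^esub> p = w" using pc unfolding p(3)
        by (simp add: a_minus_def M.a_assoc M.a_comm[of w] M.r_neg2 M.r_neg1)
      ultimately have "v \<in> ?I \<inter> U" using v vc by simp
      then have "v = \<zero>\<^bsub>R\<^esub>" using zero by blast
      then have "x = p" using p v zero_act[OF y] pc by simp
      then show False using P p by simp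
    qed
    then show "essential_right_ideal ?I R"
      unfolding R.essential_right_ideal_iff using conductor_right_ideal[OF Q(1) y] by blast
  qed
  then have QM: "?Q = carrier M" using full[OF Q(1)] P(2) Q(2) by blast
  have "singular_module R (quot_module M P)"
  proof (rule singular_quotientI[OF P(1)])
    fix y assume y: "y \<in> carrier M"
    let ?I = "{a \<in> carrier R. a \<odot>\<^bsub>M\<^esub> y \<in> P}"
    have SI: "right_socle R \<subseteq> ?I"
      using soc y P(2) R.right_ideal_carrier[OF R.socle_right_ideal] by blast
    have "?I \<inter> U \<noteq> {\<zero>\<^bsub>R\<^esub>}" if U: "right_ideal U R" "U \<noteq> {\<zero>\<^bsub>R\<^esub>}" for U
    proof
      assume zero: "?I \<inter> U = {\<zero>\<^bsub>R\<^esub>}"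
      have "V = {\<zero>\<^bsub>R\<^esub>} \<or> V = U" if V: "right_ideal V R" "V \<subseteq> U" for V
      proof (cases "V = {\<zero>\<^bsub>R\<^esub>}")
        case False
        then obtain v where v: "v \<in> V" "v \<noteq> \<zero>\<^bsub>R\<^esub>" using R.right_ideal_zero[OF V(1)] by blast
        then have "v \<odot>\<^bsub>M\<^esub> y \<notin> P" using zero V R.right_ideal_carrier[OF V(1)] by blast
        then have xL: "x \<in> P <+>\<^bsub>M\<^esub> ((\<lambda>a. a \<odot>\<^bsub>M\<^esub> y) ` V)" (is "x \<in> ?L") using grow[OF y V(1) v(1)] by blast
        note sV = scalar_image_submodule[OF V(1) y]
        have sL: "submodule ?L R M" using submodule_plus[OF P(1) sV] .
        have "?xR \<subseteq> ?L" using sL xL unfolding submodule_iff by auto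
        then have "carrier M \<subseteq> ?L"
          using plus_subset[OF sL subset_plus(1)[OF P(1) sV], of ?xR] QM by simp
        have "u \<in> V" if u: "u \<in> U" for u
        proof -
          have uc: "u \<in> carrier R" using u R.right_ideal_carrier[OF U(1)] by blast
          have "u \<odot>\<^bsub>M\<^esub> y \<in> ?L" using act_closed[OF uc y] \<open>carrier M \<subseteq> ?L\<close> by blast
          then obtain p w where p: "p \<in> P" "w \<in> (\<lambda>a. a \<odot>\<^bsub>M\<^esub> y) ` V" "u \<odot>\<^bsub>M\<^esub> y = p \<oplus>\<^bsub>M\<^esub> w" by (rule set_addE)
          then obtain v where v: "v \<in> V" "w = v \<odot>\<^bsub>M\<^esub> y" by blast
          have vc: "v \<in> carrier R" using v R.right_ideal_carrier[OF V(1)] by blast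
          have pc: "p \<in> carrier M" "w \<in> carrier M"
            using submodule_carrier[OF P(1) p(1)] v vc y act_closed by auto
          have "(u \<ominus>\<^bsub>R\<^esub> v) \<odot>\<^bsub>M\<^esub> y = (p \<oplus>\<^bsub>M\<^esub> w) \<oplus>\<^bsub>M\<^esub> (\<ominus>\<^bsub>M\<^esub> w)"
            using uc vc y p(3) v(2) by (simp add: a_minus_def act_add_scalar minus_act)
          also have "\<dots> = p" using pc by (simp add: M.a_assoc M.r_neg)
          finally have "(u \<ominus>\<^bsub>R\<^esub> v) \<odot>\<^bsub>M\<^esub> y \<in> P" using p by simp
          moreover have "u \<ominus>\<^bsub>R\<^esub> v \<in> U" using R.right_ideal_diff[OF U(1) u] v V by blast
          ultimately have "u \<ominus>\<^bsub>R\<^esub> v \<in> ?I \<inter> U" using uc vc by simp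
          then have "u \<ominus>\<^bsub>R\<^esub> v = \<zero>\<^bsub>R\<^esub>" using zero by blast
          then show ?thesis using R.diff_zero_imp_eq uc vc v by blast
        qed
        then show ?thesis using V by blast
      qed simp
      then have "simple_right_ideal U R" using U by (simp add: simple_submodule_def)
      then have "U \<subseteq> ?I" using R.simple_subset_socle SI by blast
      then show False using zero U by blast
    qed
    then show "essential_right_ideal ?I R"
      unfolding R.essential_right_ideal_iff using conductor_right_ideal[OF P(1) y] by blast
  qed
  then have "P = carrier M" using full[OF P(1,2)] by blast
  then show False using P x by blast
qed

section \<open>Flat modules and relations\<close>

text \<open>
Relations are given by lists of summands because they are consumed by recursion only; repeated
summands then need no bookkeeping.
\<close>

primrec list_sum :: "('b, 'd) ring_scheme \<Rightarrow> ('t \<Rightarrow> 'b) \<Rightarrow> 't list \<Rightarrow> 'b" where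
  "list_sum G f [] = \<zero>\<^bsub>G\<^esub>"
| "list_sum G f (t # ts) = f t \<oplus>\<^bsub>G\<^esub> list_sum G f ts"

lemma (in abelian_monoid) list_sum_closed:
  "(\<And>t. t \<in> set ts \<Longrightarrow> f t \<in> carrier G) \<Longrightarrow> list_sum G f ts \<in> carrier G"
  by (induction ts) auto

lemma (in abelian_monoid) list_sum_append:
  assumes "\<And>t. t \<in> set (ts @ us) \<Longrightarrow> f t \<in> carrier G"
  shows "list_sum G f (ts @ us) = list_sum G f ts \<oplus> list_sum G f us"
  using assms by (induction ts) (auto simp: a_assoc list_sum_closed)

text \<open>
Covers are available, and flatness can be tested, only for modules with elements in one fixed type;
this moves a module there along an injection of its carrier.
\<close>

definition transport_module ::
    "('b \<Rightarrow> 'm) \<Rightarrow> ('a, 'b, 'd) module_scheme \<Rightarrow> ('a, 'm) module" where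
  "transport_module h N =
     \<lparr>carrier = h ` carrier N, monoid.mult = undefined, one = undefined, ring.zero = h \<zero>\<^bsub>N\<^esub>,
      ring.add = (\<lambda>u v. h (inv_into (carrier N) h u \<oplus>\<^bsub>N\<^esub> inv_into (carrier N) h v)),
      smult = (\<lambda>a u. h (a \<odot>\<^bsub>N\<^esub> inv_into (carrier N) h u))\<rparr>"

lemma transport_module_simps:
  assumes "inj_on h (carrier N)"
  shows "carrier (transport_module h N) = h ` carrier N"
    "\<zero>\<^bsub>transport_module h N\<^esub> = h \<zero>\<^bsub>N\<^esub>"
    "x \<in> carrier N \<Longrightarrow> y \<in> carrier N \<Longrightarrow> h x \<oplus>\<^bsub>transport_module h N\<^esub> h y = h (x \<oplus>\<^bsub>N\<^esub> y)"
    "x \<in> carrier N \<Longrightarrow> a \<odot>\<^bsub>transport_module h N\<^esub> h x = h (a \<odot>\<^bsub>N\<^esub> x)"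
  using assms by (simp_all add: transport_module_def)

lemma (in onesided_module) onesided_transport:
  assumes h: "inj_on h (carrier M)"
  shows "onesided_module R (transport_module h M)"
proof -
  note simps = transport_module_simps[OF h]
  have "abelian_group (transport_module h M)"
  proof (rule abelian_groupI)
    fix u assume "u \<in> carrier (transport_module h M)"
    then obtain x where x: "x \<in> carrier M" "u = h x" by (auto simp: simps)
    then have "h (\<ominus>\<^bsub>M\<^esub> x) \<oplus>\<^bsub>transport_module h M\<^esub> u = \<zero>\<^bsub>transport_module h M\<^esub>"
      by (simp add: simps M.l_neg)
    then show "\<exists>v\<in>carrier (transport_module h M). v \<oplus>\<^bsub>transport_module h M\<^esub> u = \<zero>\<^bsub>transport_module h M\<^esub>"
      using x by (auto simp: simps)
  qed (auto simp: simps M.a_ac)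
  then show ?thesis
    by (intro onesided_module.intro onesided_module_axioms.intro R.ring_axioms)
      (auto simp: simps act_closed act_add_scalar act_add_vector act_one)
qed

lemma (in right_module) right_transport:
  assumes h: "inj_on h (carrier M)" shows "right_module R (transport_module h M)"
  using onesided_transport[OF h]
  by (auto simp: right_module_def right_module_axioms_def transport_module_simps[OF h]
      act_closed right_assoc)

lemma (in left_module) left_transport:
  assumes h: "inj_on h (carrier M)" shows "left_module R (transport_module h M)"
  using onesided_transport[OF h]
  by (auto simp: left_module_def left_module_axioms_def transport_module_simps[OF h]
      act_closed left_assoc)

lemma (in left_module) left_submodule:
  assumes H: "submodule H R M" shows "left_module R (M\<lparr>carrier := H\<rparr>)"
proof -
  have HM: "\<And>x. x \<in> H \<Longrightarrow> x \<in> carrier M" using submodule_carrier[OF H] .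
  have "abelian_group (M\<lparr>carrier := H\<rparr>)"
  proof (rule abelian_groupI)
    fix x assume x: "x \<in> carrier (M\<lparr>carrier := H\<rparr>)"
    have "(\<ominus>\<^bsub>R\<^esub> \<one>\<^bsub>R\<^esub>) \<odot>\<^bsub>M\<^esub> x \<in> H" using H x by (simp add: submodule_iff)
    moreover have "(\<ominus>\<^bsub>R\<^esub> \<one>\<^bsub>R\<^esub>) \<odot>\<^bsub>M\<^esub> x \<oplus>\<^bsub>M\<^esub> x = \<zero>\<^bsub>M\<^esub>"
      using x HM by (simp add: minus_act act_one M.l_neg)
    ultimately show "\<exists>y\<in>carrier (M\<lparr>carrier := H\<rparr>).
        y \<oplus>\<^bsub>M\<lparr>carrier := H\<rparr>\<^esub> x = \<zero>\<^bsub>M\<lparr>carrier := H\<rparr>\<^esub>" by auto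
  qed (use H HM in \<open>auto simp: submodule_iff M.a_ac\<close>)
  moreover have "\<forall>a\<in>carrier R. \<forall>x\<in>H. a \<odot>\<^bsub>M\<^esub> x \<in> H" using H by (simp add: submodule_iff)
  ultimately show ?thesis
    by (intro left_module.intro onesided_module.intro onesided_module_axioms.intro
        left_module_axioms.intro R.ring_axioms)
      (auto simp: HM act_add_scalar act_add_vector act_one left_assoc)
qed

definition left_regular :: "('a, 'c) ring_scheme \<Rightarrow> ('a, 'a) module" where
  "left_regular R =
     \<lparr>carrier = carrier R, monoid.mult = monoid.mult R, one = \<one>\<^bsub>R\<^esub>,
      ring.zero = \<zero>\<^bsub>R\<^esub>, ring.add = ring.add R, smult = monoid.mult R\<rparr>"

lemma left_regular_simps [simp]:
  "carrier (left_regular R) = carrier R"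
  "\<zero>\<^bsub>left_regular R\<^esub> = \<zero>\<^bsub>R\<^esub>"
  "x \<oplus>\<^bsub>left_regular R\<^esub> y = x \<oplus>\<^bsub>R\<^esub> y"
  "a \<odot>\<^bsub>left_regular R\<^esub> x = a \<otimes>\<^bsub>R\<^esub> x"
  by (simp_all add: left_regular_def)

lemma (in ring) left_regular_left_module: "left_module R (left_regular R)"
proof -
  have "abelian_group (left_regular R)"
  proof (rule abelian_groupI)
    fix x assume "x \<in> carrier (left_regular R)"
    then show "\<exists>y\<in>carrier (left_regular R). y \<oplus>\<^bsub>left_regular R\<^esub> x = \<zero>\<^bsub>left_regular R\<^esub>"
      using l_neg[of x] by (auto intro!: bexI[of _ "\<ominus> x"])
  qed (auto simp: a_ac)
  then show ?thesis
    by (intro left_module.intro onesided_module.intro onesided_module_axioms.intro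
        left_module_axioms.intro) (auto simp: l_distr r_distr m_assoc ring_axioms)
qed

lemma free_subgroup_closed:
  assumes "subgroup H (free_Abelian_group S)" "a \<in> H" "b \<in> H"
  shows "a + b \<in> H" "- a \<in> H" "a - b \<in> H"
proof -
  have p: "a + b \<in> H" if "a \<in> H" "b \<in> H" for a b
    using subgroup.m_closed[OF assms(1) that] by simp
  have n: "- a \<in> H" if "a \<in> H" for a
    using subgroup.m_inv_closed[OF assms(1) that] subgroup.mem_carrier[OF assms(1) that] by simp
  show "a + b \<in> H" "- a \<in> H" "a - b \<in> H"
    using p[OF assms(2,3)] n[OF assms(2)] p[OF assms(2) n[OF assms(3)]] by simp_all
qed

lemma tensor_gens_carrier:
  assumes F: "onesided_module R F" and A: "onesided_module R A"
  shows "tensor_gens R F A \<subseteq> carrier (free_Abelian_group (carrier F \<times> carrier A))"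
proof -
  interpret F: onesided_module R F by (rule F)
  interpret A: onesided_module R A by (rule A)
  let ?S = "carrier F \<times> carrier A"
  let ?G = "carrier (free_Abelian_group ?S)"
  have d: "a - b \<in> ?G" if "a \<in> ?G" "b \<in> ?G" for a b
    using that keys_diff unfolding carrier_free_Abelian_group_iff by (meson Un_least order_trans)
  show ?thesis
    unfolding tensor_gens_def
    by (auto intro!: d simp del: carrier_free_Abelian_group_iff simp: F.act_closed A.act_closed)
qed

lemma tensor_rels_subgroup:
  assumes F: "onesided_module R F" and A: "onesided_module R A"
  shows "subgroup (tensor_rels R F A) (free_Abelian_group (carrier F \<times> carrier A))"
  unfolding tensor_rels_def
  by (rule group.generate_is_subgroup[OF group_free_Abelian_group tensor_gens_carrier[OF F A]])

lemma tensor_rels_incl: "g \<in> tensor_gens R F A \<Longrightarrow> g \<in> tensor_rels R F A"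
  unfolding tensor_rels_def by (rule generate.incl)

lemma tensor_gens_hom_vanish:
  assumes F: "onesided_module R F" and A: "onesided_module R A"
    and L: "additive_subgroup L G" and G: "abelian_group G"
    and \<Psi>: "\<Psi> \<in> hom (free_Abelian_group (carrier F \<times> carrier A)) (add_monoid G)"
    and gens: "\<And>g. g \<in> tensor_gens R F A \<Longrightarrow> \<Psi> g \<in> L"
    and \<tau>: "\<tau> \<in> tensor_rels R F A"
  shows "\<Psi> \<tau> \<in> L"
proof -
  let ?FA = "free_Abelian_group (carrier F \<times> carrier A)"
  interpret G: abelian_group G by (rule G)
  interpret \<Psi>: group_hom ?FA "add_monoid G" \<Psi>
    using \<Psi> by (simp add: group_hom_def group_hom_axioms_def G.a_group)
  have sub: "subgroup L (add_monoid G)" using L by (simp add: additive_subgroup_def)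
  have "subgroup (\<Psi> -` L \<inter> carrier ?FA) ?FA"
  proof (rule subgroup.intro)
    fix x assume x: "x \<in> \<Psi> -` L \<inter> carrier ?FA"
    then have "\<Psi> (inv\<^bsub>?FA\<^esub> x) = inv\<^bsub>add_monoid G\<^esub> (\<Psi> x)" using \<Psi>.hom_inv by blast
    then show "inv\<^bsub>?FA\<^esub> x \<in> \<Psi> -` L \<inter> carrier ?FA"
      using x subgroup.m_inv_closed[OF sub, of "\<Psi> x"] group.inv_closed[OF group_free_Abelian_group, of x] by auto
  next
    show "\<one>\<^bsub>?FA\<^esub> \<in> \<Psi> -` L \<inter> carrier ?FA"
      using \<Psi>.hom_one subgroup.one_closed[OF sub] group.is_monoid[OF group_free_Abelian_group] by (auto simp: monoid.one_closed)
  next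
    fix x y assume "x \<in> \<Psi> -` L \<inter> carrier ?FA" "y \<in> \<Psi> -` L \<inter> carrier ?FA"
    then show "x \<otimes>\<^bsub>?FA\<^esub> y \<in> \<Psi> -` L \<inter> carrier ?FA"
      using \<Psi>.hom_mult[of x y] subgroup.m_closed[OF sub, of "\<Psi> x" "\<Psi> y"]
        monoid.m_closed[OF group.is_monoid[OF group_free_Abelian_group], of x "carrier F \<times> carrier A" y]
      by (auto simp del: carrier_free_Abelian_group_iff mult_free_Abelian_group)
  qed auto
  moreover have "tensor_gens R F A \<subseteq> \<Psi> -` L \<inter> carrier ?FA"
    using gens tensor_gens_carrier[OF F A] by blast
  ultimately have "tensor_rels R F A \<subseteq> \<Psi> -` L \<inter> carrier ?FA"
    unfolding tensor_rels_def
    using group.generate_subgroup_incl[OF group_free_Abelian_group] by blast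
  then show ?thesis using \<tau> by blast
qed

text \<open>
The identity \<open>\<Sum> x\<^sub>t \<otimes> a\<^sub>t b = (\<Sum> x\<^sub>t a\<^sub>t) \<otimes> b = 0\<close>, stated in the free abelian group.
\<close>

lemma tensor_sum_is_relation:
  assumes F: "right_module R F" and B: "left_module R B" and b: "b \<in> carrier B"
    and ts: "\<And>x a. (x, a) \<in> set ts \<Longrightarrow> x \<in> carrier F \<and> a \<in> carrier R"
    and zero: "list_sum F (\<lambda>(x, a). a \<odot>\<^bsub>F\<^esub> x) ts = \<zero>\<^bsub>F\<^esub>"
  shows "sum_list (map (\<lambda>(x, a). frag_of (x, a \<odot>\<^bsub>B\<^esub> b)) ts) \<in> tensor_rels R F B"
proof -
  interpret F: right_module R F by (rule F)
  interpret B: left_module R B by (rule B)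
  let ?T = "tensor_rels R F B"
  let ?s = "list_sum F (\<lambda>(x, a). a \<odot>\<^bsub>F\<^esub> x)"
  let ?\<sigma> = "\<lambda>ts. sum_list (map (\<lambda>(x, a). frag_of (x, a \<odot>\<^bsub>B\<^esub> b)) ts)"
  have sub: "subgroup ?T (free_Abelian_group (carrier F \<times> carrier B))"
    by (rule tensor_rels_subgroup[OF F.onesided_module_axioms B.onesided_module_axioms])
  note cl = free_subgroup_closed[OF sub]
  have add: "frag_of (x \<oplus>\<^bsub>F\<^esub> y, b) - frag_of (x, b) - frag_of (y, b) \<in> ?T"
    if "x \<in> carrier F" "y \<in> carrier F" for x y
    using that b by (intro tensor_rels_incl) (auto simp: tensor_gens_def)
  have bal: "frag_of (a \<odot>\<^bsub>F\<^esub> x, b) - frag_of (x, a \<odot>\<^bsub>B\<^esub> b) \<in> ?T"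
    if "x \<in> carrier F" "a \<in> carrier R" for x a
    using that b by (intro tensor_rels_incl) (auto simp: tensor_gens_def)
  have z: "frag_of (\<zero>\<^bsub>F\<^esub>, b) \<in> ?T"
    using cl(2)[OF add[OF F.M.zero_closed F.M.zero_closed]] add[OF F.M.zero_closed F.M.zero_closed] by simp
  have "?s ts \<in> carrier F \<and> ?\<sigma> ts - frag_of (?s ts, b) \<in> ?T"
    using ts
  proof (induction ts)
    case Nil
    then show ?case using z cl(2)[OF z z] by simp
  next
    case (Cons t ts)
    obtain x a where t: "t = (x, a)" by (cases t)
    have xa: "x \<in> carrier F" "a \<in> carrier R" using Cons.prems[of x a] t by auto
    have IH: "?s ts \<in> carrier F" "?\<sigma> ts - frag_of (?s ts, b) \<in> ?T"
      using Cons.IH Cons.prems by auto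
    have ax: "a \<odot>\<^bsub>F\<^esub> x \<in> carrier F" using F.act_closed xa by blast
    have "(?\<sigma> ts - frag_of (?s ts, b)) - (frag_of (a \<odot>\<^bsub>F\<^esub> x, b) - frag_of (x, a \<odot>\<^bsub>B\<^esub> b))
       - (frag_of (a \<odot>\<^bsub>F\<^esub> x \<oplus>\<^bsub>F\<^esub> ?s ts, b) - frag_of (a \<odot>\<^bsub>F\<^esub> x, b) - frag_of (?s ts, b)) \<in> ?T"
      using cl(3)[OF cl(3)[OF IH(2) bal[OF xa]] add[OF ax IH(1)]] .
    then show ?case using t ax IH(1) by (simp add: algebra_simps)
  qed
  then have "?\<sigma> ts - frag_of (\<zero>\<^bsub>F\<^esub>, b) \<in> ?T" using zero by simp
  then show ?thesis using cl(1)[OF _ z] by fastforce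
qed

text \<open>
Injectivity of \<open>F \<otimes> H \<rightarrow> F \<otimes> B\<close> for a submodule \<open>H\<close> of \<open>B\<close>, in terms of relations.  The map on
generators is the identity, so both the coset of \<open>\<tau>\<close> and the zero coset are sent to the zero coset.
\<close>

lemma flat_submodule_relation:
  fixes B :: "('a, 'm) module"
  assumes flat: "flat_module TYPE('m) R F" and B: "left_module R B" and H: "submodule H R B"
    and \<tau>: "\<tau> \<in> carrier (free_Abelian_group (carrier F \<times> H))" and rel: "\<tau> \<in> tensor_rels R F B"
  shows "\<tau> \<in> tensor_rels R F (B\<lparr>carrier := H\<rparr>)"
proof -
  let ?A = "B\<lparr>carrier := H\<rparr>"
  have F: "right_module R F" using flat by (simp add: flat_module_def)
  interpret F: right_module R F by (rule F)
  interpret B: left_module R B by (rule B)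
  have A: "left_module R ?A" using B.left_submodule[OF H] .
  interpret A: left_module R ?A by (rule A)
  have HB: "H \<subseteq> carrier B" using B.submodule_carrier[OF H] by blast
  let ?FA = "free_Abelian_group (carrier F \<times> H)" and ?FB = "free_Abelian_group (carrier F \<times> carrier B)"
  let ?TA = "tensor_rels R F ?A" and ?TB = "tensor_rels R F B"
  have subA: "subgroup ?TA ?FA"
    using tensor_rels_subgroup[OF F.onesided_module_axioms A.onesided_module_axioms] by simp
  have subB: "subgroup ?TB ?FB"
    using tensor_rels_subgroup[OF F.onesided_module_axioms B.onesided_module_axioms] .
  note clB = free_subgroup_closed[OF subB]
  interpret gA: group ?FA by simp
  interpret gB: group ?FB by simp
  have "tensor_gens R F ?A \<subseteq> tensor_gens R F B"
  proof
    fix g assume "g \<in> tensor_gens R F ?A"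
    then consider
        x y u where "g = frag_of (x \<oplus>\<^bsub>F\<^esub> y, u) - frag_of (x, u) - frag_of (y, u)"
          "x \<in> carrier F" "y \<in> carrier F" "u \<in> H"
      | x u v where "g = frag_of (x, u \<oplus>\<^bsub>B\<^esub> v) - frag_of (x, u) - frag_of (x, v)"
          "x \<in> carrier F" "u \<in> H" "v \<in> H"
      | a x u where "g = frag_of (a \<odot>\<^bsub>F\<^esub> x, u) - frag_of (x, a \<odot>\<^bsub>B\<^esub> u)"
          "a \<in> carrier R" "x \<in> carrier F" "u \<in> H"
      unfolding tensor_gens_def by auto
    then show "g \<in> tensor_gens R F B"
      using HB unfolding tensor_gens_def by cases blast+
  qed
  moreover have "tensor_gens R F B \<subseteq> carrier ?FB"
    by (rule tensor_gens_carrier[OF F.onesided_module_axioms B.onesided_module_axioms])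
  ultimately have "generate ?FB (tensor_gens R F ?A) \<subseteq> ?TB"
    unfolding tensor_rels_def using gB.mono_generate by blast
  moreover have "?TA \<subseteq> generate ?FB (tensor_gens R F ?A)"
  proof
    fix t assume "t \<in> ?TA"
    then have "t \<in> generate ?FA (tensor_gens R F ?A)" by (simp add: tensor_rels_def)
    then show "t \<in> generate ?FB (tensor_gens R F ?A)"
    proof induction
      case one
      then show ?case using generate.one[of ?FB] by simp
    next
      case (incl h)
      then show ?case by (rule generate.incl)
    next
      case (inv h)
      have "Poly_Mapping.keys h \<subseteq> carrier F \<times> H"
        using subsetD[OF tensor_gens_carrier[OF F.onesided_module_axioms A.onesided_module_axioms] inv]
        by simp
      moreover from this have "Poly_Mapping.keys h \<subseteq> carrier F \<times> carrier B" using HB by blast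
      ultimately show ?case using generate.inv[OF inv, of ?FB] by simp
    next
      case (eng h1 h2)
      then show ?case using generate.eng[of h1 ?FB _ h2] by simp
    qed
  qed
  ultimately have TAB: "?TA \<subseteq> ?TB" by blast
  have "(\<lambda>(x, u). frag_of (x, id u)) = (frag_of :: 'c \<times> 'm \<Rightarrow> _)" by auto
  then have map_eq: "tensor_map R F B id C = (\<Union>t\<in>C. ?TB #>\<^bsub>?FB\<^esub> t)" for C
    unfolding tensor_map_def by (simp flip: frag_expansion)
  have rc: "?TB #>\<^bsub>?FB\<^esub> t = ?TB" if "t \<in> ?TB" for t
    by (rule gB.coset_join2[OF subgroup.mem_carrier[OF subB that] subB that])
  have coset: "tensor_map R F B id C = ?TB" if "C \<subseteq> ?TB" "C \<noteq> {}" for C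
  proof -
    have "(\<Union>t\<in>C. ?TB #>\<^bsub>?FB\<^esub> t) = (\<Union>t\<in>C. ?TB)" using rc that by blast
    then show ?thesis unfolding map_eq using that by simp
  qed
  let ?C = "?TA #>\<^bsub>?FA\<^esub> \<tau>"
  have \<tau>C: "\<tau> \<in> ?C" using gA.rcos_self[OF \<tau> subA] .
  have "?C \<subseteq> ?TB"
    using TAB clB(1)[OF _ rel] by (auto simp: r_coset_def)
  then have "tensor_map R F B id ?C = tensor_map R F B id ?TA"
    using coset[of ?C] coset[of ?TA] TAB \<tau>C subgroup.one_closed[OF subA] by auto
  moreover have "?C \<in> carrier (tensor_product R F ?A)" "?TA \<in> carrier (tensor_product R F ?A)"
  proof -
    show "?C \<in> carrier (tensor_product R F ?A)"
      using \<tau> by (auto simp: tensor_product_def FactGroup_def RCOSETS_def simp del: carrier_free_Abelian_group_iff)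
    have "?TA #>\<^bsub>?FA\<^esub> \<one>\<^bsub>?FA\<^esub> = ?TA"
      using gA.coset_mult_one subgroup.subset[OF subA] by blast
    then show "?TA \<in> carrier (tensor_product R F ?A)"
      using gA.one_closed by (auto simp: tensor_product_def FactGroup_def RCOSETS_def simp del: carrier_free_Abelian_group_iff one_free_Abelian_group)
  qed
  moreover have "inj_on (tensor_map R F B id) (carrier (tensor_product R F ?A))"
  proof -
    have "id \<in> module_hom R ?A B" using HB by (auto simp: module_hom_def)
    moreover have "inj_on id (carrier ?A)" by simp
    ultimately show ?thesis using flat A B unfolding flat_module_def by blast
  qed
  ultimately have "?C = ?TA" by (meson inj_onD)
  then show ?thesis using \<tau>C by simp
qed

lemma (in ring) left_ideal_iff:
  "submodule A R (left_regular R) \<longleftrightarrow> A \<subseteq> carrier R \<and> \<zero> \<in> A \<and> (\<forall>x\<in>A. \<forall>y\<in>A. x \<oplus> y \<in> A) \<and>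
     (\<forall>a\<in>carrier R. \<forall>x\<in>A. a \<otimes> x \<in> A)"
proof -
  interpret left_module R "left_regular R" by (rule left_regular_left_module)
  show ?thesis using submodule_iff[of A] by simp
qed

lemma (in ring) left_ideal_additive_subgroup:
  "submodule A R (left_regular R) \<Longrightarrow> additive_subgroup A R"
  unfolding left_ideal_iff
proof (intro additive_subgroup.intro subgroup.intro)
  fix x
  assume A: "A \<subseteq> carrier R \<and> \<zero> \<in> A \<and> (\<forall>x\<in>A. \<forall>y\<in>A. x \<oplus> y \<in> A) \<and>
     (\<forall>a\<in>carrier R. \<forall>x\<in>A. a \<otimes> x \<in> A)" and x: "x \<in> A"
  then have "(\<ominus> \<one>) \<otimes> x \<in> A" by simp
  moreover have "(\<ominus> \<one>) \<otimes> x = \<ominus> x" using A x by (auto simp: l_minus)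
  ultimately show "inv\<^bsub>add_monoid R\<^esub> x \<in> A" by (simp add: a_inv_def)
qed auto

text \<open>
The map \<open>F \<otimes> A \<rightarrow> R/D \<otimes> A \<rightarrow> A/L\<close> induced by a homomorphism \<open>F \<rightarrow> R/D\<close>, for \<open>DA \<subseteq> L\<close>, is applied to
\<open>\<Sum> x\<^sub>t \<otimes> a\<^sub>t\<close>, which vanishes in \<open>F \<otimes> A\<close> by flatness since it does so in \<open>F \<otimes> R\<close>.  The homomorphism is
represented by a map \<open>h\<close> into \<open>R\<close> that is additive and linear only modulo \<open>D\<close>.
\<close>

lemma (in ring) flat_relation_vanishes:
  fixes i :: "'a \<Rightarrow> 'm"
  assumes flat: "flat_module TYPE('m) R F" and i: "inj_on i (carrier R)"
    and A: "submodule A R (left_regular R)" and L: "additive_subgroup L R"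
    and DA: "\<And>d a. d \<in> D \<Longrightarrow> a \<in> A \<Longrightarrow> d \<otimes> a \<in> L"
    and h: "\<And>x. x \<in> carrier F \<Longrightarrow> h x \<in> carrier R"
    and h_add: "\<And>x y. x \<in> carrier F \<Longrightarrow> y \<in> carrier F \<Longrightarrow> h (x \<oplus>\<^bsub>F\<^esub> y) \<ominus> (h x \<oplus> h y) \<in> D"
    and h_act: "\<And>x a. x \<in> carrier F \<Longrightarrow> a \<in> carrier R \<Longrightarrow> h (a \<odot>\<^bsub>F\<^esub> x) \<ominus> h x \<otimes> a \<in> D"
    and ts: "\<And>x a. (x, a) \<in> set ts \<Longrightarrow> x \<in> carrier F \<and> a \<in> A"
    and zero: "list_sum F (\<lambda>(x, a). a \<odot>\<^bsub>F\<^esub> x) ts = \<zero>\<^bsub>F\<^esub>"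
  shows "list_sum R (\<lambda>(x, a). h x \<otimes> a) ts \<in> L"
proof -
  have F: "right_module R F" using flat by (simp add: flat_module_def)
  interpret F: right_module R F by (rule F)
  interpret LR: left_module R "left_regular R" by (rule left_regular_left_module)
  let ?j = "inv_into (carrier R) i"
  define B where "B = transport_module i (left_regular R)"
  have i': "inj_on i (carrier (left_regular R))" using i by simp
  note Bs = transport_module_simps[OF i', folded B_def, simplified]
  have B: "left_module R B" unfolding B_def using LR.left_transport[OF i'] .
  interpret B: left_module R B by (rule B)
  have AR: "\<And>a. a \<in> A \<Longrightarrow> a \<in> carrier R" using A[unfolded left_ideal_iff] by blast
  have H: "submodule (i ` A) R B"
    using A AR unfolding B.submodule_iff left_ideal_iff by (auto simp: Bs)
  define \<tau> where "\<tau> = sum_list (map (\<lambda>(x, a). frag_of (x, i a)) ts)"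
  have "(\<lambda>(x, a). frag_of (x, a \<odot>\<^bsub>B\<^esub> i \<one>)) t = (\<lambda>(x, a). frag_of (x, i a)) t" if "t \<in> set ts" for t
  proof (cases t)
    case (Pair x a)
    then have "a \<in> carrier R" using that ts[of x a] AR by blast
    then show ?thesis using Pair by (simp add: Bs)
  qed
  then have eq: "map (\<lambda>(x, a). frag_of (x, a \<odot>\<^bsub>B\<^esub> i \<one>)) ts = map (\<lambda>(x, a). frag_of (x, i a)) ts"
    by simp
  have relB: "\<tau> \<in> tensor_rels R F B"
    unfolding \<tau>_def eq[symmetric]
    by (rule tensor_sum_is_relation[OF F B _ _ zero]) (use ts AR in \<open>auto simp: Bs\<close>)
  have keys: "Poly_Mapping.keys (sum_list (map (\<lambda>(x, a). frag_of (x, i a)) us)) \<subseteq> carrier F \<times> i ` A"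
    if "\<And>x a. (x, a) \<in> set us \<Longrightarrow> x \<in> carrier F \<and> a \<in> A" for us
    using that
  proof (induction us)
    case (Cons t us)
    obtain x a where t: "t = (x, a)" by (cases t)
    show ?case
      using Cons.IH Cons.prems keys_add[of "frag_of (x, i a)" "sum_list (map (\<lambda>(x, a). frag_of (x, i a)) us)"]
      unfolding t by fastforce
  qed simp
  let ?A = "B\<lparr>carrier := i ` A\<rparr>"
  let ?FA = "free_Abelian_group (carrier F \<times> i ` A)"
  have \<tau>: "\<tau> \<in> carrier ?FA"
    using keys[OF ts] by (simp add: \<tau>_def)
  have relA: "\<tau> \<in> tensor_rels R F ?A"
    by (rule flat_submodule_relation[OF flat B H \<tau> relB])
  have Amod: "left_module R ?A" using B.left_submodule[OF H] .
  interpret A: left_module R ?A by (rule Amod)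
  interpret L: additive_subgroup L R by (rule L)
  have im: "(\<lambda>(x, u). h x \<otimes> ?j u) ` (carrier F \<times> i ` A) \<subseteq> carrier (add_monoid R)"
    using h AR i by auto
  obtain \<Psi> where \<Psi>: "\<Psi> \<in> hom ?FA (add_monoid R)"
    and "\<And>p. p \<in> carrier F \<times> i ` A \<Longrightarrow> \<Psi> (frag_of p) = (\<lambda>(x, u). h x \<otimes> ?j u) p"
    using comm_group.free_Abelian_group_universal[OF a_comm_group im] by metis
  then have \<Psi>f: "\<Psi> (frag_of (x, i a)) = h x \<otimes> a" if "x \<in> carrier F" "a \<in> A" for x a
    using that AR i by auto
  have \<Psi>_add: "\<Psi> (s + t) = \<Psi> s \<oplus> \<Psi> t" and \<Psi>c: "\<Psi> s \<in> carrier R"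
    if "s \<in> carrier ?FA" "t \<in> carrier ?FA" for s t
    using \<Psi> that by (auto simp: hom_def simp del: carrier_free_Abelian_group_iff)
  have FAdiff: "s - t \<in> carrier ?FA" if "s \<in> carrier ?FA" "t \<in> carrier ?FA" for s t
    using that keys_diff unfolding carrier_free_Abelian_group_iff by (meson Un_least order_trans)
  have \<Psi>_diff: "\<Psi> (s - t) = \<Psi> s \<ominus> \<Psi> t" if st: "s \<in> carrier ?FA" "t \<in> carrier ?FA" for s t
  proof -
    have "\<Psi> s = \<Psi> (s - t) \<oplus> \<Psi> t" using \<Psi>_add[OF FAdiff[OF st] st(2)] by simp
    then show ?thesis
      using \<Psi>c[OF FAdiff[OF st] st(2)] \<Psi>c[OF st(2,2)] by (simp add: a_minus_def a_assoc r_neg)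
  qed
  have fc: "frag_of (x, i a) \<in> carrier ?FA" if "x \<in> carrier F" "a \<in> A" for x a
    using that by simp
  have Acl: "\<And>a b. a \<in> A \<Longrightarrow> b \<in> A \<Longrightarrow> a \<oplus> b \<in> A" "\<And>a b. a \<in> carrier R \<Longrightarrow> b \<in> A \<Longrightarrow> a \<otimes> b \<in> A"
    using A[unfolded left_ideal_iff] by blast+
  have gens: "\<Psi> g \<in> L" if "g \<in> tensor_gens R F ?A" for g
    using that unfolding tensor_gens_def
  proof (elim UnE CollectE exE conjE)
    fix x y u
    assume g: "g = frag_of (x \<oplus>\<^bsub>F\<^esub> y, u) - frag_of (x, u) - frag_of (y, u)"
      and xy: "x \<in> carrier F" "y \<in> carrier F" and "u \<in> carrier ?A"
    then obtain a where a: "a \<in> A" "u = i a" by auto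
    have "\<Psi> g = h (x \<oplus>\<^bsub>F\<^esub> y) \<otimes> a \<ominus> h x \<otimes> a \<ominus> h y \<otimes> a"
      unfolding g a(2) using xy a by (simp add: \<Psi>_diff FAdiff fc \<Psi>f del: carrier_free_Abelian_group_iff)
    also have "\<dots> = (h (x \<oplus>\<^bsub>F\<^esub> y) \<ominus> (h x \<oplus> h y)) \<otimes> a"
      using xy h a AR by (simp add: a_minus_def l_distr l_minus minus_add a_assoc)
    finally show ?thesis using DA[OF h_add[OF xy] a(1)] by simp
  next
    fix x u v
    assume g: "g = frag_of (x, u \<oplus>\<^bsub>?A\<^esub> v) - frag_of (x, u) - frag_of (x, v)"
      and x: "x \<in> carrier F" and "u \<in> carrier ?A" "v \<in> carrier ?A"
    then obtain a b where ab: "a \<in> A" "u = i a" "b \<in> A" "v = i b" by auto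
    then have uv: "u \<oplus>\<^bsub>?A\<^esub> v = i (a \<oplus> b)" using AR by (simp add: Bs)
    have "\<Psi> g = h x \<otimes> (a \<oplus> b) \<ominus> h x \<otimes> a \<ominus> h x \<otimes> b"
      unfolding g uv unfolding ab(2,4) using x ab Acl
      by (simp add: \<Psi>_diff FAdiff fc \<Psi>f del: carrier_free_Abelian_group_iff)
    also have "\<dots> = (h x \<otimes> a \<oplus> h x \<otimes> b) \<oplus> \<ominus> (h x \<otimes> a \<oplus> h x \<otimes> b)" using x h ab(1,3) AR
      by (simp add: a_minus_def r_distr minus_add a_assoc)
    also have "\<dots> = \<zero>" using x h ab(1,3) AR by (simp add: r_neg)
    finally show ?thesis by simp
  next
    fix a x u
    assume g: "g = frag_of (a \<odot>\<^bsub>F\<^esub> x, u) - frag_of (x, a \<odot>\<^bsub>?A\<^esub> u)"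
      and ax: "a \<in> carrier R" "x \<in> carrier F" and "u \<in> carrier ?A"
    then obtain b where b: "b \<in> A" "u = i b" by auto
    then have au: "a \<odot>\<^bsub>?A\<^esub> u = i (a \<otimes> b)" using AR by (simp add: Bs)
    have "\<Psi> g = h (a \<odot>\<^bsub>F\<^esub> x) \<otimes> b \<ominus> h x \<otimes> (a \<otimes> b)"
      unfolding g au unfolding b(2) using ax b Acl F.act_closed
      by (simp add: \<Psi>_diff FAdiff fc \<Psi>f del: carrier_free_Abelian_group_iff)
    also have "\<dots> = (h (a \<odot>\<^bsub>F\<^esub> x) \<ominus> h x \<otimes> a) \<otimes> b"
      using ax h b AR F.act_closed by (simp add: a_minus_def l_distr l_minus m_assoc)
    finally show ?thesis using DA[OF h_act[OF ax(2,1)] b(1)] by simp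
  qed
  have "\<Psi> \<tau> \<in> L"
    by (rule tensor_gens_hom_vanish[OF F.onesided_module_axioms A.onesided_module_axioms L abelian_group_axioms _ gens relA])
      (use \<Psi> in simp)
  moreover have "\<Psi> (sum_list (map (\<lambda>(x, a). frag_of (x, i a)) us)) = list_sum R (\<lambda>(x, a). h x \<otimes> a) us"
    if "\<And>x a. (x, a) \<in> set us \<Longrightarrow> x \<in> carrier F \<and> a \<in> A" for us
    using that
  proof (induction us)
    case Nil
    have "\<Psi> 0 \<oplus> \<Psi> 0 = \<Psi> 0" using \<Psi>_add[of 0 0] by simp
    then show ?case using \<Psi>c[of 0 0] by simp
  next
    case (Cons t us)
    obtain x a where t: "t = (x, a)" by (cases t)
    have xa: "x \<in> carrier F" "a \<in> A" using Cons.prems[of x a] t by auto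
    have us: "\<And>x a. (x, a) \<in> set us \<Longrightarrow> x \<in> carrier F \<and> a \<in> A"
      by (rule Cons.prems) simp
    have "sum_list (map (\<lambda>(x, a). frag_of (x, i a)) us) \<in> carrier ?FA"
      using keys[OF us] by simp
    then show ?case
      using Cons.IH[OF us] t \<Psi>_add[OF fc[OF xa]] xa by (simp add: \<Psi>f del: carrier_free_Abelian_group_iff)
  qed
  ultimately show ?thesis using ts unfolding \<tau>_def by metis
qed

section \<open>A version of Nakayama's lemma\<close>

text \<open>
The left ideal \<open>D p\<^sub>1 + \<dots> + D p\<^sub>n + S\<close>, by recursion on the generators because Nakayama's lemma
eliminates them one by one.
\<close>

primrec left_span :: "('a, 'c) ring_scheme \<Rightarrow> 'a set \<Rightarrow> 'a set \<Rightarrow> 'a list \<Rightarrow> 'a set" where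
  "left_span R D S [] = S"
| "left_span R D S (p # ps) = {d \<otimes>\<^bsub>R\<^esub> p \<oplus>\<^bsub>R\<^esub> z | d z. d \<in> D \<and> z \<in> left_span R D S ps}"

context ring
begin

lemma left_span_ConsI:
  "d \<in> D \<Longrightarrow> z \<in> left_span R D S ps \<Longrightarrow> d \<otimes> p \<oplus> z \<in> left_span R D S (p # ps)"
  by auto

lemma left_span_left_ideal:
  assumes D: "ideal D R" and S: "ideal S R" and ps: "set ps \<subseteq> carrier R"
  shows "submodule (left_span R D S ps) R (left_regular R)"
  using ps
proof (induction ps)
  case Nil
  interpret S: ideal S R by (rule S)
  show ?case unfolding left_ideal_iff using S.a_subset by (auto simp: S.I_l_closed)
next
  case (Cons p ps)
  interpret D: ideal D R by (rule D)
  let ?L = "left_span R D S ps"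
  have p: "p \<in> carrier R" using Cons.prems by simp
  have L: "?L \<subseteq> carrier R" "\<zero> \<in> ?L" "\<And>x y. x \<in> ?L \<Longrightarrow> y \<in> ?L \<Longrightarrow> x \<oplus> y \<in> ?L"
    "\<And>a x. a \<in> carrier R \<Longrightarrow> x \<in> ?L \<Longrightarrow> a \<otimes> x \<in> ?L"
    using Cons unfolding left_ideal_iff by auto
  show ?case unfolding left_ideal_iff
  proof (intro conjI ballI)
    show "left_span R D S (p # ps) \<subseteq> carrier R" using L p by auto
    show "\<zero> \<in> left_span R D S (p # ps)" using left_span_ConsI[of \<zero> D \<zero> S ps p] L p by simp
    fix x y assume "x \<in> left_span R D S (p # ps)" "y \<in> left_span R D S (p # ps)"
    then obtain d z e w where *: "d \<in> D" "z \<in> ?L" "e \<in> D" "w \<in> ?L"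
      "x = d \<otimes> p \<oplus> z" "y = e \<otimes> p \<oplus> w" by auto
    have c: "d \<in> carrier R" "e \<in> carrier R" "z \<in> carrier R" "w \<in> carrier R"
      using * L D.a_subset by auto
    have "x \<oplus> y = (d \<oplus> e) \<otimes> p \<oplus> (z \<oplus> w)"
      unfolding *(5,6) using c p by (simp add: l_distr a_ac)
    then show "x \<oplus> y \<in> left_span R D S (p # ps)" using left_span_ConsI[of "d \<oplus> e" D "z \<oplus> w" S ps p] * L by simp
  next
    fix a x assume a: "a \<in> carrier R" and "x \<in> left_span R D S (p # ps)"
    then obtain d z where *: "d \<in> D" "z \<in> ?L" "x = d \<otimes> p \<oplus> z" by auto
    have c: "d \<in> carrier R" "z \<in> carrier R" using * L D.a_subset by auto
    have "a \<otimes> x = (a \<otimes> d) \<otimes> p \<oplus> a \<otimes> z"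
      unfolding *(3) using a c p by (simp add: r_distr m_assoc)
    then show "a \<otimes> x \<in> left_span R D S (p # ps)"
      using left_span_ConsI[of "a \<otimes> d" D "a \<otimes> z" S ps p] * L a D.I_l_closed by simp
  qed
qed

lemma left_span_base:
  assumes D: "ideal D R" and S: "ideal S R" and ps: "set ps \<subseteq> carrier R"
  shows "S \<subseteq> left_span R D S ps"
  using ps
proof (induction ps)
  case (Cons p ps)
  interpret D: ideal D R by (rule D)
  interpret S: ideal S R by (rule S)
  have "s \<in> left_span R D S (p # ps)" if "s \<in> S" for s
  proof -
    have "\<zero> \<otimes> p \<oplus> s = s" using that S.a_subset Cons.prems by auto
    moreover have "s \<in> left_span R D S ps" using that Cons by auto
    ultimately show ?thesis using left_span_ConsI[OF D.zero_closed, of s S ps p] by simp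
  qed
  then show ?case by blast
qed simp

lemma left_span_tail:
  assumes D: "ideal D R" and S: "ideal S R" and ps: "set (p # ps) \<subseteq> carrier R"
  shows "left_span R D S ps \<subseteq> left_span R D S (p # ps)"
proof
  fix z assume z: "z \<in> left_span R D S ps"
  interpret D: ideal D R by (rule D)
  have "z \<in> carrier R" using left_span_left_ideal[OF D S, of ps] ps z unfolding left_ideal_iff by auto
  then have "\<zero> \<otimes> p \<oplus> z = z" using ps by simp
  then show "z \<in> left_span R D S (p # ps)"
    using left_span_ConsI[OF D.zero_closed z, of p] by simp
qed

lemma left_span_generator:
  assumes D: "ideal D R" and S: "ideal S R" and ps: "set ps \<subseteq> carrier R"
    and d: "d \<in> D" and p: "p \<in> set ps"
  shows "d \<otimes> p \<in> left_span R D S ps"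
  using ps p
proof (induction ps)
  case (Cons q ps)
  interpret D: ideal D R by (rule D)
  interpret S: ideal S R by (rule S)
  show ?case
  proof (cases "p = q")
    case True
    have "\<zero> \<in> left_span R D S ps" using left_span_base[OF D S, of ps] Cons.prems S.zero_closed by auto
    moreover have "d \<otimes> p \<oplus> \<zero> = d \<otimes> p" using d D.a_subset Cons.prems by auto
    ultimately show ?thesis using left_span_ConsI[OF d, of \<zero> S ps q] True by simp
  next
    case False
    then show ?thesis using Cons left_span_tail[OF D S Cons.prems(1)] by auto
  qed
qed simp

lemma left_span_mult:
  assumes D: "ideal D R" and S: "ideal S R" and ps: "set ps \<subseteq> carrier R"
    and d: "d \<in> D" and a: "a \<in> left_span R (carrier R) S ps"
  shows "d \<otimes> a \<in> left_span R D S ps"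
  using ps a
proof (induction ps arbitrary: a)
  case Nil
  interpret D: ideal D R by (rule D)
  interpret S: ideal S R by (rule S)
  show ?case using Nil d D.a_subset S.I_l_closed by auto
next
  case (Cons p ps)
  interpret D: ideal D R by (rule D)
  obtain r z where *: "r \<in> carrier R" "z \<in> left_span R (carrier R) S ps" "a = r \<otimes> p \<oplus> z"
    using Cons.prems by auto
  have c: "d \<in> carrier R" "p \<in> carrier R" "z \<in> carrier R"
    using d D.a_subset Cons.prems * left_span_left_ideal[OF oneideal S, of ps]
    unfolding left_ideal_iff by auto
  have "d \<otimes> a = (d \<otimes> r) \<otimes> p \<oplus> d \<otimes> z"
    unfolding *(3) using * c by (simp add: r_distr m_assoc)
  moreover have "d \<otimes> z \<in> left_span R D S ps" using Cons.IH[OF _ *(2)] Cons.prems by simp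
  ultimately show ?case using left_span_ConsI[OF D.I_r_closed[OF d *(1)], of "d \<otimes> z" S ps p] by simp
qed

text \<open>
One generator is eliminated at a time: \<open>p = d p + z\<close> with \<open>z\<close> in the span of the others gives
\<open>p \<equiv> v z\<close> modulo \<open>S\<close> for a left inverse \<open>v\<close> of \<open>1 - d\<close> modulo \<open>S\<close>, so that \<open>p\<close> lies in the span of the
others and drops out of their relations.
\<close>

lemma nakayama:
  assumes D: "ideal D R" and S: "ideal S R"
    and inv: "\<And>d. d \<in> D \<Longrightarrow> \<exists>v\<in>carrier R. v \<otimes> (\<one> \<ominus> d) \<ominus> \<one> \<in> S"
    and ps: "set ps \<subseteq> carrier R" and mem: "set ps \<subseteq> left_span R D S ps"
  shows "set ps \<subseteq> S"
  using ps mem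
proof (induction ps)
  case (Cons p ps)
  interpret D: ideal D R by (rule D)
  interpret S: ideal S R by (rule S)
  let ?L = "left_span R D S ps"
  have psc: "set ps \<subseteq> carrier R" and p: "p \<in> carrier R" using Cons.prems by auto
  have lid: "submodule ?L R (left_regular R)" by (rule left_span_left_ideal[OF D S psc])
  then have L: "?L \<subseteq> carrier R" "\<And>x y. x \<in> ?L \<Longrightarrow> y \<in> ?L \<Longrightarrow> x \<oplus> y \<in> ?L"
    "\<And>a x. a \<in> carrier R \<Longrightarrow> x \<in> ?L \<Longrightarrow> a \<otimes> x \<in> ?L"
    unfolding left_ideal_iff by auto
  interpret L: additive_subgroup ?L R by (rule left_ideal_additive_subgroup[OF lid])
  have SL: "S \<subseteq> ?L" by (rule left_span_base[OF D S psc])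
  obtain d z where dz: "d \<in> D" "z \<in> ?L" "p = d \<otimes> p \<oplus> z" using Cons.prems by auto
  obtain v where v: "v \<in> carrier R" "v \<otimes> (\<one> \<ominus> d) \<ominus> \<one> \<in> S" using inv[OF dz(1)] by blast
  have c: "d \<in> carrier R" "z \<in> carrier R" using dz D.a_subset L by auto
  have "z = (\<one> \<ominus> d) \<otimes> p"
  proof -
    have "(\<one> \<ominus> d) \<otimes> p = p \<oplus> (\<ominus> (d \<otimes> p))" using c p by (simp add: a_minus_def l_distr l_minus)
    also have "\<dots> = (d \<otimes> p \<oplus> z) \<oplus> (\<ominus> (d \<otimes> p))" using dz(3) by simp
    also have "\<dots> = z" using c p by (simp add: a_ac r_neg r_neg1 r_neg2)
    finally show ?thesis by simp
  qed
  then have "v \<otimes> z \<ominus> p = (v \<otimes> (\<one> \<ominus> d) \<ominus> \<one>) \<otimes> p"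
    using v c p by (simp add: a_minus_def l_distr l_minus m_assoc)
  then have "v \<otimes> z \<ominus> p \<in> ?L" using S.I_r_closed[OF v(2) p] SL by auto
  moreover have "v \<otimes> z \<in> ?L" using L v dz by blast
  ultimately have "v \<otimes> z \<oplus> \<ominus> (v \<otimes> z \<ominus> p) \<in> ?L" by simp
  moreover have "v \<otimes> z \<oplus> \<ominus> (v \<otimes> z \<ominus> p) = p"
    using v c p by (simp add: a_minus_def minus_add r_neg1 r_neg2)
  ultimately have pL: "p \<in> ?L" by simp
  have red: "left_span R D S (p # ps) \<subseteq> ?L"
    using L pL D.a_subset by auto
  have "set ps \<subseteq> left_span R D S (p # ps)"
    by (rule order_trans[OF _ Cons.prems(2)]) auto
  then have "set ps \<subseteq> S" using Cons.IH[OF psc order_trans[OF _ red]] by blast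
  moreover have "left_span R D S qs \<subseteq> S" if "set qs \<subseteq> S" for qs
    using that by (induction qs) (use D.a_subset S.I_l_closed in auto)
  ultimately have "?L \<subseteq> S" by blast
  then show ?case using pL \<open>set ps \<subseteq> S\<close> by auto
qed simp

end

section \<open>Countable direct sums of a cyclic module\<close>

text \<open>
For an ideal \<open>D\<close> this is the right module \<open>(R/D)\<^sup>(\<^sup>\<nat>\<^sup>)\<close>.  Finite support is expressed by a bound, which
serves as the induction parameter when elements are lifted to a cover.
\<close>

definition finsupp_module :: "('a, 'c) ring_scheme \<Rightarrow> 'a set \<Rightarrow> ('a, nat \<Rightarrow> 'a set) module" where
  "finsupp_module R D =
     \<lparr>carrier = {v. (\<forall>n. v n \<in> carrier (R Quot D)) \<and> (\<exists>N. \<forall>n\<ge>N. v n = \<zero>\<^bsub>R Quot D\<^esub>)},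
      monoid.mult = undefined, one = undefined, ring.zero = (\<lambda>n. \<zero>\<^bsub>R Quot D\<^esub>),
      ring.add = (\<lambda>v w n. v n \<oplus>\<^bsub>R Quot D\<^esub> w n),
      smult = (\<lambda>a v n. v n \<otimes>\<^bsub>R Quot D\<^esub> (D +>\<^bsub>R\<^esub> a))\<rparr>"

lemma finsupp_module_simps:
  "v \<in> carrier (finsupp_module R D) \<longleftrightarrow>
     (\<forall>n. v n \<in> carrier (R Quot D)) \<and> (\<exists>N. \<forall>n\<ge>N. v n = \<zero>\<^bsub>R Quot D\<^esub>)"
  "\<zero>\<^bsub>finsupp_module R D\<^esub> = (\<lambda>n. \<zero>\<^bsub>R Quot D\<^esub>)"
  "v \<oplus>\<^bsub>finsupp_module R D\<^esub> w = (\<lambda>n. v n \<oplus>\<^bsub>R Quot D\<^esub> w n)"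
  "a \<odot>\<^bsub>finsupp_module R D\<^esub> v = (\<lambda>n. v n \<otimes>\<^bsub>R Quot D\<^esub> (D +>\<^bsub>R\<^esub> a))"
  by (simp_all add: finsupp_module_def)

lemma (in ideal) finsupp_right_module: "right_module R (finsupp_module R I)"
proof -
  let ?Q = "R Quot I" and ?M = "finsupp_module R I"
  interpret Q: ring ?Q by (rule quotient_is_ring)
  interpret \<pi>: ring_hom_ring R ?Q "(+>) I" by (rule rcos_ring_hom_ring)
  note s = finsupp_module_simps
  have add: "v \<oplus>\<^bsub>?M\<^esub> w \<in> carrier ?M" if v: "v \<in> carrier ?M" and w: "w \<in> carrier ?M" for v w
  proof -
    obtain N where "\<forall>n\<ge>N. v n = \<zero>\<^bsub>?Q\<^esub>" using v by (auto simp: s)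
    moreover obtain K where "\<forall>n\<ge>K. w n = \<zero>\<^bsub>?Q\<^esub>" using w by (auto simp: s)
    ultimately have "\<forall>n\<ge>max N K. v n \<oplus>\<^bsub>?Q\<^esub> w n = \<zero>\<^bsub>?Q\<^esub>" by simp
    then show ?thesis using v w unfolding s by blast
  qed
  have act: "a \<odot>\<^bsub>?M\<^esub> v \<in> carrier ?M" if a: "a \<in> carrier R" and v: "v \<in> carrier ?M" for a v
  proof -
    obtain N where "\<forall>n\<ge>N. v n = \<zero>\<^bsub>?Q\<^esub>" using v by (auto simp: s)
    then have "\<forall>n\<ge>N. v n \<otimes>\<^bsub>?Q\<^esub> (I +> a) = \<zero>\<^bsub>?Q\<^esub>" using a by simp
    moreover have "\<forall>n. v n \<otimes>\<^bsub>?Q\<^esub> (I +> a) \<in> carrier ?Q" using v a by (simp add: s)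
    ultimately show ?thesis unfolding s by blast
  qed
  have "abelian_group ?M"
  proof (rule abelian_groupI)
    fix v assume v: "v \<in> carrier ?M"
    let ?w = "\<lambda>n. \<ominus>\<^bsub>?Q\<^esub> v n"
    obtain N where "\<forall>n\<ge>N. v n = \<zero>\<^bsub>?Q\<^esub>" using v by (auto simp: s)
    then have "\<forall>n\<ge>N. ?w n = \<zero>\<^bsub>?Q\<^esub>" by simp
    moreover have "\<forall>n. ?w n \<in> carrier ?Q" using v by (simp add: s)
    ultimately have "?w \<in> carrier ?M" unfolding s by blast
    moreover have "?w \<oplus>\<^bsub>?M\<^esub> v = \<zero>\<^bsub>?M\<^esub>" using v by (simp add: s Q.l_neg)
    ultimately show "\<exists>w\<in>carrier ?M. w \<oplus>\<^bsub>?M\<^esub> v = \<zero>\<^bsub>?M\<^esub>" by blast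
  qed (use add in \<open>auto simp: s Q.a_ac\<close>)
  then show ?thesis
    by (intro right_module.intro onesided_module.intro onesided_module_axioms.intro
        right_module_axioms.intro ring_axioms act)
      (auto simp: s Q.r_distr Q.l_distr Q.m_assoc)
qed

text \<open>
The direct sum is no larger than the universe of test modules: cosets are coded by representatives,
and sequences of finite support over an infinite set do not increase its cardinality.
\<close>

lemma (in ideal) ex_inj_finsupp:
  fixes i :: "'a \<Rightarrow> 'm"
  assumes inf: "infinite (UNIV :: 'm set)" and i: "inj_on i (carrier R)"
  obtains j :: "(nat \<Rightarrow> 'a set) \<Rightarrow> 'm" where "inj_on j (carrier (finsupp_module R I))"
proof -
  let ?Q = "R Quot I"
  interpret Q: ring ?Q by (rule quotient_is_ring)
  define \<rho> where "\<rho> C = i (SOME r. r \<in> carrier R \<and> C = I +> r)" for C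
  have \<rho>: "inj_on \<rho> (carrier ?Q)"
  proof (rule inj_onI)
    fix C C' assume "C \<in> carrier ?Q" "C' \<in> carrier ?Q" and eq: "\<rho> C = \<rho> C'"
    then have "\<exists>r. r \<in> carrier R \<and> C = I +> r" "\<exists>r. r \<in> carrier R \<and> C' = I +> r"
      unfolding quotient_carrier by blast+
    from this[THEN someI_ex] show "C = C'"
      using eq inj_onD[OF i] unfolding \<rho>_def by metis
  qed
  let ?k = "\<lambda>_ :: nat. \<rho> \<zero>\<^bsub>?Q\<^esub>"
  let ?F = "{f :: nat \<Rightarrow> 'm. f ` UNIV \<subseteq> UNIV \<and> {n. f n \<noteq> ?k n} \<subseteq> UNIV \<and> finite {n. f n \<noteq> ?k n}}"
  have "carrier (finsupp_module R I) \<lesssim> ?F"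
    unfolding lepoll_def
  proof (intro exI conjI)
    show "inj_on (\<lambda>v n. \<rho> (v n)) (carrier (finsupp_module R I))"
      by (rule inj_onI) (auto simp: finsupp_module_simps fun_eq_iff dest!: inj_onD[OF \<rho>])
    show "(\<lambda>v n. \<rho> (v n)) ` carrier (finsupp_module R I) \<subseteq> ?F"
    proof
      fix f assume "f \<in> (\<lambda>v n. \<rho> (v n)) ` carrier (finsupp_module R I)"
      then obtain v N where "f = (\<lambda>n. \<rho> (v n))" "\<forall>n\<ge>N. v n = \<zero>\<^bsub>?Q\<^esub>"
        by (auto simp: finsupp_module_simps)
      then have "{n. f n \<noteq> ?k n} \<subseteq> {..<N}" by (auto simp: not_le[symmetric])
      then have "finite {n. f n \<noteq> ?k n}" by (rule finite_subset) simp
      then show "f \<in> ?F" by simp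
    qed
  qed
  also have "\<dots> \<lesssim> Fpow ((UNIV :: nat set) \<times> (UNIV :: 'm set))"
    by (rule lepoll_restricted_funspace)
  also have "\<dots> \<approx> (UNIV :: nat set) \<times> (UNIV :: 'm set)"
    by (rule eqpoll_Fpow)
      (use inf finite_cartesian_productD2[of "UNIV :: nat set" "UNIV :: 'm set"] in blast)
  also have "\<dots> \<lesssim> (UNIV :: 'm set) \<times> (UNIV :: 'm set)"
    using inf by (intro times_lepoll_mono) (simp_all add: infinite_le_lepoll)
  also have "\<dots> \<approx> (UNIV :: 'm set)"
    using card_of_Times_same_infinite[OF inf] eqpoll_iff_card_of_ordIso by blast
  finally show thesis using that unfolding lepoll_def by blast
qed

lemma flat_delta_cover_of_embedded_module:
  fixes M :: "('a, 'b) module" and j :: "'b \<Rightarrow> 'm"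
  assumes perf: "right_G_delta_perfect TYPE('m) TYPE('f) R"
    and M: "right_module R M" and j: "inj_on j (carrier M)"
  obtains F :: "('a, 'f) module" and f where "flat_delta_cover TYPE('m) R F M f"
proof -
  interpret M: right_module R M by (rule M)
  let ?T = "transport_module j M"
  note s = transport_module_simps[OF j]
  have T: "right_module R ?T" using M.right_transport[OF j] .
  then obtain F :: "('a, 'f) module" and f where cov: "flat_delta_cover TYPE('m) R F ?T f"
    using perf unfolding right_G_delta_perfect_def by blast
  then have flat: "flat_module TYPE('m) R F" and hom: "f \<in> module_hom R F ?T"
    and onto: "f ` carrier F = carrier ?T" and small: "delta_small (a_kernel F ?T f) R F"
    by (simp_all add: flat_delta_cover_def)
  let ?g = "\<lambda>x. inv_into (carrier M) j (f x)"
  have gx: "?g x \<in> carrier M" "j (?g x) = f x" if "x \<in> carrier F" for x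
  proof -
    have "f x \<in> j ` carrier M" using onto that s(1) by blast
    then show "?g x \<in> carrier M" "j (?g x) = f x" by (simp_all add: inv_into_into f_inv_into_f)
  qed
  have gI: "?g x = m" if "m \<in> carrier M" "f x = j m" for x m
    using that j by simp
  have ghom: "?g \<in> module_hom R F M" unfolding module_hom_def
  proof (intro CollectI conjI ballI Pi_I gx(1))
    fix x y assume xy: "x \<in> carrier F" "y \<in> carrier F"
    have "f (x \<oplus>\<^bsub>F\<^esub> y) = f x \<oplus>\<^bsub>?T\<^esub> f y" using hom xy by (simp add: module_hom_def)
    also have "\<dots> = j (?g x) \<oplus>\<^bsub>?T\<^esub> j (?g y)" using gx(2) xy by simp
    also have "\<dots> = j (?g x \<oplus>\<^bsub>M\<^esub> ?g y)" by (rule s(3)[OF gx(1)[OF xy(1)] gx(1)[OF xy(2)]])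
    finally show "?g (x \<oplus>\<^bsub>F\<^esub> y) = ?g x \<oplus>\<^bsub>M\<^esub> ?g y" using gI gx(1) xy by simp
  next
    fix a x assume ax: "a \<in> carrier R" "x \<in> carrier F"
    have "f (a \<odot>\<^bsub>F\<^esub> x) = a \<odot>\<^bsub>?T\<^esub> f x" using hom ax by (simp add: module_hom_def)
    also have "\<dots> = a \<odot>\<^bsub>?T\<^esub> j (?g x)" using gx(2) ax by simp
    also have "\<dots> = j (a \<odot>\<^bsub>M\<^esub> ?g x)" by (rule s(4)[OF gx(1)[OF ax(2)]])
    finally show "?g (a \<odot>\<^bsub>F\<^esub> x) = a \<odot>\<^bsub>M\<^esub> ?g x" using gI gx(1) ax M.act_closed by simp
  qed
  moreover have "?g ` carrier F = carrier M"
  proof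
    show "?g ` carrier F \<subseteq> carrier M" using gx(1) by blast
    show "carrier M \<subseteq> ?g ` carrier F"
    proof
      fix m assume m: "m \<in> carrier M"
      then have "j m \<in> f ` carrier F" using onto s(1) by blast
      then obtain x where "x \<in> carrier F" "f x = j m" by (metis imageE)
      then show "m \<in> ?g ` carrier F" using gI[OF m, of x] by (metis imageI)
    qed
  qed
  moreover have "a_kernel F M ?g = a_kernel F ?T f"
  proof -
    have "?g x = \<zero>\<^bsub>M\<^esub> \<longleftrightarrow> f x = \<zero>\<^bsub>?T\<^esub>" if x: "x \<in> carrier F" for x
      using gx[OF x] gI[OF M.M.zero_closed, of x] s(2) by metis
    then show ?thesis unfolding a_kernel_def' by blast
  qed
  ultimately have "flat_delta_cover TYPE('m) R F M ?g"
    using flat small by (simp add: flat_delta_cover_def)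
  then show thesis using that by blast
qed

section \<open>T-nilpotence modulo the socle\<close>

definition unit_vector :: "('a, 'c) ring_scheme \<Rightarrow> 'a set \<Rightarrow> nat \<Rightarrow> nat \<Rightarrow> 'a set" where
  "unit_vector R D k n = (if n = k then \<one>\<^bsub>R Quot D\<^esub> else \<zero>\<^bsub>R Quot D\<^esub>)"

text \<open>
The injection \<open>i\<close> serves to present left ideals of \<open>R\<close> as modules on which the flatness of \<open>F\<close> can be tested.
\<close>

locale delta_cover_of_power = ring R for R :: "('a, 'c) ring_scheme" (structure) +
  fixes i :: "'a \<Rightarrow> 'm" and F :: "('a, 'f) module" and f :: "'f \<Rightarrow> nat \<Rightarrow> 'a set"
  assumes i: "inj_on i (carrier R)"
    and cover: "flat_delta_cover TYPE('m) R F (finsupp_module R (delta_right R)) f"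

sublocale delta_cover_of_power \<subseteq> D: ideal "delta_right R" R by (rule delta_ideal)
sublocale delta_cover_of_power \<subseteq> S: ideal "right_socle R" R by (rule socle_ideal)
sublocale delta_cover_of_power \<subseteq> Q: ring "R Quot delta_right R" by (rule D.quotient_is_ring)
sublocale delta_cover_of_power \<subseteq> \<pi>: ring_hom_ring R "R Quot delta_right R" "(+>) (delta_right R)"
  by (rule D.rcos_ring_hom_ring)
sublocale delta_cover_of_power \<subseteq> F: right_module R F
  using cover by (simp add: flat_delta_cover_def flat_module_def)

context delta_cover_of_power
begin

abbreviation "D \<equiv> delta_right R"
abbreviation "S \<equiv> right_socle R"
abbreviation "Q \<equiv> R Quot D"
abbreviation "M \<equiv> finsupp_module R D"
abbreviation "\<epsilon> \<equiv> unit_vector R D"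
abbreviation "act \<equiv> (\<lambda>(x, a). a \<odot>\<^bsub>F\<^esub> x)"

lemma flat: "flat_module TYPE('m) R F" and hom: "f \<in> module_hom R F M"
  and onto: "f ` carrier F = carrier M" and small: "delta_small (a_kernel F M f) R F"
  using cover by (simp_all add: flat_delta_cover_def)

lemma f_closed: "x \<in> carrier F \<Longrightarrow> f x n \<in> carrier Q"
  using hom by (auto simp: module_hom_def finsupp_module_simps(1) Pi_iff)

lemma f_add: "x \<in> carrier F \<Longrightarrow> y \<in> carrier F \<Longrightarrow> f (x \<oplus>\<^bsub>F\<^esub> y) n = f x n \<oplus>\<^bsub>Q\<^esub> f y n"
  using hom by (simp add: module_hom_def finsupp_module_simps)

lemma f_act: "a \<in> carrier R \<Longrightarrow> x \<in> carrier F \<Longrightarrow> f (a \<odot>\<^bsub>F\<^esub> x) n = f x n \<otimes>\<^bsub>Q\<^esub> (D +> a)"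
  using hom by (simp add: module_hom_def finsupp_module_simps)

lemma coset_zero_iff: "a \<in> carrier R \<Longrightarrow> D +> a = \<zero>\<^bsub>Q\<^esub> \<longleftrightarrow> a \<in> D"
  using D.coset_eq_iff[of a \<zero>] \<pi>.hom_zero by (simp add: a_minus_def)

text \<open>
Modulo \<open>FS\<close>, finitely many lifts of unit vectors are linearly independent over \<open>R/S\<close>.  The \<open>i\<close>-th
coordinate of \<open>f\<close> is a homomorphism \<open>F \<rightarrow> R/D\<close> that maps \<open>v\<^sub>k\<close> to the Kronecker delta; by flatness it turns
the relation into \<open>p\<^sub>i \<in> \<Sum> D p\<^sub>k + S\<close>.
\<close>

lemma relation_coefficients_in_socle:
  assumes v: "\<And>k. k < N \<Longrightarrow> v k \<in> carrier F \<and> f (v k) = \<epsilon> k"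
    and p: "\<And>k. k < N \<Longrightarrow> p k \<in> carrier R"
    and zs: "set zs \<subseteq> carrier F \<times> S"
    and zero: "list_sum F act (zs @ map (\<lambda>k. (v k, p k)) [0..<N]) = \<zero>\<^bsub>F\<^esub>"
    and k: "k < N"
  shows "p k \<in> S"
proof -
  define ps where "ps = map p [0..<N]"
  let ?A = "left_span R (carrier R) S ps" and ?L = "left_span R D S ps"
  let ?ts = "zs @ map (\<lambda>k. (v k, p k)) [0..<N]"
  have ps: "set ps \<subseteq> carrier R" using p by (auto simp: ps_def)
  have A: "submodule ?A R (left_regular R)" and lid: "submodule ?L R (left_regular R)"
    using left_span_left_ideal[OF oneideal S.is_ideal ps] left_span_left_ideal[OF D.is_ideal S.is_ideal ps] .
  have L: "additive_subgroup ?L R" using left_ideal_additive_subgroup[OF lid] .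
  interpret L: additive_subgroup ?L R by (rule L)
  have SA: "S \<subseteq> ?A" "S \<subseteq> ?L"
    using left_span_base[OF oneideal S.is_ideal ps] left_span_base[OF D.is_ideal S.is_ideal ps] .
  have Dc: "\<And>d. d \<in> D \<Longrightarrow> d \<in> carrier R" using D.a_subset by blast
  have "p i \<in> ?L" if iN: "i < N" for i
  proof -
    define h where "h x = (SOME r. r \<in> carrier R \<and> f x i = D +> r)" for x
    have h: "h x \<in> carrier R \<and> f x i = D +> h x" if "x \<in> carrier F" for x
      unfolding h_def
      by (rule someI_ex) (use f_closed[OF that, of i] D.quotient_carrier in blast)
    have h_add: "h (x \<oplus>\<^bsub>F\<^esub> y) \<ominus> (h x \<oplus> h y) \<in> D" if "x \<in> carrier F" "y \<in> carrier F" for x y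
    proof -
      have "D +> h (x \<oplus>\<^bsub>F\<^esub> y) = D +> (h x \<oplus> h y)"
        using f_add[OF that, of i] h that by simp
      moreover have "h (x \<oplus>\<^bsub>F\<^esub> y) \<in> carrier R" "h x \<oplus> h y \<in> carrier R" using h that by auto
      ultimately show ?thesis using D.coset_eq_iff by blast
    qed
    have h_act: "h (a \<odot>\<^bsub>F\<^esub> x) \<ominus> h x \<otimes> a \<in> D" if "x \<in> carrier F" "a \<in> carrier R" for x a
    proof -
      have "D +> h (a \<odot>\<^bsub>F\<^esub> x) = D +> (h x \<otimes> a)"
        using f_act[OF that(2,1), of i] h that F.act_closed by simp
      moreover have "h (a \<odot>\<^bsub>F\<^esub> x) \<in> carrier R" "h x \<otimes> a \<in> carrier R"
        using h that F.act_closed by auto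
      ultimately show ?thesis using D.coset_eq_iff by blast
    qed
    have ts: "x \<in> carrier F \<and> a \<in> ?A" if "(x, a) \<in> set ?ts" for x a
    proof -
      have "p k \<in> ?A" if "k < N" for k
        using left_span_generator[OF oneideal S.is_ideal ps one_closed, of "p k"] that p
        by (auto simp: ps_def)
      then show ?thesis using that zs SA v by auto
    qed
    have sum: "list_sum R (\<lambda>(x, a). h x \<otimes> a) ?ts \<in> ?L"
      by (rule flat_relation_vanishes[OF flat i A L, where D = D])
        (use left_span_mult[OF D.is_ideal S.is_ideal ps] h h_add h_act ts zero in auto)
    have "list_sum R (\<lambda>(x, a). h x \<otimes> a) zs \<in> S" (is "?z \<in> S")
      using zs
    proof (induction zs)
      case (Cons t zs)
      then show ?case using h S.I_l_closed by (cases t) auto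
    qed simp
    then have zL: "?z \<in> ?L" using SA by blast
    \<comment> \<open>Only the summand with index \<open>i\<close> survives modulo \<open>L\<close>; the list is kept arbitrary for the induction.\<close>
    have coord: "\<exists>l\<in>?L. list_sum R (\<lambda>(x, a). h x \<otimes> a) (map (\<lambda>k. (v k, p k)) ks)
        = (if i \<in> set ks then p i else \<zero>) \<oplus> l"
      if "set ks \<subseteq> {..<N}" "distinct ks" for ks
      using that
    proof (induction ks)
      case (Cons k ks)
      then obtain l where l: "l \<in> ?L" "list_sum R (\<lambda>(x, a). h x \<otimes> a) (map (\<lambda>k. (v k, p k)) ks)
        = (if i \<in> set ks then p i else \<zero>) \<oplus> l" by auto
      have kN: "k < N" and ni: "k = i \<Longrightarrow> i \<notin> set ks" using Cons.prems by auto
      have vk: "v k \<in> carrier F" "f (v k) = \<epsilon> k" and pk: "p k \<in> carrier R" using v p kN by auto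
      have hk: "h (v k) \<in> carrier R" "f (v k) i = D +> h (v k)"
        using h[OF vk(1)] by blast+
      let ?\<delta> = "if i = k then \<one> else \<zero>"
      define d where "d = h (v k) \<ominus> ?\<delta>"
      have "D +> h (v k) = D +> ?\<delta>"
        using hk vk(2) unfolding unit_vector_def by (auto split: if_splits)
      then have "d \<in> D" unfolding d_def using D.coset_eq_iff hk by auto
      have pL: "d \<otimes> p k \<in> ?L"
        using left_span_generator[OF D.is_ideal S.is_ideal ps \<open>d \<in> D\<close>] kN by (simp add: ps_def)
      have lc: "l \<in> carrier R" and pi: "p i \<in> carrier R" and dc: "d \<in> carrier R"
        using l L.a_subset p iN Dc \<open>d \<in> D\<close> by auto
      have hd: "h (v k) = ?\<delta> \<oplus> d" unfolding d_def using hk by (simp add: a_minus_def r_neg r_neg2 a_ac)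
      have "h (v k) \<otimes> p k = (if i = k then p i else \<zero>) \<oplus> d \<otimes> p k"
        unfolding hd using pk dc by (auto simp: l_distr)
      then have "h (v k) \<otimes> p k \<oplus> ((if i \<in> set ks then p i else \<zero>) \<oplus> l)
          = (if i \<in> set (k # ks) then p i else \<zero>) \<oplus> (d \<otimes> p k \<oplus> l)"
        using ni pi lc dc pk by (auto simp: a_ac)
      moreover have "d \<otimes> p k \<oplus> l \<in> ?L" using pL l by simp
      ultimately show ?case using l(2) by auto
    qed (use L.zero_closed in auto)
    obtain l where l: "l \<in> ?L" "list_sum R (\<lambda>(x, a). h x \<otimes> a) (map (\<lambda>k. (v k, p k)) [0..<N]) = p i \<oplus> l"
      using coord[of "[0..<N]"] iN by (auto simp: atLeast0LessThan)
    have pi: "p i \<in> carrier R" using p iN by blast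
    have c: "?z \<in> carrier R" "l \<in> carrier R" using zL l L.a_subset by auto
    have "list_sum R (\<lambda>(x, a). h x \<otimes> a) ?ts = ?z \<oplus> (p i \<oplus> l)"
      unfolding l(2)[symmetric]
    proof (rule list_sum_append)
      fix t assume t: "t \<in> set ?ts"
      obtain x a where xa: "t = (x, a)" by (cases t)
      then have "x \<in> carrier F" "a \<in> carrier R"
        using ts t A[unfolded left_ideal_iff] by blast+
      then show "(case t of (x, a) \<Rightarrow> h x \<otimes> a) \<in> carrier R" using h xa by simp
    qed
    then have "(?z \<oplus> (p i \<oplus> l)) \<oplus> \<ominus> (?z \<oplus> l) \<in> ?L"
      using sum zL l by simp
    moreover have "(?z \<oplus> (p i \<oplus> l)) \<oplus> \<ominus> (?z \<oplus> l) = p i"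
    proof -
      have "?z \<oplus> (p i \<oplus> l) = p i \<oplus> (?z \<oplus> l)" using c pi by (simp add: a_ac)
      then show ?thesis using c pi by (simp add: a_assoc r_neg)
    qed
    ultimately show ?thesis by simp
  qed
  then have "set ps \<subseteq> ?L" by (auto simp: ps_def)
  then have "set ps \<subseteq> S"
    by (intro nakayama[OF D.is_ideal S.is_ideal _ ps])
      (use delta_one_minus_left_inverse in blast)
  then show ?thesis using k by (auto simp: ps_def)
qed

lemma unit_vector_carrier: "\<epsilon> k \<in> carrier M"
proof -
  have "\<forall>n\<ge>Suc k. \<epsilon> k n = \<zero>\<^bsub>Q\<^esub>" by (simp add: unit_vector_def)
  moreover have "\<forall>n. \<epsilon> k n \<in> carrier Q" by (simp add: unit_vector_def)
  ultimately show ?thesis unfolding finsupp_module_simps by blast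
qed

text \<open>
The submodule \<open>FS + g\<^sub>0 R + \<dots> + g\<^sub>n\<^sub>-\<^sub>1 R\<close>, built one generator at a time so that its elements come with
exactly one coefficient for each \<open>g\<^sub>k\<close>.
\<close>

primrec partial_span :: "(nat \<Rightarrow> 'f) \<Rightarrow> nat \<Rightarrow> 'f set" where
  "partial_span g 0 = {list_sum F act ts | ts. set ts \<subseteq> carrier F \<times> S}"
| "partial_span g (Suc n) = partial_span g n <+>\<^bsub>F\<^esub> ((\<lambda>r. r \<odot>\<^bsub>F\<^esub> g n) ` carrier R)"

lemma partial_span_SucI:
  assumes "x \<in> partial_span g n" "r \<in> carrier R"
  shows "x \<oplus>\<^bsub>F\<^esub> r \<odot>\<^bsub>F\<^esub> g n \<in> partial_span g (Suc n)"
  unfolding partial_span.simps by (rule set_addI[OF assms(1)]) (use assms(2) in blast)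

lemma pair_act_closed: "set ts \<subseteq> carrier F \<times> S \<Longrightarrow> t \<in> set ts \<Longrightarrow> act t \<in> carrier F"
  using F.act_closed S.a_subset by (cases t) auto

lemma partial_span_submodule:
  assumes g: "\<And>n. g n \<in> carrier F"
  shows "submodule (partial_span g n) R F"
proof (induction n)
  case 0
  let ?K = "{list_sum F act ts | ts. set ts \<subseteq> carrier F \<times> S}"
  have "submodule ?K R F" unfolding F.submodule_iff
  proof (intro conjI ballI)
    show "?K \<subseteq> carrier F" using F.list_sum_closed[of _ act] pair_act_closed by auto
    show "\<zero>\<^bsub>F\<^esub> \<in> ?K" by (auto intro!: exI[of _ "[]"])
    fix x y assume "x \<in> ?K" "y \<in> ?K"
    then obtain ts us where *: "set ts \<subseteq> carrier F \<times> S" "x = list_sum F act ts"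
      "set us \<subseteq> carrier F \<times> S" "y = list_sum F act us" by blast
    then have "x \<oplus>\<^bsub>F\<^esub> y = list_sum F act (ts @ us)"
      using F.list_sum_append[of ts us act] pair_act_closed[of "ts @ us"] by auto
    then show "x \<oplus>\<^bsub>F\<^esub> y \<in> ?K" using * by (auto intro!: exI[of _ "ts @ us"])
  next
    fix a x assume a: "a \<in> carrier R" and "x \<in> ?K"
    then obtain ts where ts: "set ts \<subseteq> carrier F \<times> S" "x = list_sum F act ts" by blast
    have "a \<odot>\<^bsub>F\<^esub> list_sum F act ts = list_sum F act (map (\<lambda>(x, s). (x, s \<otimes> a)) ts)"
      using ts(1)
    proof (induction ts)
      case Nil
      then show ?case using F.act_zero a by simp
    next
      case (Cons t ts)
      obtain x s where t: "t = (x, s)" by (cases t)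
      have xs: "x \<in> carrier F" "s \<in> carrier R" using Cons.prems t S.a_subset by auto
      have "list_sum F act ts \<in> carrier F"
        using F.list_sum_closed[of ts act] pair_act_closed[of ts] Cons.prems by auto
      then show ?case
        using Cons t a xs by (simp add: F.act_add_vector F.act_closed F.right_assoc)
    qed
    moreover have "set (map (\<lambda>(x, s). (x, s \<otimes> a)) ts) \<subseteq> carrier F \<times> S"
      using ts(1) S.I_r_closed a by auto
    ultimately show "a \<odot>\<^bsub>F\<^esub> x \<in> ?K" using ts(2) by blast
  qed
  then show ?case by simp
next
  case (Suc n)
  then show ?case
    using F.submodule_plus[OF Suc F.scalar_image_submodule[OF right_ideal_carrier_set g]] by simp
qed

lemma partial_span_mono:
  assumes g: "\<And>n. g n \<in> carrier F" and "m \<le> n"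
  shows "partial_span g m \<subseteq> partial_span g n"
proof -
  have "partial_span g n \<subseteq> partial_span g (Suc n)" for n
    using F.subset_plus(1)[OF partial_span_submodule[OF g]
        F.scalar_image_submodule[OF right_ideal_carrier_set g]] by simp
  then show ?thesis using lift_Suc_mono_le[of "partial_span g"] assms(2) by blast
qed

lemma partial_span_elem:
  assumes g: "\<And>n. g n \<in> carrier F" and x: "x \<in> partial_span g n"
  obtains zs r where "set zs \<subseteq> carrier F \<times> S" "\<forall>k. r k \<in> carrier R"
    "x = list_sum F act (zs @ map (\<lambda>k. (g k, r k)) [0..<n])"
proof -
  have "\<exists>zs r. set zs \<subseteq> carrier F \<times> S \<and> (\<forall>k. r k \<in> carrier R) \<and>
    x = list_sum F act (zs @ map (\<lambda>k. (g k, r k)) [0..<n])" using x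
  proof (induction n arbitrary: x)
    case 0
    then obtain zs where "set zs \<subseteq> carrier F \<times> S" "x = list_sum F act zs" by auto
    then show ?case by (intro exI[of _ zs] exI[of _ "\<lambda>_. \<zero>"]) simp
  next
    case (Suc n)
    then have "x \<in> partial_span g n <+>\<^bsub>F\<^esub> ((\<lambda>r. r \<odot>\<^bsub>F\<^esub> g n) ` carrier R)" by simp
    then obtain y w where y: "y \<in> partial_span g n" "w \<in> (\<lambda>r. r \<odot>\<^bsub>F\<^esub> g n) ` carrier R"
      "x = y \<oplus>\<^bsub>F\<^esub> w" by (rule set_addE)
    then obtain s where s: "s \<in> carrier R" "w = s \<odot>\<^bsub>F\<^esub> g n" by blast
    obtain zs r where zs: "set zs \<subseteq> carrier F \<times> S" and r: "\<forall>k. r k \<in> carrier R"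
      and yy: "y = list_sum F act (zs @ map (\<lambda>k. (g k, r k)) [0..<n])"
      using Suc.IH[OF y(1)] by blast
    let ?r = "r(n := s)"
    let ?us = "zs @ map (\<lambda>k. (g k, ?r k)) [0..<n]"
    have us: "zs @ map (\<lambda>k. (g k, r k)) [0..<n] = ?us" by simp
    have actF: "act t \<in> carrier F" if t: "t \<in> set (?us @ [(g n, ?r n)])" for t
    proof (cases "t \<in> set zs")
      case True
      then show ?thesis using pair_act_closed[OF zs] by blast
    next
      case False
      then obtain x a where "t = (x, a)" "x \<in> carrier F" "a \<in> carrier R"
        using t g r s by auto
      then show ?thesis using F.act_closed by simp
    qed
    have app: "list_sum F act (?us @ [(g n, ?r n)]) = list_sum F act ?us \<oplus>\<^bsub>F\<^esub> list_sum F act [(g n, ?r n)]"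
      by (rule F.list_sum_append) (rule actF)
    have "list_sum F act (?us @ [(g n, ?r n)]) = y \<oplus>\<^bsub>F\<^esub> w"
      unfolding app yy us using s g F.act_closed by simp
    then have "x = list_sum F act (zs @ map (\<lambda>k. (g k, ?r k)) [0..<Suc n])"
      using y(3) by simp
    moreover have "\<forall>k. ?r k \<in> carrier R" using r s by simp
    ultimately show ?case using zs by blast
  qed
  then show thesis using that by blast
qed

lemma finsupp_lift:
  assumes g: "\<And>n. g n \<in> carrier F" and fg: "\<And>n. f (g n) = \<epsilon> n"
    and v: "\<And>n. v n \<in> carrier Q" and vN: "\<And>n. n \<ge> N \<Longrightarrow> v n = \<zero>\<^bsub>Q\<^esub>"
  shows "\<exists>k \<in> partial_span g N. f k = v"
  using v vN
proof (induction N arbitrary: v)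
  case 0
  have z: "\<zero>\<^bsub>F\<^esub> \<in> carrier F" by simp
  have "f \<zero>\<^bsub>F\<^esub> n = \<zero>\<^bsub>Q\<^esub>" for n
  proof -
    have "f \<zero>\<^bsub>F\<^esub> n \<oplus>\<^bsub>Q\<^esub> f \<zero>\<^bsub>F\<^esub> n = f \<zero>\<^bsub>F\<^esub> n" using f_add[OF z z, of n] by simp
    then show ?thesis using f_closed[OF z, of n] by simp
  qed
  moreover have "\<zero>\<^bsub>F\<^esub> \<in> partial_span g 0"
    using partial_span_submodule[of g 0, OF g] unfolding F.submodule_iff by blast
  moreover have "v n = \<zero>\<^bsub>Q\<^esub>" for n using 0(2) by simp
  ultimately have "f \<zero>\<^bsub>F\<^esub> = v" by (simp add: fun_eq_iff)
  then show ?case using \<open>\<zero>\<^bsub>F\<^esub> \<in> partial_span g 0\<close> by blast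
next
  case (Suc N)
  let ?w = "v(N := \<zero>\<^bsub>Q\<^esub>)"
  have "?w n = \<zero>\<^bsub>Q\<^esub>" if "n \<ge> N" for n using that Suc.prems(2)[of n] by (cases "n = N") auto
  moreover have "?w n \<in> carrier Q" for n using Suc.prems(1) by simp
  ultimately obtain k where k: "k \<in> partial_span g N" "f k = ?w" using Suc.IH[of ?w] by blast
  obtain r where r: "r \<in> carrier R" "v N = D +> r" using Suc.prems(1)[of N] D.quotient_carrier by auto
  let ?x = "k \<oplus>\<^bsub>F\<^esub> r \<odot>\<^bsub>F\<^esub> g N"
  have kc: "k \<in> carrier F" using F.submodule_carrier[OF partial_span_submodule[OF g] k(1)] .
  have rg: "r \<odot>\<^bsub>F\<^esub> g N \<in> carrier F" using F.act_closed r g by blast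
  have "f ?x n = v n" for n
    using f_add[OF kc rg, of n] f_act[OF r(1) g, of N n] k(2) fg r Suc.prems(1)[of n]
    by (auto simp: unit_vector_def)
  moreover have "?x \<in> partial_span g (Suc N)"
    using partial_span_SucI[OF k(1) r(1)] .
  ultimately show ?case by blast
qed

lemma left_growing_prod_closed:
  assumes "\<And>k. k \<ge> 1 \<Longrightarrow> a k \<in> carrier R" shows "left_growing_prod R a n \<in> carrier R"
  using assms by (induction n) auto

text \<open>
Lifts of the unit vectors generate \<open>F\<close> modulo \<open>FS\<close>: what they generate covers the direct sum, hence
supplements the \<open>\<delta>\<close>-small kernel.
\<close>

lemma partial_span_union:
  assumes g: "\<And>n. g n \<in> carrier F" and fg: "\<And>n. f (g n) = \<epsilon> n"
  shows "(\<Union>n. partial_span g n) = carrier F"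
proof (rule F.delta_small_supplement[OF small])
  have sub: "submodule (partial_span g n) R F" for n by (rule partial_span_submodule) (rule g)
  let ?K = "\<Union>n. partial_span g n"
  show K: "submodule ?K R F" unfolding F.submodule_iff
  proof (intro conjI ballI)
    show "?K \<subseteq> carrier F" using F.submodule_carrier[OF sub] by blast
    show "\<zero>\<^bsub>F\<^esub> \<in> ?K" using sub unfolding F.submodule_iff by blast
    fix x y assume "x \<in> ?K" "y \<in> ?K"
    then obtain m n where "x \<in> partial_span g m" "y \<in> partial_span g n" by blast
    then have "x \<in> partial_span g (max m n)" "y \<in> partial_span g (max m n)"
      using partial_span_mono[OF g] by (meson max.cobounded1 max.cobounded2 subsetD)+
    then have "x \<oplus>\<^bsub>F\<^esub> y \<in> partial_span g (max m n)" using sub[unfolded F.submodule_iff] by blast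
    then show "x \<oplus>\<^bsub>F\<^esub> y \<in> ?K" by blast
  next
    fix a x assume "a \<in> carrier R" "x \<in> ?K"
    then show "a \<odot>\<^bsub>F\<^esub> x \<in> ?K" using sub[unfolded F.submodule_iff] by blast
  qed
  show "s \<odot>\<^bsub>F\<^esub> y \<in> ?K" if s: "s \<in> S" and y: "y \<in> carrier F" for s y
  proof -
    have "s \<odot>\<^bsub>F\<^esub> y = list_sum F act [(y, s)]" using s y S.a_subset F.act_closed by auto
    then have "s \<odot>\<^bsub>F\<^esub> y \<in> partial_span g 0" using s y by (auto intro!: exI[of _ "[(y, s)]"])
    then show ?thesis by blast
  qed
  have N: "submodule (a_kernel F M f) R F" using small by (simp add: delta_small_def)
  have "x \<in> a_kernel F M f <+>\<^bsub>F\<^esub> ?K" if x: "x \<in> carrier F" for x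
  proof -
    have "f x \<in> carrier M" using onto x by blast
    then obtain N where "\<And>n. f x n \<in> carrier Q" "\<And>n. n \<ge> N \<Longrightarrow> f x n = \<zero>\<^bsub>Q\<^esub>"
      unfolding finsupp_module_simps by blast
    then obtain k where k: "k \<in> partial_span g N" "f k = f x"
      using finsupp_lift[OF g fg, of "f x" N] by blast
    have kc: "k \<in> carrier F" using F.submodule_carrier[OF sub k(1)] .
    let ?y = "x \<ominus>\<^bsub>F\<^esub> k"
    have yk: "?y \<oplus>\<^bsub>F\<^esub> k = x" using x kc by (simp add: a_minus_def F.M.a_assoc F.M.l_neg)
    have yc: "?y \<in> carrier F" using x kc by simp
    have "f ?y n = \<zero>\<^bsub>Q\<^esub>" for n
    proof -
      have "f ?y n \<oplus>\<^bsub>Q\<^esub> f x n = f x n" using f_add[OF yc kc, of n] yk k(2) by simp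
      then show ?thesis using f_closed[OF yc, of n] f_closed[OF x, of n] by simp
    qed
    then have "?y \<in> a_kernel F M f"
      using yc by (auto simp: a_kernel_def' finsupp_module_simps)
    then show ?thesis using set_addI[of ?y "a_kernel F M f" k ?K F] k(1) yk by auto
  qed
  moreover have "a_kernel F M f <+>\<^bsub>F\<^esub> ?K \<subseteq> carrier F"
    using F.submodule_carrier[OF F.submodule_plus[OF N K]] by blast
  ultimately show "a_kernel F M f <+>\<^bsub>F\<^esub> ?K = carrier F" by blast
qed

text \<open>
Bass's argument.  The elements \<open>g\<^sub>k = y\<^sub>k - y\<^sub>k\<^sub>+\<^sub>1 a\<^sub>k\<^sub>+\<^sub>1\<close> lift the same unit vectors as the \<open>y\<^sub>k\<close>, since \<open>f\<close>
takes values in a module annihilated by \<open>D\<close>.  They therefore generate \<open>y\<^sub>0\<close> modulo \<open>FS\<close>, whereas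
telescoping leaves the remainder \<open>y\<^sub>n a\<^sub>n \<cdots> a\<^sub>1\<close>.
\<close>

lemma left_growing_prod_in_socle:
  assumes a: "\<And>k. k \<ge> 1 \<Longrightarrow> a k \<in> D"
  shows "\<exists>n\<ge>1. left_growing_prod R a n \<in> S"
proof -
  let ?P = "left_growing_prod R a"
  have ac: "a (Suc k) \<in> carrier R" for k using a D.a_subset by auto
  have Pc: "?P n \<in> carrier R" for n using left_growing_prod_closed a D.a_subset by blast
  have "\<forall>k. \<exists>y\<in>carrier F. f y = \<epsilon> k"
    using onto unit_vector_carrier by (metis imageE)
  then obtain y where y: "\<And>k. y k \<in> carrier F" "\<And>k. f (y k) = \<epsilon> k" by metis
  define g where "g k = y k \<oplus>\<^bsub>F\<^esub> (\<ominus> a (Suc k)) \<odot>\<^bsub>F\<^esub> y (Suc k)" for k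
  have ayc: "(\<ominus> a (Suc k)) \<odot>\<^bsub>F\<^esub> y (Suc k) \<in> carrier F" "a (Suc k) \<odot>\<^bsub>F\<^esub> y (Suc k) \<in> carrier F" for k
    using F.act_closed ac y by auto
  have g: "g k \<in> carrier F" for k using ayc y by (simp add: g_def)
  have fg: "f (g k) = \<epsilon> k" for k
  proof
    fix n
    have "D +> (\<ominus> a (Suc k)) = \<zero>\<^bsub>Q\<^esub>" using coset_zero_iff a ac by simp
    then have "f ((\<ominus> a (Suc k)) \<odot>\<^bsub>F\<^esub> y (Suc k)) n = \<zero>\<^bsub>Q\<^esub>"
      using f_act[of "\<ominus> a (Suc k)" "y (Suc k)" n] f_closed[OF y(1), of "Suc k" n] ac y(1) by simp
    then show "f (g k) n = \<epsilon> k n"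
      using f_add[OF y(1) ayc(1), of k k n] f_closed[OF y(1), of k n] y(2) by (simp add: g_def)
  qed
  have yg: "y k = g k \<oplus>\<^bsub>F\<^esub> a (Suc k) \<odot>\<^bsub>F\<^esub> y (Suc k)" for k
    using y(1) ac ayc by (simp add: g_def F.minus_act F.M.a_assoc F.M.l_neg)
  have sub: "submodule (partial_span g n) R F" for n by (rule partial_span_submodule) (rule g)
  have tele: "\<exists>k \<in> partial_span g m. y 0 = k \<oplus>\<^bsub>F\<^esub> ?P m \<odot>\<^bsub>F\<^esub> y m" for m
  proof (induction m)
    case 0
    have "\<zero>\<^bsub>F\<^esub> \<in> partial_span g 0" using sub unfolding F.submodule_iff by blast
    moreover have "y 0 = \<zero>\<^bsub>F\<^esub> \<oplus>\<^bsub>F\<^esub> ?P 0 \<odot>\<^bsub>F\<^esub> y 0" using y(1) F.act_one by simp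
    ultimately show ?case by blast
  next
    case (Suc m)
    then obtain k where k: "k \<in> partial_span g m" "y 0 = k \<oplus>\<^bsub>F\<^esub> ?P m \<odot>\<^bsub>F\<^esub> y m" by blast
    have kc: "k \<in> carrier F" using F.submodule_carrier[OF sub k(1)] .
    have "?P m \<odot>\<^bsub>F\<^esub> y m = ?P m \<odot>\<^bsub>F\<^esub> g m \<oplus>\<^bsub>F\<^esub> ?P (Suc m) \<odot>\<^bsub>F\<^esub> y (Suc m)"
      using yg[of m] Pc g ac y(1) ayc by (simp add: F.act_add_vector F.right_assoc)
    then have "y 0 = (k \<oplus>\<^bsub>F\<^esub> ?P m \<odot>\<^bsub>F\<^esub> g m) \<oplus>\<^bsub>F\<^esub> ?P (Suc m) \<odot>\<^bsub>F\<^esub> y (Suc m)"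
      using k(2) kc F.act_closed Pc g y(1) by (simp add: F.M.a_assoc del: left_growing_prod.simps)
    moreover have "k \<oplus>\<^bsub>F\<^esub> ?P m \<odot>\<^bsub>F\<^esub> g m \<in> partial_span g (Suc m)"
      using partial_span_SucI[OF k(1) Pc] .
    ultimately show ?case by blast
  qed
  obtain m where m: "y 0 \<in> partial_span g m" using partial_span_union[OF g fg] y(1) by blast
  \<comment> \<open>The index is raised by one since T-nilpotence asks for a nonempty product.\<close>
  define n where "n = Suc m"
  have y0: "y 0 \<in> partial_span g n" using partial_span_mono[of g m n, OF g] m unfolding n_def by auto
  obtain k where k: "k \<in> partial_span g n" "y 0 = k \<oplus>\<^bsub>F\<^esub> ?P n \<odot>\<^bsub>F\<^esub> y n" using tele by blast
  have kc: "k \<in> carrier F" using F.submodule_carrier[OF sub k(1)] .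
  have Py: "?P n \<odot>\<^bsub>F\<^esub> y n \<in> carrier F" using F.act_closed Pc y by blast
  have "y 0 \<ominus>\<^bsub>F\<^esub> k \<in> partial_span g n" using F.submodule_minus_closed[OF sub y0 k(1)] .
  moreover have "y 0 \<ominus>\<^bsub>F\<^esub> k = ?P n \<odot>\<^bsub>F\<^esub> y n"
    unfolding k(2) using kc Py by (simp add: a_minus_def F.M.a_ac F.M.r_neg1 F.M.r_neg2)
  ultimately have "?P n \<odot>\<^bsub>F\<^esub> y n \<in> partial_span g n" by simp
  from this obtain zs r where zs: "set zs \<subseteq> carrier F \<times> S" and r: "\<forall>k. r k \<in> carrier R"
    and eq: "?P n \<odot>\<^bsub>F\<^esub> y n = list_sum F act (zs @ map (\<lambda>k. (g k, r k)) [0..<n])"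
    by (rule partial_span_elem[OF g])
  \<comment> \<open>The relation among \<open>g\<^sub>0, \<dots>, g\<^sub>n\<^sub>-\<^sub>1, y\<^sub>n\<close>, with the product, up to sign, as the coefficient of \<open>y\<^sub>n\<close>.\<close>
  let ?v = "g(n := y n)" and ?p = "r(n := \<ominus> ?P n)"
  let ?us = "zs @ map (\<lambda>k. (?v k, ?p k)) [0..<n]"
  have us: "zs @ map (\<lambda>k. (g k, r k)) [0..<n] = ?us" by simp
  have actF: "act t \<in> carrier F" if t: "t \<in> set (?us @ [(?v n, ?p n)])" for t
  proof (cases "t \<in> set zs")
    case True
    then show ?thesis using pair_act_closed[OF zs] by blast
  next
    case False
    then obtain x b where "t = (x, b)" "x \<in> carrier F" "b \<in> carrier R"
      using t g r y Pc by auto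
    then show ?thesis using F.act_closed by simp
  qed
  have app: "list_sum F act (?us @ [(?v n, ?p n)]) = list_sum F act ?us \<oplus>\<^bsub>F\<^esub> list_sum F act [(?v n, ?p n)]"
    by (rule F.list_sum_append) (rule actF)
  have "list_sum F act (?us @ [(?v n, ?p n)]) = \<zero>\<^bsub>F\<^esub>"
    unfolding app eq[unfolded us, symmetric] using Py Pc y by (simp add: F.minus_act F.M.r_neg)
  then have zero: "list_sum F act (zs @ map (\<lambda>k. (?v k, ?p k)) [0..<Suc n]) = \<zero>\<^bsub>F\<^esub>" by simp
  have "?p n \<in> S"
    by (rule relation_coefficients_in_socle[OF _ _ zs zero]) (use g fg y r Pc in auto)
  then have "\<ominus> (\<ominus> ?P n) \<in> S" using S.a_inv_closed by simp
  then have "?P n \<in> S" using Pc by simp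
  then show ?thesis unfolding n_def by (intro exI[of _ "Suc m"]) simp
qed

end

theorem theorem3p10:
  fixes R :: "('a, 'c) ring_scheme"
    and i :: "'a \<Rightarrow> 'm"
  assumes "ring R"
    and "infinite (UNIV :: 'm set)"
    and "inj_on i (carrier R)"
    and "right_G_delta_perfect TYPE('m) TYPE('f) R"
  shows "right_T_nilpotent (R Quot right_socle R) (jacobson_radical (R Quot right_socle R))
    \<and> idempotents_lift_modulo R (delta_right R)"
proof -
  interpret ring R by (rule assms(1))
  let ?S = "right_socle R" and ?D = "delta_right R"
  interpret S: ideal ?S R by (rule socle_ideal)
  interpret D: ideal ?D R by (rule delta_ideal)
  interpret QS: ring "R Quot ?S" by (rule S.quotient_is_ring)
  interpret \<pi>S: ring_hom_ring R "R Quot ?S" "(+>\<^bsub>R\<^esub>) ?S" by (rule S.rcos_ring_hom_ring)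
  obtain j :: "(nat \<Rightarrow> 'a set) \<Rightarrow> 'm" where j: "inj_on j (carrier (finsupp_module R ?D))"
    using D.ex_inj_finsupp[OF assms(2,3)] .
  obtain F :: "('a, 'f) module" and f where
    "flat_delta_cover TYPE('m) R F (finsupp_module R ?D) f"
    using flat_delta_cover_of_embedded_module[OF assms(4) D.finsupp_right_module j] .
  then interpret delta_cover_of_power R i F f
    by unfold_locales (rule assms(3))
  have "right_T_nilpotent (R Quot ?S) (jacobson_radical (R Quot ?S))"
    unfolding right_T_nilpotent_def
  proof (intro allI impI)
    fix s :: "nat \<Rightarrow> 'a set"
    assume s: "\<forall>k\<ge>1. s k \<in> jacobson_radical (R Quot ?S)"
    have "\<exists>d\<in>?D. s k = ?S +>\<^bsub>R\<^esub> d" if "k \<ge> 1" for k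
    proof -
      have sk: "s k \<in> jacobson_radical (R Quot ?S)" using s that by blast
      then have "s k \<in> carrier (R Quot ?S)" by (simp add: jacobson_radical_def)
      then obtain d where "d \<in> carrier R" "s k = ?S +>\<^bsub>R\<^esub> d" unfolding S.quotient_carrier by blast
      then show ?thesis using delta_right_iff[of d] sk by auto
    qed
    then obtain a where a: "\<And>k. k \<ge> 1 \<Longrightarrow> a k \<in> ?D" "\<And>k. k \<ge> 1 \<Longrightarrow> s k = ?S +>\<^bsub>R\<^esub> a k" by metis
    have ac: "a k \<in> carrier R" if "k \<ge> 1" for k using a that D.a_subset by blast
    have prod: "left_growing_prod (R Quot ?S) s n = ?S +>\<^bsub>R\<^esub> left_growing_prod R a n" for n
      by (induction n) (use a ac left_growing_prod_closed in auto)
    obtain n where n: "n \<ge> 1" "left_growing_prod R a n \<in> ?S"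
      using left_growing_prod_in_socle a by blast
    have c: "left_growing_prod R a n \<in> carrier R" using n S.a_subset by blast
    have "?S +>\<^bsub>R\<^esub> left_growing_prod R a n = ?S +>\<^bsub>R\<^esub> \<zero>\<^bsub>R\<^esub>"
      using S.coset_eq_iff[OF c zero_closed] n c by (simp add: a_minus_def)
    then show "\<exists>n\<ge>1. left_growing_prod (R Quot ?S) s n = \<zero>\<^bsub>R Quot ?S\<^esub>"
      using n prod[of n] \<pi>S.hom_zero by auto
  qed
  moreover have "idempotents_lift_modulo R ?D"
  proof (rule idempotents_lift_modulo_delta)
    fix s assume s: "s \<in> ?D"
    have sc: "s \<in> carrier R" using s D.a_subset by blast
    have "left_growing_prod R (\<lambda>_. s) n = s [^]\<^bsub>R\<^esub> n" for n
    proof (induction n)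
      case (Suc n)
      then show ?case using nat_pow_Suc2[OF sc, of n] by simp
    qed simp
    then show "\<exists>n\<ge>1::nat. s [^]\<^bsub>R\<^esub> n \<in> ?S"
      using left_growing_prod_in_socle[of "\<lambda>_. s"] s by auto
  qed
  ultimately show ?thesis by blast
qed

end
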